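(* Let $N\ge1$, $0<s<1$, $n\ge0$, and $u_0\in L^1(\mathbb{R}^N)$, $u_0\ge0$. Let $u$ be a strong solution of $\partial_t u+(-\Delta)^s\phi(u)=0$ in $\mathbb{R}^N\times(0,\infty)$ with initial datum $u_0$, and for $\varepsilon>0$ let $u_\varepsilon$ be the approximate solution with initial datum $u_0+\varepsilon$. Then $u\le u_\varepsilon$ a.e. in $\mathbb{R}^N\times(0,\infty)$.
   Context: $(-\Delta)^s v(x)=c(N,s)\,\mathrm{p.v.}\int_{\mathbb{R}^N}\frac{v(x)-v(y)}{|x-y|^{N+2s}}\,dy$. The nonlinearity is $\phi(u)=-u^{-n}$ for $n>0$, $\phi(u)=\log u$ for $n=0$. A weak (energy) solution is a nonnegative $u$ with $u\in C^0((0,\infty);L^1(\mathbb{R}^N))$, $\phi(u)\in L^2_{loc}(0,\infty;\dot H^s(\mathbb{R}^N))$ and $\int_0^\infty\!\int u\,\partial_t\zeta-\int_0^\infty\!\int(-\Delta)^{s/2}\phi(u)(-\Delta)^{s/2}\zeta=0$ for all $\zeta\in C_c^\infty(\mathbb{R}^N\times(0,\infty))$; it is strong if moreover $u\in C((0,\infty);L^1(\mathbb{R}^N))$ and $\partial_t u(\cdot,t)\in L^1(\mathbb{R}^N)$ for every $t>0$. Approximate solutions: with $\phi_\varepsilon(v)=\phi(v+\varepsilon)-\phi(\varepsilon)$, $v_\varepsilon$ is the unique nonnegative weak solution of $\partial_t v+(-\Delta)^s\phi_\varepsilon(v)=0$, $v(\cdot,0)=u_0$ (in the same weak sense with $\phi_\varepsilon$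 in place of $\phi$, and $v\in C^0([0,\infty);L^1)$), and $u_\varepsilon=v_\varepsilon+\varepsilon$. *)

theory Defs
  imports "HOL-Analysis.Analysis"
begin

coinductive smooth_fun :: "('a::euclidean_space \<Rightarrow> real) \<Rightarrow> bool" where
  "(\<And>x. f differentiable (at x)) \<Longrightarrow>
   (\<And>b. b \<in> Basis \<Longrightarrow> smooth_fun (\<lambda>x. frechet_derivative f (at x) b)) \<Longrightarrow>
   smooth_fun f"

definition test_fun :: "('a::euclidean_space \<times> real \<Rightarrow> real) \<Rightarrow> bool" where
  "test_fun \<zeta> \<longleftrightarrow> smooth_fun \<zeta> \<and>
     (\<exists>K. compact K \<and> K \<subseteq> UNIV \<times> {0<..} \<and> (\<forall>z. z \<notin> K \<longrightarrow> \<zeta> z = 0))"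

definition dt :: "('a::euclidean_space \<times> real \<Rightarrow> real) \<Rightarrow> 'a \<times> real \<Rightarrow> real" where
  "dt \<zeta> z = frechet_derivative \<zeta> (at z) (0, 1)"

definition phi :: "real \<Rightarrow> real \<Rightarrow> real" where
  "phi n u = (if n > 0 then - (u powr (- n)) else ln u)"

definition phi_eps :: "real \<Rightarrow> real \<Rightarrow> real \<Rightarrow> real" where
  "phi_eps n \<epsilon> v = phi n (v + \<epsilon>) - phi n \<epsilon>"

(* normalising constant c(N,s) of the fractional Laplacian *)
definition cNs :: "nat \<Rightarrow> real \<Rightarrow> real" where
  "cNs N s = s * 4 powr s * Gamma ((real N + 2 * s) / 2) / (pi powr (real N / 2) * Gamma (1 - s))"

definition kern :: "real \<Rightarrow> 'a::euclidean_space \<Rightarrow> 'a \<Rightarrow> real" where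
  "kern s x y = 1 / (norm (x - y) powr (real DIM('a) + 2 * s))"

definition L1_cont :: "real set \<Rightarrow> ('a::euclidean_space \<Rightarrow> real \<Rightarrow> real) \<Rightarrow> bool" where
  "L1_cont T u \<longleftrightarrow>
     (\<forall>t\<in>T. integrable lebesgue (\<lambda>x. u x t)) \<and>
     (\<forall>t\<in>T. ((\<lambda>t'. LINT x|lebesgue. \<bar>u x t' - u x t\<bar>) \<longlongrightarrow> 0) (at t within T))"

definition jmeas :: "('a::euclidean_space \<Rightarrow> real \<Rightarrow> real) \<Rightarrow> bool" where
  "jmeas u \<longleftrightarrow> (\<lambda>z. u (fst z) (snd z)) \<in> borel_measurable lebesgue"

(* f \<in> L^2_loc(0,\<infinity>; \<dot>H^s(R^N)), \<dot>H^s-seminorm written in Gagliardo form: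
   \<integral>_a^b \<integral>\<integral> |f(x,t)-f(y,t)|^2 / |x-y|^{N+2s} dx dy dt < \<infinity> for all 0<a<b *)
definition L2loc_Hs :: "real \<Rightarrow> ('a::euclidean_space \<Rightarrow> real \<Rightarrow> real) \<Rightarrow> bool" where
  "L2loc_Hs s f \<longleftrightarrow> jmeas f \<and>
     (\<forall>a b. 0 < a \<longrightarrow> a < b \<longrightarrow>
        set_integrable lebesgue ((UNIV \<times> UNIV) \<times> {a..b})
          (\<lambda>((x, y), t). (f x t - f y t)\<^sup>2 * kern s x y))"

(* the weak formulation of  d_t w + (-\<Delta>)^s F(w) = 0 in R^N x (0,\<infinity>), where
   \<integral>(-\<Delta>)^{s/2}f (-\<Delta>)^{s/2}g = c(N,s)/2 \<integral>\<integral>(f(x)-f(y))(g(x)-g(y))/|x-y|^{N+2s} *)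
definition weak_eq :: "real \<Rightarrow> (real \<Rightarrow> real) \<Rightarrow> ('a::euclidean_space \<Rightarrow> real \<Rightarrow> real) \<Rightarrow> bool" where
  "weak_eq s F w \<longleftrightarrow>
     (\<forall>\<zeta>. test_fun \<zeta> \<longrightarrow>
        (LINT z:UNIV \<times> {0<..}|lebesgue. w (fst z) (snd z) * dt \<zeta> z)
        - (cNs DIM('a) s / 2) *
          (LINT q:(UNIV \<times> UNIV) \<times> {0<..}|lebesgue.
              (case q of ((x, y), t) \<Rightarrow>
                 (F (w x t) - F (w y t)) * (\<zeta> (x, t) - \<zeta> (y, t)) * kern s x y)) = 0)"

definition weak_solution :: "real \<Rightarrow> real \<Rightarrow> ('a::euclidean_space \<Rightarrow> real \<Rightarrow> real) \<Rightarrow> bool" where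
  "weak_solution n s u \<longleftrightarrow>
     jmeas u \<and>
     (AE z in lebesgue. snd z > 0 \<longrightarrow> u (fst z) (snd z) > 0) \<and>
     L1_cont {0<..} u \<and>
     L2loc_Hs s (\<lambda>x t. phi n (u x t)) \<and>
     weak_eq s (phi n) u"

definition strong_solution :: "real \<Rightarrow> real \<Rightarrow> ('a::euclidean_space \<Rightarrow> real \<Rightarrow> real) \<Rightarrow> bool" where
  "strong_solution n s u \<longleftrightarrow> weak_solution n s u \<and>
     (\<exists>w. jmeas w \<and>
        (\<forall>t>0. integrable lebesgue (\<lambda>x. w x t)) \<and>
        (\<forall>K. compact K \<longrightarrow> K \<subseteq> UNIV \<times> {0<..} \<longrightarrow>
              set_integrable lebesgue K (\<lambda>z. w (fst z) (snd z))) \<and>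
        (\<forall>\<zeta>. test_fun \<zeta> \<longrightarrow>
           (LINT z:UNIV \<times> {0<..}|lebesgue. u (fst z) (snd z) * dt \<zeta> z)
           = - (LINT z:UNIV \<times> {0<..}|lebesgue. w (fst z) (snd z) * \<zeta> z)))"

definition initial_datum :: "('a::euclidean_space \<Rightarrow> real \<Rightarrow> real) \<Rightarrow> ('a \<Rightarrow> real) \<Rightarrow> bool" where
  "initial_datum u u0 \<longleftrightarrow> ((\<lambda>t. LINT x|lebesgue. \<bar>u x t - u0 x\<bar>) \<longlongrightarrow> 0) (at_right 0)"

definition approx_weak_solution ::
  "real \<Rightarrow> real \<Rightarrow> real \<Rightarrow> ('a::euclidean_space \<Rightarrow> real) \<Rightarrow> ('a \<Rightarrow> real \<Rightarrow> real) \<Rightarrow> bool" where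
  "approx_weak_solution n s \<epsilon> u0 v \<longleftrightarrow>
     jmeas v \<and>
     (AE z in lebesgue. snd z \<ge> 0 \<longrightarrow> v (fst z) (snd z) \<ge> 0) \<and>
     L1_cont {0..} v \<and>
     (AE x in lebesgue. v x 0 = u0 x) \<and>
     L2loc_Hs s (\<lambda>x t. phi_eps n \<epsilon> (v x t)) \<and>
     weak_eq s (phi_eps n \<epsilon>) v"

end

theory Submission
  imports Defs
begin

text \<open>
  Otto's doubling of the time variable. Put \<open>w = v + \<epsilon>\<close>; up to a constant in the nonlinearity, \<open>u\<close> and \<open>w\<close> solve the
  same equation. For a ramp \<open>p\<close> approximating the Heaviside function, the function
  \<open>P(x) = p(\<phi>(u(x,t)) - \<phi>(w(x,\<tau>)))\<close> is bounded, has finite energy, and is supported where \<open>u(x,t) > \<epsilon>\<close>, hence is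
  integrable; so it may be used as a spatial test function in both equations. Freezing \<open>\<tau>\<close>, the
  increments of \<open>u\<close> tested with \<open>P\<close> dominate those of a convex primitive of \<open>p(\<phi>(\<cdot>) - \<phi>(w(x,\<tau>)))\<close>,
  and symmetrically for \<open>w\<close> with \<open>t\<close> frozen; no time derivative has to be a function. Adding the two,
  the energy terms combine to a nonnegative quantity, because \<open>p\<close> is monotone. Letting the time step and
  then the width of the ramp tend to zero gives \<open>(\<partial>\<^sub>t + \<partial>\<^sub>\<tau>) \<integral>(u(t) - w(\<tau>))\<^sup>+ \<le> 0\<close> weakly. On the diagonal
  the integral is therefore nonincreasing, and it vanishes at time zero.
\<close>

subsection \<open>Smooth test functions\<close>

text \<open>Two times are needed because convexity controls \<open>Jf\<close> only in its first
  argument and \<open>Jb\<close> only in its second. As long as the ramp has positive width these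
  are different functions; only their common limit is the positive part of the difference. So one
  solution is moved at a time while the other stays frozen. The order of the limits is forced. The
  energy of \<open>P\<close> is bounded only by a multiple of \<open>1 / d\<^sup>2\<close>, so the
  ramp width \<open>d\<close> is kept while the time step \<open>h\<close> and then an AM-GM weight
  \<open>l\<close> tend to zero; \<open>d\<close> follows, and the concentration on the diagonal
  comes last. The equation integrated over a time step sees the nonlinearity at all intermediate
  times, whereas the sign argument needs it at the end point, where \<open>P\<close> is formed. The
  mismatch is an oscillation that is o(h) after integration in time, for mere square integrability
  of the energy increments. Since \<open>phi\<close> is unbounded near 0, \<open>phi n u\<close>
  need not be integrable; it enters the energy only through differences in space. The lift by
  \<open>\<epsilon>\<close> bounds the nonlinearity of the second solution from below.\<close>

text \<open>Closed under partial derivatives, so coinduction gives smoothness of all its members.\<close>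

inductive smooth_expr :: "('b::euclidean_space \<Rightarrow> real) \<Rightarrow> bool" where
  const: "smooth_expr (\<lambda>_. c)"
| linear: "bounded_linear l \<Longrightarrow> smooth_expr l"
| add: "smooth_expr f \<Longrightarrow> smooth_expr g \<Longrightarrow> smooth_expr (\<lambda>x. f x + g x)"
| mult: "smooth_expr f \<Longrightarrow> smooth_expr g \<Longrightarrow> smooth_expr (\<lambda>x. f x * g x)"
| comp: "smooth_fun F \<Longrightarrow> smooth_expr f \<Longrightarrow> smooth_expr (\<lambda>x. F (f x))"

lemma smooth_funD:
  assumes "smooth_fun f"
  shows "f differentiable (at x)" "b \<in> Basis \<Longrightarrow> smooth_fun (\<lambda>x. frechet_derivative f (at x) b)"
  using assms by (auto elim: smooth_fun.cases)

lemma smooth_fun_real_deriv: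
  fixes F :: "real \<Rightarrow> real"
  assumes "smooth_fun F"
  shows "(F has_real_derivative frechet_derivative F (at r) 1) (at r)"
    "smooth_fun (\<lambda>r. frechet_derivative F (at r) 1)"
proof -
  have d: "(F has_derivative frechet_derivative F (at r)) (at r)"
    using smooth_funD(1)[OF assms] frechet_derivative_works by blast
  interpret bounded_linear "frechet_derivative F (at r)" using d by (rule has_derivative_bounded_linear)
  have "frechet_derivative F (at r) h = frechet_derivative F (at r) 1 * h" for h
    using scaleR[of h 1] by (simp add: mult.commute)
  then have "frechet_derivative F (at r) = (*) (frechet_derivative F (at r) 1)"
    by (intro ext)
  with d show "(F has_real_derivative frechet_derivative F (at r) 1) (at r)"
    unfolding has_field_derivative_def by metis
  show "smooth_fun (\<lambda>r. frechet_derivative F (at r) 1)"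
    using smooth_funD(2)[OF assms, of 1] by simp
qed

lemma frechet_derivative_eq:
  "(f has_derivative f') (at x) \<Longrightarrow> frechet_derivative f (at x) = f'"
  using frechet_derivative_at by force

text \<open>Each differentiation rule again produces an expression of the grammar. Composition is
  restricted to outer functions on the real line, so that the chain rule yields a plain
  product.\<close>

lemma smooth_expr_derivative:
  assumes "smooth_expr f"
  shows "(\<forall>x. f differentiable (at x)) \<and> (\<forall>b. smooth_expr (\<lambda>x. frechet_derivative f (at x) b))"
  using assms
proof induction
  case (const c)
  then show ?case by (auto intro: smooth_expr.intros)
next
  case (linear l)
  then have d: "(l has_derivative l) (at x)" for x
    by (rule bounded_linear_imp_has_derivative)
  show ?case
    using d by (auto simp: frechet_derivative_eq[OF d] intro: smooth_expr.const differentiableI)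
next
  case (add f g)
  then have d: "(f has_derivative frechet_derivative f (at x)) (at x)"
    "(g has_derivative frechet_derivative g (at x)) (at x)" for x
    using frechet_derivative_works by blast+
  note d' = has_derivative_add[OF d]
  show ?case
    using add d' by (auto simp: frechet_derivative_eq[OF d'] intro!: smooth_expr.add smooth_expr.mult intro: differentiableI)
next
  case (mult f g)
  then have d: "(f has_derivative frechet_derivative f (at x)) (at x)"
    "(g has_derivative frechet_derivative g (at x)) (at x)" for x
    using frechet_derivative_works by blast+
  note d' = has_derivative_mult[OF d]
  show ?case
    using mult d' by (auto simp: frechet_derivative_eq[OF d'] intro!: smooth_expr.add smooth_expr.mult intro: differentiableI)
next
  case (comp F f)
  then have d: "(f has_derivative frechet_derivative f (at x)) (at x)" for x
    using frechet_derivative_works by blast+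
  note d' = DERIV_compose_FDERIV[OF smooth_fun_real_deriv(1)[OF comp(1)] d]
  show ?case
    using comp d' smooth_fun_real_deriv(2)[OF comp(1)]
    by (auto simp: frechet_derivative_eq[OF d'] intro!: smooth_expr.mult
        intro: smooth_expr.comp[of "\<lambda>r. frechet_derivative F (at r) 1"] differentiableI)
qed

lemma smooth_expr_imp_smooth_fun: "smooth_expr f \<Longrightarrow> smooth_fun f"
  by (coinduction arbitrary: f rule: smooth_fun.coinduct) (use smooth_expr_derivative in blast)

lemma smooth_expr_sum: "(\<And>i. i \<in> I \<Longrightarrow> smooth_expr (f i)) \<Longrightarrow> smooth_expr (\<lambda>x. \<Sum>i\<in>I. f i x)"
  by (induction I rule: infinite_finite_induct) (auto intro: smooth_expr.intros)

text \<open>Transfers smoothness from the mollifier to the step function, which is known only as an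
  antiderivative.\<close>

lemma smooth_fun_antiderivative:
  fixes F :: "real \<Rightarrow> real"
  assumes "\<And>r. (F has_real_derivative f r) (at r)" "smooth_fun f"
  shows "smooth_fun F"
proof (rule smooth_fun.intros)
  fix r show "F differentiable (at r)" using assms(1) real_differentiable_def by blast
  show "smooth_fun (\<lambda>x. frechet_derivative F (at x) b)" if "b \<in> Basis" for b
    using that assms frechet_derivative_eq[OF assms(1)[unfolded has_field_derivative_def]]
    by simp
qed

text \<open>The classical flat functions at the origin. The polynomial factor makes the family
  closed under differentiation, which is what the coinduction for smoothness needs.\<close>

definition exp_recip :: "real poly \<Rightarrow> real \<Rightarrow> real" where
  "exp_recip p r = (if r > 0 then poly p (1/r) * exp (- (1/r)) else 0)"

lemma poly_times_exp_tendsto_0: "((\<lambda>x. poly p x * exp (- x)) \<longlongrightarrow> 0) (at_top::real filter)"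
proof -
  have "((\<lambda>x::real. \<Sum>i\<le>degree p. coeff p i * (x ^ i / exp x)) \<longlongrightarrow> (\<Sum>i\<le>degree p. coeff p i * 0)) at_top"
    by (intro tendsto_intros tendsto_power_div_exp_0)
  then show ?thesis
    by (simp add: poly_altdef sum_distrib_right sum_divide_distrib exp_minus divide_inverse mult.assoc)
qed

lemma exp_recip_tendsto_0: "((\<lambda>h. poly p (1/h) * exp (- (1/h))) \<longlongrightarrow> 0) (at_right (0::real))"
proof -
  have "filterlim (\<lambda>h::real. 1/h) at_top (at_right 0)"
    using filterlim_inverse_at_top_right by (simp add: inverse_eq_divide)
  from filterlim_compose[OF poly_times_exp_tendsto_0 this] show ?thesis .
qed

text \<open>With X = 1/r, differentiating p(X) exp(-X) in r gives the factor X^2, which is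
  \<open>[:0,0,1:]\<close>, and the polynomial p - p'. At the origin exponential decay beats every
  polynomial in X.\<close>

lemma exp_recip_deriv:
  "(exp_recip p has_real_derivative exp_recip ([:0,0,1:] * (p - pderiv p)) r) (at r)"
proof -
  consider "r > 0" | "r < 0" | "r = 0" by linarith
  then show ?thesis
  proof cases
    case 1
    have "((\<lambda>r. poly p (1/r) * exp (- (1/r))) has_real_derivative
       exp_recip ([:0,0,1:] * (p - pderiv p)) r) (at r)"
      using 1 by (auto intro!: derivative_eq_intros DERIV_compose_FDERIV poly_DERIV[THEN DERIV_chain2]
          simp: exp_recip_def field_simps power2_eq_square)
    then show ?thesis
      by (rule has_field_derivative_transform_within_open[where S="{0<..}"])
        (use 1 in \<open>auto simp: exp_recip_def\<close>)
  next
    case 2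
    have "((\<lambda>r. 0) has_real_derivative exp_recip ([:0,0,1:] * (p - pderiv p)) r) (at r)"
      using 2 by (simp add: exp_recip_def)
    then show ?thesis
      by (rule has_field_derivative_transform_within_open[where S="{..<0}"])
        (use 2 in \<open>auto simp: exp_recip_def\<close>)
  next
    case 3
    \<comment> \<open>The division by \<open>h\<close> is absorbed into the polynomial, as one more
      factor 1/h.\<close>
    have "((\<lambda>h. exp_recip p h / h) \<longlongrightarrow> 0) (at_right 0)"
      using exp_recip_tendsto_0[of "[:0,1:] * p"]
      by (rule Lim_transform_eventually) (auto simp: eventually_at_right_field exp_recip_def intro!: exI[of _ 1])
    moreover have "((\<lambda>h. exp_recip p h / h) \<longlongrightarrow> 0) (at_left 0)"
      by (rule tendsto_eventually) (auto simp: eventually_at_left_field exp_recip_def intro!: exI[of _ "-1"])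
    ultimately have "((\<lambda>h. exp_recip p h / h) \<longlongrightarrow> 0) (at 0)"
      by (simp add: filterlim_split_at)
    then show ?thesis
      using 3 by (simp add: DERIV_def exp_recip_def)
  qed
qed

lemma smooth_exp_recip: "smooth_fun (exp_recip p)"
proof (coinduction arbitrary: p rule: smooth_fun.coinduct)
  case smooth_fun
  show ?case
    using frechet_derivative_eq[OF exp_recip_deriv[of p, unfolded has_field_derivative_def]]
    by (intro exI[of _ "exp_recip p"] conjI refl allI impI)
       (use exp_recip_deriv[of p] in \<open>auto simp: real_differentiable_def simp del: mult_pCons_left\<close>)
qed

section \<open>Bumps in space and smooth steps in time\<close>

definition "bump1 = exp_recip 1"

lemma bump1: "smooth_fun bump1" "r > 0 \<Longrightarrow> bump1 r > 0" "r \<le> 0 \<Longrightarrow> bump1 r = 0" "0 \<le> bump1 r" "bump1 r \<le> 1"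
  by (auto simp: bump1_def smooth_exp_recip) (auto simp: exp_recip_def)

lemma smooth_fun_imp_continuous: "smooth_fun f \<Longrightarrow> continuous_on S f"
  by (meson continuous_at_imp_continuous_on differentiable_imp_continuous_within smooth_funD(1))

text \<open>\<open>\<eta>\<close> is the product of two flat functions, positive exactly inside the
  interval, divided by its mass; \<open>H\<close> is its distribution function. The support lies to
  the right of 0, so averages around a positive time look forward and never reach time zero.\<close>

lemma smooth_step_exists:
  assumes "d > (0::real)"
  obtains \<eta> H :: "real \<Rightarrow> real" where "smooth_fun \<eta>" "smooth_fun H"
    "\<And>r. (H has_real_derivative \<eta> r) (at r)" "\<And>r. \<eta> r \<ge> 0" "\<And>r. r \<notin> {0..d} \<Longrightarrow> \<eta> r = 0"
    "\<And>r. r \<le> 0 \<Longrightarrow> H r = 0" "\<And>r. r \<ge> d \<Longrightarrow> H r = 1" "\<And>r. 0 \<le> H r \<and> H r \<le> 1"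
proof -
  define e where "e = (\<lambda>r. bump1 r * bump1 (d + (- r)))"
  have "smooth_expr e" unfolding e_def
    by (intro smooth_expr.mult smooth_expr.comp[of bump1] smooth_expr.add smooth_expr.const bump1
        smooth_expr.linear bounded_linear_ident bounded_linear_minus)
  then have es: "smooth_fun e" by (rule smooth_expr_imp_smooth_fun)
  have ec: "isCont e r" for r
    using smooth_fun_imp_continuous[OF es, of UNIV] continuous_on_eq_continuous_at open_UNIV by blast
  obtain G where G: "\<And>r. (G has_real_derivative e r) (at r)"
    using einterval_antiderivative[of "-\<infinity>" "\<infinity>" e] ec
    by (auto simp: has_real_derivative_iff_has_vector_derivative)
  have e0: "e r \<ge> 0" for r by (simp add: e_def bump1)
  have eout: "e r = 0" if "r \<notin> {0..d}" for r using that by (auto simp: e_def bump1)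
  have mono: "G x \<le> G y" if "x \<le> y" for x y
    using DERIV_nonneg_imp_nondecreasing[OF that] G e0 by blast
  have cst1: "G x = G 0" if "x \<le> 0" for x
  proof (cases "x = 0")
    case False
    have "\<exists>z>x. z < 0 \<and> G 0 - G x = (0 - x) * e z"
      by (rule MVT2) (use that False G in auto)
    then obtain z where "G 0 - G x = (0 - x) * e z" "x < z" "z < 0" by blast
    then show ?thesis using eout[of z] by simp
  qed auto
  have cst2: "G x = G d" if "d \<le> x" for x
  proof (cases "x = d")
    case False
    have "\<exists>z>d. z < x \<and> G x - G d = (x - d) * e z"
      by (rule MVT2) (use that False G in auto)
    then obtain z where "G x - G d = (x - d) * e z" "d < z" "z < x" by blast
    then show ?thesis using eout[of z] by simp
  qed auto
  \<comment> \<open>The mass is positive because the mean value point lies strictly inside the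
    interval, where \<open>e\<close> is positive.\<close>
  have "\<exists>z>0. z < d \<and> G d - G 0 = (d - 0) * e z"
    by (rule MVT2) (use assms G in auto)
  then obtain z where z: "G d - G 0 = (d - 0) * e z" "0 < z" "z < d" by blast
  then have pos: "G d - G 0 > 0" using assms by (simp add: e_def bump1)
  define Z where "Z = G d - G 0"
  have Z: "Z > 0" using pos by (simp add: Z_def)
  define H where "H = (\<lambda>r. (G r - G 0) / Z)"
  define \<eta> where "\<eta> = (\<lambda>r. (1/Z) * e r)"
  have H': "(H has_real_derivative \<eta> r) (at r)" for r
    unfolding H_def \<eta>_def using Z by (auto intro!: derivative_eq_intros G)
  have \<eta>s: "smooth_fun \<eta>" unfolding \<eta>_def
    by (intro smooth_expr_imp_smooth_fun smooth_expr.mult smooth_expr.const) fact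
  show ?thesis
  proof (rule that[of \<eta> H])
    show "smooth_fun H" using H' \<eta>s by (rule smooth_fun_antiderivative)
    show "0 \<le> H r \<and> H r \<le> 1" for r
    proof -
      have "G 0 \<le> G r" using mono[of 0 r] cst1[of r] by (cases "r \<le> 0") auto
      moreover have "G r \<le> G d" using mono[of r d] cst2[of r] by (cases "r \<le> d") auto
      ultimately show ?thesis using Z by (simp add: H_def Z_def divide_simps)
    qed
  next
    show "H r = 1" if "r \<ge> d" for r
      unfolding H_def cst2[OF that] Z_def[symmetric] using Z by simp
  next
    show "H r = 0" if "r \<le> 0" for r unfolding H_def cst1[OF that] by simp
  qed (use H' \<eta>s e0 eout Z in \<open>auto simp: \<eta>_def\<close>)
qed

text \<open>The squared norm keeps the function smooth at the origin. No normalisation is made: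
  sign, support and integrability are what is used.\<close>

definition bump :: "real \<Rightarrow> 'a::euclidean_space \<Rightarrow> real" where
  "bump k x = bump1 (k\<^sup>2 - (norm x)\<^sup>2)"

lemma bump_bounds: "0 \<le> bump k x" "bump k x \<le> 1" "norm x \<ge> k \<Longrightarrow> k > 0 \<Longrightarrow> bump k x = 0"
  "norm x < k \<Longrightarrow> bump k x > 0"
  by (auto simp: bump_def bump1 intro!: bump1(2,3) power_mono power_strict_mono)

lemma smooth_bump_shift: "smooth_expr (\<lambda>z::'a::euclidean_space \<times> real. bump k (fst z - x))"
proof -
  \<comment> \<open>The squared norm is written out in coordinates, as a sum of products of affine
    forms, to fit the grammar of \<open>smooth_expr\<close>.\<close>
  have "bump k (fst z - x) = bump1 (k\<^sup>2 + (\<Sum>b\<in>Basis. (- ((fst z \<bullet> b + (- (x \<bullet> b))) * (fst z \<bullet> b + (- (x \<bullet> b))))))) " for z :: "'a \<times> real"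
    unfolding bump_def power2_norm_eq_inner
    by (subst euclidean_inner) (simp add: inner_diff_left sum_negf)
  then show ?thesis
    apply (subst fun_cong) apply (rule refl)
    apply (simp only:)
    apply (intro smooth_expr.comp[of bump1] smooth_expr.add smooth_expr.const bump1 smooth_expr_sum)
    apply (intro smooth_expr.comp[of uminus "\<lambda>z. (fst z \<bullet> i + (- (x \<bullet> i))) * (fst z \<bullet> i + (- (x \<bullet> i)))" for i]
         smooth_expr.mult smooth_expr.add smooth_expr.const smooth_expr_imp_smooth_fun smooth_expr.linear
         bounded_linear_minus bounded_linear_ident bounded_linear_intros)
    done
qed

lemma test_fun_bump_times:
  fixes x :: "'a::euclidean_space" and \<theta> :: "real \<Rightarrow> real"
  assumes "smooth_fun \<theta>" "\<And>r. (\<theta> has_real_derivative \<theta>' r) (at r)"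
    "0 < a" "\<And>r. r \<notin> {a..b} \<Longrightarrow> \<theta> r = 0" "k > 0"
  shows "test_fun (\<lambda>z. bump k (fst z - x) * \<theta> (snd z))"
    "dt (\<lambda>z. bump k (fst z - x) * \<theta> (snd z)) (y, r) = bump k (y - x) * \<theta>' r"
proof -
  have "smooth_expr (\<lambda>z::'a \<times> real. \<theta> (snd z))"
    using assms(1) by (intro smooth_expr.comp[of \<theta>] smooth_expr.linear bounded_linear_snd)
  then have s: "smooth_expr (\<lambda>z. bump k (fst z - x) * \<theta> (snd z))"
    by (intro smooth_expr.mult smooth_bump_shift)
  have "compact (cball x k \<times> {a..b})" by (intro compact_Times) auto
  moreover have "cball x k \<times> {a..b} \<subseteq> UNIV \<times> {0<..}" using assms(3) by auto
  moreover have "\<forall>z. z \<notin> cball x k \<times> {a..b} \<longrightarrow> bump k (fst z - x) * \<theta> (snd z) = 0"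
    using assms(4,5) by (auto simp: bump_bounds(3) dist_norm norm_minus_commute)
  ultimately show "test_fun (\<lambda>z. bump k (fst z - x) * \<theta> (snd z))"
    unfolding test_fun_def using smooth_expr_imp_smooth_fun[OF s] by blast
  \<comment> \<open>The spatial factor is constant along the vertical line through \<open>y\<close>;
    uniqueness of derivatives turns this into a vanishing time component.\<close>
  have "\<exists>D. ((\<lambda>z. bump k (fst z - x)) has_derivative D) (at (y,r)) \<and> D (0,1) = 0"
  proof -
    have "(\<lambda>z. bump k (fst z - x)) differentiable (at (y,r))"
      using smooth_bump_shift smooth_expr_derivative by blast
    then obtain D where D: "((\<lambda>z. bump k (fst z - x)) has_derivative D) (at (y,r))"
      unfolding differentiable_def by blast
    have g: "((\<lambda>\<tau>. (y, \<tau>)) has_derivative (\<lambda>h. (0,h))) (at r)"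
      by (auto intro!: derivative_eq_intros)
    have "((\<lambda>z. bump k (fst z - x)) \<circ> (\<lambda>\<tau>. (y, \<tau>)) has_derivative D \<circ> (\<lambda>h. (0,h))) (at r)"
      by (rule diff_chain_at[OF g D])
    moreover have "((\<lambda>z. bump k (fst z - x)) \<circ> (\<lambda>\<tau>. (y, \<tau>)) has_derivative (\<lambda>h. 0)) (at r)"
      by (simp add: o_def)
    ultimately have "D \<circ> (\<lambda>h. (0,h)) = (\<lambda>h. 0)" by (rule has_derivative_unique)
    then show ?thesis using D by (auto simp: fun_eq_iff)
  qed
  then obtain D where D: "((\<lambda>z. bump k (fst z - x)) has_derivative D) (at (y,r))" "D (0,1) = 0"
    by blast
  have "((\<lambda>z. \<theta> (snd z)) has_derivative (\<lambda>h. snd h * \<theta>' r)) (at (y, r))"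
    using DERIV_compose_FDERIV[of \<theta> "\<theta>' r" snd "(y,r)" snd UNIV] assms(2)
      bounded_linear_imp_has_derivative[OF bounded_linear_snd] by auto
  from frechet_derivative_eq[OF has_derivative_mult[OF D(1) this]]
  show "dt (\<lambda>z. bump k (fst z - x) * \<theta> (snd z)) (y, r) = bump k (y - x) * \<theta>' r"
    unfolding dt_def by (simp add: D(2))
qed

subsection \<open>Continuity of translations\<close>

lemma borel_comp_continuous:
  fixes f :: "'a::topological_space \<Rightarrow> 'c::topological_space"
  assumes "f \<in> borel_measurable borel" "continuous_on UNIV g"
  shows "(\<lambda>x. f (g x)) \<in> borel_measurable borel"
  by (rule measurable_compose[OF borel_measurable_continuous_onI[OF assms(2)] assms(1)])

lemma nn_integral_lborel_shift:
  fixes f :: "'a::euclidean_space \<Rightarrow> ennreal"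
  assumes "f \<in> borel_measurable borel"
  shows "(\<integral>\<^sup>+x. f (x + c) \<partial>lborel) = (\<integral>\<^sup>+x. f x \<partial>lborel)"
proof -
  have "(\<integral>\<^sup>+x. f x \<partial>lborel) = (\<integral>\<^sup>+x. f x \<partial>distr lborel borel ((+) c))"
    by (simp add: lborel_distr_plus)
  also have "\<dots> = (\<integral>\<^sup>+x. f (c + x) \<partial>lborel)"
    using assms by (intro nn_integral_distr) auto
  finally show ?thesis by (simp add: add.commute)
qed

lemma integrable_lborel_shift:
  fixes f :: "'a::euclidean_space \<Rightarrow> real"
  assumes "integrable lborel f"
  shows "integrable lborel (\<lambda>x. f (x + c))"
proof -
  have "integrable (distr lborel borel ((+) c)) f"
    using assms by (simp add: lborel_distr_plus)
  then have "integrable lborel (\<lambda>x. f (c + x))"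
    by (rule integrable_distr[rotated]) simp
  then show ?thesis by (simp add: add.commute)
qed

lemma integral_lborel_shift:
  fixes f :: "'a::euclidean_space \<Rightarrow> real"
  assumes "f \<in> borel_measurable borel"
  shows "(LINT x|lborel. f (x + c)) = (LINT x|lborel. f x)"
proof -
  have "(LINT x|lborel. f x) = (LINT x|distr lborel borel ((+) c). f x)"
    by (simp add: lborel_distr_plus)
  also have "\<dots> = (LINT x|lborel. f (c + x))"
    using assms by (intro integral_distr) auto
  finally show ?thesis by (simp add: add.commute)
qed

lemma lborel_distr_reflect: "distr lborel borel (\<lambda>x. c - x) = (lborel :: 'a::euclidean_space measure)"
proof -
  have "lborel = density (distr lborel borel (\<lambda>x. c + (-1) *\<^sub>R x)) (\<lambda>_. \<bar>-1::real\<bar>^DIM('a))"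
    by (rule lborel_affine) simp
  then show ?thesis by (simp add: density_1)
qed

lemma integral_lborel_reflect:
  fixes f :: "'a::euclidean_space \<Rightarrow> real"
  assumes "f \<in> borel_measurable borel"
  shows "(LINT x|lborel. f (c - x)) = (LINT x|lborel. f x)"
proof -
  have "(LINT x|lborel. f x) = (LINT x|distr lborel borel (\<lambda>x. c - x). f x)"
    by (simp add: lborel_distr_reflect)
  also have "\<dots> = (LINT x|lborel. f (c - x))"
    using assms by (intro integral_distr) auto
  finally show ?thesis by simp
qed

lemma nn_integral_lborel_reflect:
  fixes f :: "'a::euclidean_space \<Rightarrow> ennreal"
  assumes "f \<in> borel_measurable borel"
  shows "(\<integral>\<^sup>+x. f (c - x) \<partial>lborel) = (\<integral>\<^sup>+x. f x \<partial>lborel)"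
proof -
  have "(\<integral>\<^sup>+x. f x \<partial>lborel) = (\<integral>\<^sup>+x. f x \<partial>distr lborel borel (\<lambda>x. c - x))"
    by (simp add: lborel_distr_reflect)
  also have "\<dots> = (\<integral>\<^sup>+x. f (c - x) \<partial>lborel)"
    using assms by (intro nn_integral_distr) auto
  finally show ?thesis by simp
qed

lemma emeasure_lborel_shift:
  fixes A :: "'a::euclidean_space set"
  assumes "A \<in> sets borel"
  shows "emeasure lborel {x. x + c \<in> A} = emeasure lborel A"
proof -
  have "emeasure lborel A = emeasure (distr lborel borel ((+) c)) A"
    by (simp add: lborel_distr_plus)
  also have "\<dots> = emeasure lborel {x. c + x \<in> A}"
    using assms by (subst emeasure_distr) (auto simp: vimage_def)
  finally show ?thesis by (simp add: add.commute)
qed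

text \<open>The measure lost by a small translation equals the measure gained, since Lebesgue
  measure is invariant; hence the factor 2. The loss tends to zero by dominated convergence, because
  a point of an open set stays inside under small shifts.\<close>

lemma translation_L1_open:
  fixes U :: "'a::euclidean_space set"
  assumes U: "open U" "emeasure lborel U < \<infinity>"
  shows "((\<lambda>z. LINT x|lborel. \<bar>indicator U (x + z) - indicator U x :: real\<bar>) \<longlongrightarrow> 0) (at 0)"
proof -
  have Um[measurable]: "U \<in> sets borel" using U by auto
  have iU: "integrable lborel (indicator U :: 'a \<Rightarrow> real)"
    using U by (simp add: integrable_indicator_iff)
  have iUz: "integrable lborel (\<lambda>x. indicator U (x + z) :: real)" for z
    by (rule integrable_lborel_shift[OF iU])
  have eq: "(LINT x|lborel. \<bar>indicator U (x + z) - indicator U x :: real\<bar>)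
      = 2 * (LINT x|lborel. indicator U x * (1 - indicator U (x + z)))" for z
  proof -
    have "(LINT x|lborel. \<bar>indicator U (x + z) - indicator U x :: real\<bar>)
      = (LINT x|lborel. 2 * (indicator U x * (1 - indicator U (x + z))) + (indicator U (x + z) - indicator U x))"
      by (rule Bochner_Integration.integral_cong) (auto simp: indicator_def)
    also have "\<dots> = 2 * (LINT x|lborel. indicator U x * (1 - indicator U (x + z)))
        + ((LINT x|lborel. indicator U (x + z)) - (LINT x|lborel. indicator U x))"
    proof (subst Bochner_Integration.integral_add)
      show "integrable lborel (\<lambda>x. 2 * (indicator U x * (1 - indicator U (x + z))) :: real)"
        by (rule Bochner_Integration.integrable_bound[OF integrable_mult_right[OF iU, of 2]])
          (auto simp: indicator_def)
    qed (use iU iUz[of z] in auto)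
    also have "(LINT x|lborel. indicator U (x + z)) = (LINT x|lborel. (indicator U x :: real))"
      by (rule integral_lborel_shift) simp
    finally show ?thesis by simp
  qed
  have "((\<lambda>z. LINT x|lborel. indicator U x * (1 - indicator U (x + z)) :: real) \<longlongrightarrow> 0) (at 0)"
    unfolding tendsto_at_iff_sequentially
  proof (intro allI impI)
    fix X :: "nat \<Rightarrow> 'a" assume "\<forall>i. X i \<in> UNIV - {0}" and X: "X \<longlonglongrightarrow> 0"
    have "(\<lambda>i. LINT x|lborel. indicator U x * (1 - indicator U (x + X i)) :: real) \<longlonglongrightarrow> (LINT x|(lborel :: 'a measure). (0::real))"
    proof (rule integral_dominated_convergence)
      show "integrable lborel (indicator U :: 'a \<Rightarrow> real)" by fact
      show "AE x in lborel. (\<lambda>i. indicator U x * (1 - indicator U (x + X i)) :: real) \<longlonglongrightarrow> 0"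
      proof (rule AE_I2)
        fix x
        show "(\<lambda>i. indicator U x * (1 - indicator U (x + X i)) :: real) \<longlonglongrightarrow> 0"
        proof (cases "x \<in> U")
          case True
          have "(\<lambda>i. x + X i) \<longlonglongrightarrow> x" using tendsto_add[OF tendsto_const X, of x] by simp
          then have "\<forall>\<^sub>F i in sequentially. x + X i \<in> U"
            using U(1) True by (rule topological_tendstoD)
          then have "\<forall>\<^sub>F i in sequentially. indicator U x * (1 - indicator U (x + X i)) = (0::real)"
            by eventually_elim simp
          then show ?thesis by (rule tendsto_eventually)
        qed auto
      qed
    qed (auto simp: indicator_def)
    then show "((\<lambda>z. LINT x|lborel. indicator U x * (1 - indicator U (x + z)) :: real) \<circ> X) \<longlonglongrightarrow> 0"
      by (simp add: o_def)
  qed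
  from tendsto_mult_left[OF this, of 2] show ?thesis unfolding eq by simp
qed

lemma translation_L1_aux:
  fixes f :: "'a::euclidean_space \<Rightarrow> real"
  assumes f: "integrable lborel f" and g: "integrable lborel g"
  shows "(LINT x|lborel. \<bar>f (x + z) - f x\<bar>) \<le> 2 * (LINT x|lborel. \<bar>f x - g x\<bar>) + (LINT x|lborel. \<bar>g (x + z) - g x\<bar>)"
proof -
  note fz = integrable_lborel_shift[OF f, of z] note gz = integrable_lborel_shift[OF g, of z]
  have [measurable]: "f \<in> borel_measurable borel" "g \<in> borel_measurable borel"
    using f g by (auto dest: borel_measurable_integrable)
  have "(LINT x|lborel. \<bar>f (x + z) - f x\<bar>) \<le> (LINT x|lborel. \<bar>f (x + z) - g (x + z)\<bar> + \<bar>f x - g x\<bar> + \<bar>g (x + z) - g x\<bar>)"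
    by (rule integral_mono) (use f g fz gz in \<open>auto intro!: Bochner_Integration.integrable_add integrable_abs Bochner_Integration.integrable_diff\<close>)
  also have "\<dots> = (LINT x|lborel. \<bar>f (x + z) - g (x + z)\<bar>) + (LINT x|lborel. \<bar>f x - g x\<bar>) + (LINT x|lborel. \<bar>g (x + z) - g x\<bar>)"
    using f g fz gz by (simp add: Bochner_Integration.integral_add integrable_abs)
  also have "(LINT x|lborel. \<bar>f (x + z) - g (x + z)\<bar>) = (LINT x|lborel. \<bar>f x - g x\<bar>)"
    by (rule integral_lborel_shift[where f="\<lambda>x. \<bar>f x - g x\<bar>"]) simp
  finally show ?thesis by simp
qed

text \<open>The property is closed under approximation in L1. This serves twice below: to pass from
  open to measurable sets, and in the limit case of the induction.\<close>

lemma translation_L1_approx: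
  fixes f :: "'a::euclidean_space \<Rightarrow> real"
  assumes f: "integrable lborel f"
    and ap: "\<And>e. e > 0 \<Longrightarrow> \<exists>g. integrable lborel g \<and> (LINT x|lborel. \<bar>f x - g x\<bar>) < e
       \<and> ((\<lambda>z. LINT x|lborel. \<bar>g (x + z) - g x\<bar>) \<longlongrightarrow> 0) (at 0)"
  shows "((\<lambda>z. LINT x|lborel. \<bar>f (x + z) - f x\<bar>) \<longlongrightarrow> 0) (at 0)"
proof (rule tendstoI)
  fix e :: real assume e: "e > 0"
  obtain g where g: "integrable lborel g" "(LINT x|lborel. \<bar>f x - g x\<bar>) < e/4"
    "((\<lambda>z. LINT x|lborel. \<bar>g (x + z) - g x\<bar>) \<longlongrightarrow> 0) (at 0)"
    using ap[of "e/4"] e by auto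
  have "\<forall>\<^sub>F z in at 0. (LINT x|lborel. \<bar>g (x + z) - g x\<bar>) < e/4"
    using order_tendstoD(2)[OF g(3), of "e/4"] e by auto
  then show "\<forall>\<^sub>F z in at 0. dist (LINT x|lborel. \<bar>f (x + z) - f x\<bar>) 0 < e"
  proof eventually_elim
    case (elim z)
    with translation_L1_aux[OF f g(1), of z] g(2) e show ?case by simp
  qed
qed

text \<open>Density argument, run as an induction over integrable functions. For a set of finite
  measure, outer regularity supplies an open superset whose indicator is close in L1.\<close>

lemma translation_L1:
  fixes f :: "'a::euclidean_space \<Rightarrow> real"
  assumes "integrable lborel f"
  shows "((\<lambda>z. LINT x|lborel. \<bar>f (x + z) - f x\<bar>) \<longlongrightarrow> 0) (at 0)"
  using assms
proof (induction rule: integrable_induct)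
  case (base A c)
  then have A[measurable]: "A \<in> sets borel" and fin: "emeasure lborel A < \<infinity>" by auto
  have iA: "integrable lborel (indicator A :: 'a \<Rightarrow> real)"
    using fin by (simp add: integrable_indicator_iff)
  have "((\<lambda>z. LINT x|lborel. \<bar>indicator A (x + z) - indicator A x :: real\<bar>) \<longlongrightarrow> 0) (at 0)"
  proof (rule translation_L1_approx[OF iA])
    fix e :: real assume e: "e > 0"
    obtain U where U: "open U" "A \<subseteq> U" "emeasure lborel (U - A) < ennreal e"
      using outer_regular_lborel[OF A e] by auto
    have [measurable]: "U \<in> sets borel" using U by auto
    have "emeasure lborel U = emeasure lborel A + emeasure lborel (U - A)"
      using plus_emeasure[of A lborel "U - A"] U(2) by (simp add: Un_absorb1)
    also have "\<dots> < \<infinity>" using fin U(3) by (auto simp: ennreal_add_less_top less_trans[OF _ ennreal_less_top])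
    finally have finU: "emeasure lborel U < \<infinity>" .
    have "(LINT x|lborel. \<bar>indicator A x - indicator U x :: real\<bar>) = (LINT x|lborel. indicator (U - A) x)"
      using U(2) by (intro Bochner_Integration.integral_cong) (auto simp: indicator_def)
    also have "\<dots> = measure lborel (U - A)" by simp
    also have "\<dots> < e" using U(3) e unfolding measure_def
      by (metis (no_types, lifting) ennreal_enn2real_if ennreal_less_iff enn2real_nonneg ennreal_top_neq_one infinity_ennreal_def less_trans order_less_irrefl top.not_eq_extremum)
    finally show "\<exists>g. integrable lborel g \<and> (LINT x|lborel. \<bar>indicator A x - g x\<bar>) < e
       \<and> ((\<lambda>z. LINT x|lborel. \<bar>g (x + z) - g x\<bar>) \<longlongrightarrow> 0) (at 0)"
      using translation_L1_open[OF U(1) finU] finU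
      by (intro exI[of _ "indicator U"]) (auto simp: integrable_indicator_iff)
  qed
  moreover have "(LINT x|lborel. \<bar>indicator A (x + z) *\<^sub>R c - indicator A x *\<^sub>R c\<bar>)
      = \<bar>c\<bar> * (LINT x|lborel. \<bar>indicator A (x + z) - indicator A x :: real\<bar>)" for z
    by (subst integral_mult_right_zero[symmetric], rule Bochner_Integration.integral_cong)
      (auto simp: abs_mult simp flip: left_diff_distrib)
  ultimately show ?case using tendsto_mult_left[of _ 0 _ "\<bar>c\<bar>"] by fastforce
next
  case (add f g)
  show ?case
  proof (rule tendsto_sandwich[OF _ _ tendsto_const])
    show "((\<lambda>z. (LINT x|lborel. \<bar>f (x + z) - f x\<bar>) + (LINT x|lborel. \<bar>g (x + z) - g x\<bar>)) \<longlongrightarrow> 0) (at 0)"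
      using tendsto_add[OF add.IH] by simp
    show "\<forall>\<^sub>F z in at 0. (LINT x|lborel. \<bar>f (x + z) + g (x + z) - (f x + g x)\<bar>)
       \<le> (LINT x|lborel. \<bar>f (x + z) - f x\<bar>) + (LINT x|lborel. \<bar>g (x + z) - g x\<bar>)"
    proof (rule always_eventually, rule allI)
      fix z
      note fz = integrable_lborel_shift[OF add.hyps(1), of z] note gz = integrable_lborel_shift[OF add.hyps(2), of z]
      have i: "integrable lborel (\<lambda>x. \<bar>f (x + z) - f x\<bar>)" "integrable lborel (\<lambda>x. \<bar>g (x + z) - g x\<bar>)"
        using add.hyps fz gz by (auto intro!: integrable_abs)
      have "(LINT x|lborel. \<bar>f (x + z) + g (x + z) - (f x + g x)\<bar>) \<le> (LINT x|lborel. \<bar>f (x + z) - f x\<bar> + \<bar>g (x + z) - g x\<bar>)"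
        by (rule integral_mono) (use i add.hyps fz gz in \<open>auto intro!: integrable_abs\<close>)
      then show "(LINT x|lborel. \<bar>f (x + z) + g (x + z) - (f x + g x)\<bar>)
       \<le> (LINT x|lborel. \<bar>f (x + z) - f x\<bar>) + (LINT x|lborel. \<bar>g (x + z) - g x\<bar>)"
        using i by simp
    qed
  qed (auto intro!: always_eventually Bochner_Integration.integral_nonneg)
next
  case (lim f s)
  show ?case
  proof (rule translation_L1_approx[OF lim.hyps(4)])
    fix e :: real assume e: "e > 0"
    have [measurable]: "f \<in> borel_measurable borel" "\<And>i. s i \<in> borel_measurable borel"
      using lim.hyps(1,4) by (auto dest: borel_measurable_integrable)
    have "(\<lambda>i. LINT x|lborel. \<bar>f x - s i x\<bar>) \<longlonglongrightarrow> (LINT x|(lborel :: 'a measure). (0::real))"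
    proof (rule integral_dominated_convergence)
      \<comment> \<open>The induction rule provides approximations bounded by twice
        \<open>f\<close>; together with \<open>f\<close> itself this gives 3.\<close>
      show "integrable lborel (\<lambda>x. 3 * \<bar>f x\<bar>)" using lim.hyps(4) by auto
      show "AE x in lborel. (\<lambda>i. \<bar>f x - s i x\<bar>) \<longlonglongrightarrow> 0"
        using lim.hyps(2) by (auto intro!: tendsto_eq_intros AE_I2)
      show "AE x in lborel. norm \<bar>f x - s i x\<bar> \<le> 3 * \<bar>f x\<bar>" for i
      proof (rule AE_I2)
        fix x show "norm \<bar>f x - s i x\<bar> \<le> 3 * \<bar>f x\<bar>"
          using lim.hyps(3)[of x i] by simp
      qed
    qed auto
    then have "\<forall>\<^sub>F i in sequentially. (LINT x|lborel. \<bar>f x - s i x\<bar>) < e"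
      using e by (intro order_tendstoD(2)) auto
    then obtain i where "(LINT x|lborel. \<bar>f x - s i x\<bar>) < e"
      by (auto simp: eventually_sequentially)
    then show "\<exists>g. integrable lborel g \<and> (LINT x|lborel. \<bar>f x - g x\<bar>) < e
       \<and> ((\<lambda>z. LINT x|lborel. \<bar>g (x + z) - g x\<bar>) \<longlongrightarrow> 0) (at 0)"
      using lim.hyps(1) lim.IH by blast
  qed
qed

text \<open>Reduces the continuity of translations in \<open>L\<^sup>2\<close> to the one in \<open>L\<^sup>1\<close>, applied to \<open>f \<bar>f\<bar>\<close>.\<close>

lemma diff_sq_le_signed_squares: "(p - q)\<^sup>2 \<le> 2 * \<bar>p * \<bar>p\<bar> - q * \<bar>q\<bar>\<bar>" for p q :: real
proof (cases "p * q \<ge> 0")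
  case True
  have "p * \<bar>p\<bar> - q * \<bar>q\<bar> = (p - q) * (\<bar>p\<bar> + \<bar>q\<bar>)"
    using True by (auto simp: zero_le_mult_iff algebra_simps)
  then have "\<bar>p * \<bar>p\<bar> - q * \<bar>q\<bar>\<bar> = \<bar>p - q\<bar> * (\<bar>p\<bar> + \<bar>q\<bar>)"
    by (simp add: abs_mult)
  moreover have "(p - q)\<^sup>2 \<le> \<bar>p - q\<bar> * (\<bar>p\<bar> + \<bar>q\<bar>)"
    by (metis abs_ge_zero abs_triangle_ineq4 mult_left_mono power2_abs power2_eq_square)
  ultimately show ?thesis
    using abs_ge_zero[of "p * \<bar>p\<bar> - q * \<bar>q\<bar>"] by linarith
next
  case False
  then consider "p > 0" "q < 0" | "p < 0" "q > 0" by (auto simp: zero_le_mult_iff not_le)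
  then show ?thesis
  proof cases
    case 1
    then show ?thesis using sum_squares_ge_zero[of "p+q" 0]
      by (simp add: power2_eq_square algebra_simps abs_if)
  next
    case 2
    then show ?thesis using sum_squares_ge_zero[of "p+q" 0]
      by (simp add: power2_eq_square algebra_simps abs_if)
  qed
qed

lemma translation_L2:
  fixes f :: "'a::euclidean_space \<Rightarrow> real"
  assumes [measurable]: "f \<in> borel_measurable borel" and f: "integrable lborel (\<lambda>x. (f x)\<^sup>2)"
  shows "integrable lborel (\<lambda>x. (f (x + z) - f x)\<^sup>2)"
    "((\<lambda>z. LINT x|lborel. (f (x + z) - f x)\<^sup>2) \<longlongrightarrow> 0) (at 0)"
proof -
  define g where "g = (\<lambda>x. f x * \<bar>f x\<bar>)"
  have g: "integrable lborel g"
    by (rule Bochner_Integration.integrable_bound[OF f]) (auto simp: g_def power2_eq_square abs_mult)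
  note gz = integrable_lborel_shift[OF g]
  have i: "integrable lborel (\<lambda>x. 2 * \<bar>g (x + z) - g x\<bar>)" for z
    using g gz[of z] by (auto intro!: integrable_abs)
  have le: "(f (x + z) - f x)\<^sup>2 \<le> 2 * \<bar>g (x + z) - g x\<bar>" for x z
    unfolding g_def by (rule diff_sq_le_signed_squares)
  show i2: "integrable lborel (\<lambda>x. (f (x + z) - f x)\<^sup>2)" for z
    by (rule Bochner_Integration.integrable_bound[OF i[of z]]) (use le in auto)
  show "((\<lambda>z. LINT x|lborel. (f (x + z) - f x)\<^sup>2) \<longlongrightarrow> 0) (at 0)"
  proof (rule tendsto_sandwich[OF _ _ tendsto_const])
    show "((\<lambda>z. 2 * (LINT x|lborel. \<bar>g (x + z) - g x\<bar>)) \<longlongrightarrow> 0) (at 0)"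
      using tendsto_mult_left[OF translation_L1[OF g], of 2] by simp
    have "(LINT x|lborel. (f (x + z) - f x)\<^sup>2) \<le> (LINT x|lborel. 2 * \<bar>g (x + z) - g x\<bar>)" for z
      by (rule integral_mono[OF i2 i le])
    then show "\<forall>\<^sub>F z in at 0. (LINT x|lborel. (f (x + z) - f x)\<^sup>2) \<le> 2 * (LINT x|lborel. \<bar>g (x + z) - g x\<bar>)"
      by simp
  qed (auto intro!: always_eventually Bochner_Integration.integral_nonneg)
qed

subsection \<open>The Gagliardo energy\<close>

text \<open>The kernel multiplied by the bound that holds, up to a constant, for squared differences
  of bounded Lipschitz functions. It is integrable at the origin because s < 1 and at infinity
  because s > 0.\<close>

definition trunc_kern :: "real \<Rightarrow> 'a::euclidean_space \<Rightarrow> real" where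
  "trunc_kern s z = min 1 ((norm z)\<^sup>2) / norm z powr (real DIM('a) + 2 * s)"

lemma trunc_kern_measurable [measurable]: "trunc_kern s \<in> borel_measurable borel"
  unfolding trunc_kern_def by measurable

lemma trunc_kern_nonneg: "trunc_kern s z \<ge> 0"
  by (simp add: trunc_kern_def)

text \<open>On a dyadic shell the kernel is bounded by a constant, so that integrability reduces to
  volumes of balls. The first alternative covers the shells inside the unit ball, with inner radius
  \<open>2 powr (- (j + 1))\<close>; the second covers the shells outside it, with inner radius
  \<open>2 powr j\<close>.\<close>

lemma trunc_kern_dyadic_bound:
  fixes z :: "'a::euclidean_space" and s :: real
  defines "p \<equiv> real DIM('a) + 2 * s"
  assumes "0 < s" "z \<noteq> 0"
  shows "\<exists>j::nat. (norm z < 2 powr (- real j) \<and> trunc_kern s z \<le> 2 powr (- (2 * real j)) * 2 powr (p * (real j + 1)))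
    \<or> (norm z < 2 powr (real j + 1) \<and> trunc_kern s z \<le> 2 powr (- (p * real j)))"
proof -
  define k where "k = \<lfloor>log 2 (norm z)\<rfloor>"
  have p: "p > 0" using assms by (simp add: p_def add_nonneg_pos)
  have z: "norm z > 0" using assms by simp
  have lo: "2 powr k \<le> norm z" using z by (simp add: k_def le_log_iff[symmetric])
  have hi: "norm z < 2 powr (k + 1)"
    using z floor_correct[of "log 2 (norm z)"] unfolding k_def by (subst log_less_iff[symmetric]) auto
  have pw: "norm z powr (- p) \<le> (2 powr k) powr (- p)"
    using lo z p by (intro powr_mono2') auto
  have tk: "trunc_kern s z = min 1 ((norm z)\<^sup>2) * norm z powr (- p)"
    unfolding p_def powr_minus trunc_kern_def by (simp add: divide_inverse)
  show ?thesis
  proof (cases "k \<ge> 0")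
    case True
    define j where "j = nat k"
    have jk: "real_of_int k = real j" using True by (simp add: j_def)
    have "trunc_kern s z \<le> 1 * norm z powr (- p)"
      unfolding tk by (intro mult_right_mono) auto
    also have "\<dots> \<le> 2 powr (- (p * j))" using pw by (simp add: powr_powr jk mult.commute)
    finally show ?thesis using hi by (intro exI[of _ j]) (auto simp: jk)
  next
    case False
    define j where "j = nat (- k - 1)"
    have jk: "real_of_int k = - (real j + 1)" using False by (simp add: j_def)
    have hi': "norm z < 2 powr (- real j)" using hi by (simp add: jk)
    have "(norm z)\<^sup>2 \<le> (2 powr (- real j))\<^sup>2" using hi' by (intro power_mono) auto
    also have "\<dots> = 2 powr (- (2 * real j))"
      by (simp add: power2_eq_square flip: powr_add)
    finally have "trunc_kern s z \<le> 2 powr (- (2 * real j)) * norm z powr (- p)"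
      unfolding tk by (intro mult_right_mono) auto
    also have "\<dots> \<le> 2 powr (- (2 * real j)) * 2 powr (p * (real j + 1))"
      using pw by (intro mult_left_mono) (auto simp: powr_powr jk mult.commute algebra_simps)
    finally show ?thesis using hi' by blast
  qed
qed

lemma suminf_ennreal_geometric_finite:
  assumes "0 \<le> C" "0 \<le> q" "q < 1"
  shows "(\<Sum>j. ennreal (C * q ^ j)) < \<infinity>"
proof -
  have "summable (\<lambda>j. C * q ^ j)" using assms by (intro summable_mult summable_geometric) auto
  then have "(\<Sum>j. ennreal (C * q ^ j)) = ennreal (\<Sum>j. C * q ^ j)"
    using assms by (intro suminf_ennreal2) auto
  then show ?thesis by simp
qed

text \<open>Shell constants times ball volumes form two geometric series. The ratio
  \<open>2 powr (2 * s - 2)\<close> belongs to the origin and \<open>2 powr (- 2 * s)\<close> to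
  infinity, so each bound on \<open>s\<close> is used by one of them.\<close>

lemma trunc_kern_integrable:
  assumes "0 < s" "s < 1"
  shows "integrable lborel (trunc_kern s :: 'a::euclidean_space \<Rightarrow> real)"
proof -
  define p where "p = real DIM('a) + 2 * s"
  define N where "N = real DIM('a)"
  define V where "V = unit_ball_vol (real DIM('a))"
  have V: "V \<ge> 0" by (simp add: V_def)
  define c where "c j = 2 powr (- (2 * real j)) * 2 powr (p * (real j + 1))" for j
  define d where "d j = 2 powr (- (p * real j))" for j
  have vol: "emeasure lborel (ball (0::'a) (2 powr r)) = ennreal (V * 2 powr (N * r))" for r
    by (subst emeasure_ball) (auto simp: V_def N_def powr_realpow[symmetric] powr_powr mult.commute)
  have le: "ennreal (trunc_kern s z) \<le> (\<Sum>j. ennreal (c j) * indicator (ball 0 (2 powr (- real j))) z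
      + ennreal (d j) * indicator (ball 0 (2 powr (real j + 1))) z)" (is "_ \<le> (\<Sum>j. ?f j)") for z :: 'a
  proof (cases "z = 0")
    case False
    obtain j where j: "ennreal (trunc_kern s z) \<le> ?f j"
      using trunc_kern_dyadic_bound[OF assms(1) False]
      by (fastforce simp: c_def d_def p_def indicator_def intro: ennreal_leI add_increasing add_increasing2)
    also have "?f j \<le> (\<Sum>j. ?f j)"
      using sum_le_suminf[of ?f "{j}"] by simp
    finally show ?thesis .
  qed (simp add: trunc_kern_def)
  have "(\<integral>\<^sup>+z. ennreal (trunc_kern s z) \<partial>(lborel :: 'a measure)) \<le>
     (\<integral>\<^sup>+z. (\<Sum>j. ennreal (c j) * indicator (ball (0::'a) (2 powr (- real j))) z
      + ennreal (d j) * indicator (ball 0 (2 powr (real j + 1))) z) \<partial>lborel)"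
    by (rule nn_integral_mono) (rule le)
  also have "\<dots> = (\<Sum>j. ennreal (c j) * ennreal (V * 2 powr (N * (- real j))) + ennreal (d j) * ennreal (V * 2 powr (N * (real j + 1))))"
  proof -
    have [measurable]: "(\<lambda>z. indicator (ball (0::'a) r) z :: ennreal) \<in> borel_measurable borel" for r
      by (intro borel_measurable_indicator) auto
    have "(\<integral>\<^sup>+z. ennreal (c j) * indicator (ball (0::'a) (2 powr (- real j))) z
      + ennreal (d j) * indicator (ball 0 (2 powr (real j + 1))) z \<partial>lborel)
      = ennreal (c j) * ennreal (V * 2 powr (N * (- real j))) + ennreal (d j) * ennreal (V * 2 powr (N * (real j + 1)))" for j
      unfolding vol[symmetric] by (subst nn_integral_add) (auto simp: nn_integral_cmult)
    then show ?thesis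
      by (subst nn_integral_suminf) auto
  qed
  also have "\<dots> = (\<Sum>j. ennreal (c j) * ennreal (V * 2 powr (N * (- real j)))) + (\<Sum>j. ennreal (d j) * ennreal (V * 2 powr (N * (real j + 1))))"
    by (rule suminf_add[symmetric]) auto
  also have "(\<lambda>j. ennreal (c j) * ennreal (V * 2 powr (N * (- real j)))) = (\<lambda>j. ennreal ((V * 2 powr p) * (2 powr (2 * s - 2)) ^ j))"
  proof
    fix j
    have "2 powr (- (2 * real j)) * 2 powr (p * (real j + 1)) * 2 powr (N * (- real j)) = 2 powr p * 2 powr ((2 * s - 2) * real j)"
      by (simp add: p_def N_def flip: powr_add) (simp add: algebra_simps)
    then show "ennreal (c j) * ennreal (V * 2 powr (N * (- real j))) = ennreal ((V * 2 powr p) * (2 powr (2 * s - 2)) ^ j)"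
      using V by (simp add: c_def powr_realpow[symmetric] powr_powr mult_ac flip: ennreal_mult)
  qed
  also have "(\<lambda>j. ennreal (d j) * ennreal (V * 2 powr (N * (real j + 1)))) = (\<lambda>j. ennreal ((V * 2 powr N) * (2 powr (- 2 * s)) ^ j))"
  proof
    fix j
    have "2 powr (- (p * real j)) * 2 powr (N * (real j + 1)) = 2 powr N * 2 powr ((- 2 * s) * real j)"
      by (simp add: p_def N_def flip: powr_add) (simp add: algebra_simps)
    then show "ennreal (d j) * ennreal (V * 2 powr (N * (real j + 1))) = ennreal ((V * 2 powr N) * (2 powr (- 2 * s)) ^ j)"
      using V by (simp add: d_def powr_realpow[symmetric] powr_powr mult_ac flip: ennreal_mult)
  qed
  also have "(\<Sum>j. ennreal ((V * 2 powr p) * (2 powr (2 * s - 2)) ^ j)) + (\<Sum>j. ennreal ((V * 2 powr N) * (2 powr (- 2 * s)) ^ j)) < \<infinity>"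
  proof -
    have q: "2 powr (2 * s - 2) < 1" "2 powr (- 2 * s) < 1"
      using powr_less_mono[of "2 * s - 2" 0 2] powr_less_mono[of "- 2 * s" 0 2] assms by simp_all
    have "(\<Sum>j. ennreal ((V * 2 powr p) * (2 powr (2 * s - 2)) ^ j)) < \<infinity>"
      "(\<Sum>j. ennreal ((V * 2 powr N) * (2 powr (- 2 * s)) ^ j)) < \<infinity>"
      using V q by (intro suminf_ennreal_geometric_finite; simp)+
    then show ?thesis unfolding infinity_ennreal_def ennreal_add_less_top by blast
  qed
  finally show ?thesis
    by (intro integrableI_bounded) (auto simp: trunc_kern_nonneg)
qed

definition energy_density :: "real \<Rightarrow> ('a::euclidean_space \<Rightarrow> real) \<Rightarrow> 'a \<times> 'a \<Rightarrow> real" where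
  "energy_density s f z = (f (fst z) - f (snd z))\<^sup>2 * kern s (fst z) (snd z)"

definition finite_energy :: "real \<Rightarrow> ('a::euclidean_space \<Rightarrow> real) \<Rightarrow> bool" where
  "finite_energy s f \<longleftrightarrow> integrable lborel (energy_density s f)"

lemma kern_nonneg: "kern s x y \<ge> 0"
  by (simp add: kern_def)

lemma kern_shift: "kern s (x + z) (y + z) = kern s x y"
  by (simp add: kern_def)

lemma kern_measurable [measurable]:
  "(\<lambda>z::'a::euclidean_space \<times> 'a. kern s (fst z) (snd z)) \<in> borel_measurable borel"
proof -
  have [measurable]: "(\<lambda>z::'a \<times> 'a. fst z - snd z) \<in> borel_measurable borel"
    by (intro borel_measurable_continuous_onI continuous_intros)
  show ?thesis unfolding kern_def by measurable
qed

lemma borel_measurable_fst_comp: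
  "f \<in> borel_measurable borel \<Longrightarrow> (\<lambda>z::'a::topological_space \<times> 'b::topological_space. f (fst z)) \<in> borel_measurable borel"
  by (erule borel_comp_continuous) (intro continuous_intros)

lemma borel_measurable_snd_comp:
  "f \<in> borel_measurable borel \<Longrightarrow> (\<lambda>z::'a::topological_space \<times> 'b::topological_space. f (snd z)) \<in> borel_measurable borel"
  by (erule borel_comp_continuous) (intro continuous_intros)

lemma energy_density_measurable:
  assumes "f \<in> borel_measurable borel"
  shows "energy_density s f \<in> borel_measurable borel"
proof -
  note [measurable] = borel_measurable_fst_comp[OF assms] borel_measurable_snd_comp[OF assms]
  show ?thesis unfolding energy_density_def by measurable
qed

text \<open>The density vanishes unless one of the two points lies in the ball. Integrating over the
  other point costs the integral of \<open>trunc_kern\<close>, and what remains is the volume of the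
  ball.\<close>

lemma finite_energy_Lipschitz:
  fixes f :: "'a::euclidean_space \<Rightarrow> real"
  assumes s: "0 < s" "s < 1" and [measurable]: "f \<in> borel_measurable borel"
    and C: "\<And>x y. (f x - f y)\<^sup>2 \<le> C * min 1 ((norm (x - y))\<^sup>2)" "C \<ge> 0"
    and supp: "\<And>x. norm x \<ge> R \<Longrightarrow> f x = 0"
  shows "finite_energy s f"
  unfolding finite_energy_def
proof (rule integrableI_bounded)
  let ?B = "ball (0::'a) R"
  have m1[measurable]: "(\<lambda>z::'a\<times>'a. trunc_kern s (fst z - snd z)) \<in> borel_measurable borel"
    by (intro borel_comp_continuous[OF trunc_kern_measurable] continuous_intros)
  have fin: "(\<integral>\<^sup>+z. ennreal (trunc_kern s z) \<partial>(lborel :: 'a measure)) < \<infinity>"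
    using trunc_kern_integrable[OF s] by (auto simp: integrable_iff_bounded trunc_kern_nonneg)
  have finB: "emeasure lborel ?B < \<infinity>" using emeasure_bounded_finite[of ?B] by auto
  have "(\<lambda>z::'a\<times>'a. indicator ?B (fst z) :: ennreal) \<in> borel_measurable borel"
    "(\<lambda>z::'a\<times>'a. indicator ?B (snd z) :: ennreal) \<in> borel_measurable borel"
    by (rule borel_measurable_fst_comp[OF borel_measurable_indicator] borel_measurable_snd_comp[OF borel_measurable_indicator], simp)+
  note [measurable] = this
  have "(\<lambda>z. indicator ?B (fst z) * ennreal (trunc_kern s (fst z - snd z))) \<in> borel_measurable borel"
    "(\<lambda>z. indicator ?B (snd z) * ennreal (trunc_kern s (fst z - snd z))) \<in> borel_measurable borel"
    by measurable
  then have a: "(\<lambda>z. indicator ?B (fst z) * ennreal (trunc_kern s (fst z - snd z))) \<in> borel_measurable (lborel \<Otimes>\<^sub>M lborel)"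
    "(\<lambda>z. indicator ?B (snd z) * ennreal (trunc_kern s (fst z - snd z))) \<in> borel_measurable (lborel \<Otimes>\<^sub>M lborel)"
    by (simp_all add: lborel_prod)
  show "energy_density s f \<in> borel_measurable lborel" using energy_density_measurable[OF assms(3)] by simp
  have le: "energy_density s f (x, y) \<le> C * (indicator ?B x * trunc_kern s (x - y)) + C * (indicator ?B y * trunc_kern s (x - y))" for x y
  proof (cases "x \<in> ?B \<or> y \<in> ?B")
    case True
    have "energy_density s f (x, y) \<le> C * trunc_kern s (x - y)"
      using mult_right_mono[OF C(1)[of x y] kern_nonneg[of s x y]]
      by (simp add: energy_density_def trunc_kern_def kern_def divide_simps split: if_splits)
    also have "\<dots> \<le> C * (indicator ?B x * trunc_kern s (x - y)) + C * (indicator ?B y * trunc_kern s (x - y))"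
      using True C(2) trunc_kern_nonneg[of s "x - y"] by (auto simp: indicator_def)
    finally show ?thesis .
  next
    case False
    then show ?thesis using supp[of x] supp[of y] C(2) trunc_kern_nonneg[of s "x - y"]
      by (simp add: energy_density_def)
  qed
  have "(\<integral>\<^sup>+z. ennreal (norm (energy_density s f z)) \<partial>lborel)
      = (\<integral>\<^sup>+z. ennreal (energy_density s f z) \<partial>(lborel \<Otimes>\<^sub>M lborel))"
    by (subst lborel_prod) (intro nn_integral_cong, auto simp: energy_density_def kern_nonneg)
  also have "\<dots> \<le> (\<integral>\<^sup>+z. ennreal C * (indicator ?B (fst z) * ennreal (trunc_kern s (fst z - snd z)))
       + ennreal C * (indicator ?B (snd z) * ennreal (trunc_kern s (fst z - snd z))) \<partial>(lborel \<Otimes>\<^sub>M lborel))"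
  proof (intro nn_integral_mono)
    fix z :: "'a \<times> 'a"
    have "ennreal (energy_density s f z) \<le> ennreal (C * (indicator ?B (fst z) * trunc_kern s (fst z - snd z)) + C * (indicator ?B (snd z) * trunc_kern s (fst z - snd z)))"
      using le[of "fst z" "snd z"] by (intro ennreal_leI) simp
    also have "\<dots> = ennreal C * (indicator ?B (fst z) * ennreal (trunc_kern s (fst z - snd z)))
       + ennreal C * (indicator ?B (snd z) * ennreal (trunc_kern s (fst z - snd z)))"
      using C(2) trunc_kern_nonneg[of s "fst z - snd z"]
      by (auto simp: indicator_def ennreal_mult mult_2)
    finally show "ennreal (energy_density s f z) \<le> \<dots>" .
  qed
  also have *: "\<dots> = ennreal C * (\<integral>\<^sup>+z. indicator ?B (fst z) * ennreal (trunc_kern s (fst z - snd z)) \<partial>(lborel \<Otimes>\<^sub>M lborel))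
       + ennreal C * (\<integral>\<^sup>+z. indicator ?B (snd z) * ennreal (trunc_kern s (fst z - snd z)) \<partial>(lborel \<Otimes>\<^sub>M lborel))"
  proof -
    show ?thesis using a by (simp add: nn_integral_add nn_integral_cmult)
  qed
  also have "(\<integral>\<^sup>+z. indicator ?B (fst z) * ennreal (trunc_kern s (fst z - snd z)) \<partial>(lborel \<Otimes>\<^sub>M lborel))
      = (\<integral>\<^sup>+x. \<integral>\<^sup>+y. indicator ?B x * ennreal (trunc_kern s (x - y)) \<partial>lborel \<partial>lborel)"
    using lborel.nn_integral_fst[OF a(1)] by simp
  also have "\<dots> = (\<integral>\<^sup>+x. indicator ?B x * (\<integral>\<^sup>+y. ennreal (trunc_kern s y) \<partial>(lborel :: 'a measure)) \<partial>lborel)"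
    by (simp add: nn_integral_cmult nn_integral_lborel_reflect[of "\<lambda>y. ennreal (trunc_kern s y)"])
  also have "\<dots> = emeasure lborel ?B * (\<integral>\<^sup>+y. ennreal (trunc_kern s y) \<partial>(lborel :: 'a measure))"
    by (subst nn_integral_multc) (auto intro!: borel_measurable_indicator)
  also have "(\<integral>\<^sup>+z. indicator ?B (snd z) * ennreal (trunc_kern s (fst z - snd z)) \<partial>(lborel \<Otimes>\<^sub>M lborel))
      = (\<integral>\<^sup>+y. \<integral>\<^sup>+x. indicator ?B y * ennreal (trunc_kern s (x - y)) \<partial>lborel \<partial>lborel)"
    using lborel_pair.nn_integral_snd[OF a(2)] by simp
  also have "\<dots> = (\<integral>\<^sup>+x. indicator ?B x * (\<integral>\<^sup>+y. ennreal (trunc_kern s y) \<partial>(lborel :: 'a measure)) \<partial>lborel)"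
    using nn_integral_lborel_shift[of "\<lambda>y::'a. ennreal (trunc_kern s y)" "- _"]
    by (simp add: nn_integral_cmult)
  also have "\<dots> = emeasure lborel ?B * (\<integral>\<^sup>+y. ennreal (trunc_kern s y) \<partial>(lborel :: 'a measure))"
    by (subst nn_integral_multc) (auto intro!: borel_measurable_indicator)
  also have "ennreal C * (emeasure lborel ?B * (\<integral>\<^sup>+y. ennreal (trunc_kern s y) \<partial>(lborel :: 'a measure)))
     + ennreal C * (emeasure lborel ?B * (\<integral>\<^sup>+y. ennreal (trunc_kern s y) \<partial>(lborel :: 'a measure))) < \<infinity>"
    using fin finB by (auto simp: ennreal_mult_less_top ennreal_add_less_top)
  finally show "(\<integral>\<^sup>+z. ennreal (norm (energy_density s f z)) \<partial>lborel) < \<infinity>" .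
qed

lemma bump1_Lipschitz:
  assumes "M \<ge> 0"
  shows "\<exists>L\<ge>0. \<forall>x\<in>{0..M}. \<forall>y\<in>{0..M}. \<bar>bump1 x - bump1 y\<bar> \<le> L * \<bar>x - y\<bar>"
proof -
  let ?D = "exp_recip ([:0, 0, 1:] * (1 - pderiv 1))"
  have "continuous_on {0..M} ?D"
    using smooth_exp_recip by (rule smooth_fun_imp_continuous)
  then have "bounded (?D ` {0..M})" by (intro compact_imp_bounded compact_continuous_image) auto
  then obtain L where L: "\<And>x. x \<in> {0..M} \<Longrightarrow> \<bar>?D x\<bar> \<le> L"
    unfolding bounded_iff real_norm_def by blast
  have "norm (bump1 x - bump1 y) \<le> L * norm (x - y)" if "x \<in> {0..M}" "y \<in> {0..M}" for x y
    using that exp_recip_deriv[of 1] L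
    by (intro field_differentiable_bound[of "{0..M}" bump1 ?D]) (auto simp: bump1_def intro: has_field_derivative_at_within)
  moreover have "L \<ge> 0" using L[of 0] assms by fastforce
  ultimately show ?thesis by (intro exI[of _ L]) auto
qed

lemma bump_continuous: "continuous_on S (bump k)"
  unfolding bump_def
  by (intro continuous_on_compose2[OF smooth_fun_imp_continuous[OF bump1(1), of UNIV]] continuous_intros) auto

lemma bump_measurable [measurable]: "bump k \<in> borel_measurable borel"
  by (intro borel_measurable_continuous_onI bump_continuous)

lemma bump_integrable: 
  assumes "k > 0"
  shows "integrable lborel (bump k :: 'a::euclidean_space \<Rightarrow> real)"
proof (rule Bochner_Integration.integrable_bound)
  show "integrable lborel (indicator (ball (0::'a) k) :: 'a \<Rightarrow> real)"
    using emeasure_bounded_finite[of "ball (0::'a) k"] by (simp add: integrable_indicator_iff)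
  show "AE x in lborel. norm (bump k x) \<le> norm (indicator (ball (0::'a) k) x :: real)"
  proof (rule AE_I2)
    fix x :: 'a show "norm (bump k x) \<le> norm (indicator (ball 0 k) x :: real)"
      using bump_bounds(1,2)[of k x] bump_bounds(3)[OF _ assms, of x]
      by (auto simp: indicator_def not_less)
  qed
qed auto

lemma bump_finite_energy:
  assumes s: "0 < s" "s < 1" and k: "k > 0"
  shows "finite_energy s (bump k :: 'a::euclidean_space \<Rightarrow> real)"
proof -
  obtain L where L: "L \<ge> 0" "\<And>x y. x \<in> {0..k\<^sup>2} \<Longrightarrow> y \<in> {0..k\<^sup>2} \<Longrightarrow> \<bar>bump1 x - bump1 y\<bar> \<le> L * \<bar>x - y\<bar>"
    using bump1_Lipschitz[of "k\<^sup>2"] by auto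
  \<comment> \<open>Clamping the norm at \<open>k\<close> does not change the bump, and keeps the
    argument of \<open>bump1\<close> in a compact interval, where it is Lipschitz.\<close>
  define m where "m x = min k (norm x)" for x :: 'a
  have bm: "bump k x = bump1 (k\<^sup>2 - (m x)\<^sup>2)" for x :: 'a
    using k by (cases "norm x \<le> k") (auto simp: bump_def m_def bump1 min_def)
  have m: "0 \<le> m x" "m x \<le> k" for x using k by (auto simp: m_def)
  have md: "\<bar>m x - m y\<bar> \<le> norm (x - y)" for x y
    using norm_triangle_ineq3[of x y] by (auto simp: m_def min_def)
  have lip: "\<bar>bump k x - bump k y\<bar> \<le> L * (2 * k) * norm (x - y)" for x y :: 'a
  proof -
    have r: "k\<^sup>2 - (m x)\<^sup>2 \<in> {0..k\<^sup>2}" for x using m[of x] by (auto intro: power_mono)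
    have "\<bar>bump k x - bump k y\<bar> \<le> L * \<bar>(k\<^sup>2 - (m x)\<^sup>2) - (k\<^sup>2 - (m y)\<^sup>2)\<bar>"
      unfolding bm by (rule L(2)[OF r r])
    also have "(k\<^sup>2 - (m x)\<^sup>2) - (k\<^sup>2 - (m y)\<^sup>2) = (m y + m x) * (m y - m x)"
      by (simp add: power2_eq_square algebra_simps)
    also have "L * \<bar>(m y + m x) * (m y - m x)\<bar> \<le> L * (2 * k * norm (x - y))"
      using md[of y x] m[of x] m[of y] L(1) k
      by (intro mult_left_mono) (auto simp: abs_mult norm_minus_commute intro!: mult_mono)
    finally show ?thesis by (simp add: mult_ac)
  qed
  \<comment> \<open>The summand 1 serves pairs of points further apart than 1, the squared Lipschitz
    constant serves the others.\<close>
  define C where "C = 1 + (L * (2 * k))\<^sup>2"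
  have "(bump k x - bump k y)\<^sup>2 \<le> C * min 1 ((norm (x - y))\<^sup>2)" for x y :: 'a
  proof -
    have "\<bar>bump k x - bump k y\<bar> \<le> 1" using bump_bounds(1,2)[of k] by (smt (verit))
    then have a: "(bump k x - bump k y)\<^sup>2 \<le> 1" by (simp add: abs_square_le_1)
    have b: "(bump k x - bump k y)\<^sup>2 \<le> (L * (2 * k))\<^sup>2 * (norm (x - y))\<^sup>2"
      using power_mono[OF lip[of x y], of 2] by (simp add: power_mult_distrib)
    show ?thesis
    proof (cases "(norm (x - y))\<^sup>2 \<le> 1")
      case True
      have "(L * (2 * k))\<^sup>2 * (norm (x - y))\<^sup>2 \<le> C * (norm (x - y))\<^sup>2"
        by (intro mult_right_mono) (auto simp: C_def)
      with b True show ?thesis by (simp add: min_def)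
    next
      case False
      then show ?thesis using a by (simp add: C_def min_def add_increasing2)
    qed
  qed
  then show ?thesis
    by (rule finite_energy_Lipschitz[OF s bump_measurable, where R=k]) (auto simp: C_def bump_bounds(3) k)
qed

subsection \<open>Test functions of finite energy\<close>

lemma L2_Cauchy_Schwarz:
  fixes f g :: "'a \<Rightarrow> real"
  assumes [measurable]: "f \<in> borel_measurable M" "g \<in> borel_measurable M"
    and f: "integrable M (\<lambda>x. (f x)\<^sup>2)" and g: "integrable M (\<lambda>x. (g x)\<^sup>2)"
  shows "integrable M (\<lambda>x. f x * g x)"
    "\<bar>LINT x|M. f x * g x\<bar> \<le> sqrt (LINT x|M. (f x)\<^sup>2) * sqrt (LINT x|M. (g x)\<^sup>2)"
proof -
  have le: "\<bar>f x * g x\<bar> \<le> (f x)\<^sup>2 + (g x)\<^sup>2" for x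
  proof -
    have "2 * (\<bar>f x\<bar> * \<bar>g x\<bar>) \<le> (f x)\<^sup>2 + (g x)\<^sup>2"
      using sum_squares_bound[of "\<bar>f x\<bar>" "\<bar>g x\<bar>"] by (simp add: mult.assoc)
    moreover have "0 \<le> \<bar>f x\<bar> * \<bar>g x\<bar>" by simp
    ultimately show ?thesis unfolding abs_mult by linarith
  qed
  show i: "integrable M (\<lambda>x. f x * g x)"
    by (rule Bochner_Integration.integrable_bound[OF Bochner_Integration.integrable_add[OF f g]])
      (use le in auto)
  have ia: "integrable M (\<lambda>x. \<bar>f x\<bar> * \<bar>g x\<bar>)"
    using integrable_abs[OF i] by (simp add: abs_mult)
  have "(\<integral>\<^sup>+x. ennreal \<bar>f x\<bar> * ennreal \<bar>g x\<bar> \<partial>M)\<^sup>2 \<le> (\<integral>\<^sup>+x. (ennreal \<bar>f x\<bar>)\<^sup>2 \<partial>M) * (\<integral>\<^sup>+x. (ennreal \<bar>g x\<bar>)\<^sup>2 \<partial>M)"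
    by (rule Cauchy_Schwarz_nn_integral) auto
  moreover have "(\<integral>\<^sup>+x. (ennreal \<bar>f x\<bar>)\<^sup>2 \<partial>M) = ennreal (LINT x|M. (f x)\<^sup>2)"
    using nn_integral_eq_integral[OF f] by (simp add: ennreal_power)
  moreover have "(\<integral>\<^sup>+x. (ennreal \<bar>g x\<bar>)\<^sup>2 \<partial>M) = ennreal (LINT x|M. (g x)\<^sup>2)"
    using nn_integral_eq_integral[OF g] by (simp add: ennreal_power)
  moreover have "(\<integral>\<^sup>+x. ennreal \<bar>f x\<bar> * ennreal \<bar>g x\<bar> \<partial>M) = ennreal (LINT x|M. \<bar>f x\<bar> * \<bar>g x\<bar>)"
    using nn_integral_eq_integral[OF ia] by (simp add: ennreal_mult)
  ultimately have "(LINT x|M. \<bar>f x\<bar> * \<bar>g x\<bar>)\<^sup>2 \<le> (LINT x|M. (f x)\<^sup>2) * (LINT x|M. (g x)\<^sup>2)"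
    by (simp add: ennreal_power Bochner_Integration.integral_nonneg flip: ennreal_mult)
  then have "(LINT x|M. \<bar>f x\<bar> * \<bar>g x\<bar>) \<le> sqrt ((LINT x|M. (f x)\<^sup>2) * (LINT x|M. (g x)\<^sup>2))"
    by (rule real_le_rsqrt)
  moreover have "\<bar>LINT x|M. f x * g x\<bar> \<le> (LINT x|M. \<bar>f x\<bar> * \<bar>g x\<bar>)"
    using integral_abs_bound[of M "\<lambda>x. f x * g x"] by (simp add: abs_mult)
  ultimately show "\<bar>LINT x|M. f x * g x\<bar> \<le> sqrt (LINT x|M. (f x)\<^sup>2) * sqrt (LINT x|M. (g x)\<^sup>2)"
    by (simp add: real_sqrt_mult)
qed

lemma integrable_lborel_times:
  fixes f :: "'a::euclidean_space \<Rightarrow> real" and g :: "'b::euclidean_space \<Rightarrow> real"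
  assumes f: "integrable lborel f" and g: "integrable lborel g"
  shows "integrable lborel (\<lambda>p. f (fst p) * g (snd p))"
    "(LINT p|lborel. f (fst p) * g (snd p)) = (LINT x|lborel. f x) * (LINT y|lborel. g y)"
proof -
  have [measurable]: "f \<in> borel_measurable lborel" "g \<in> borel_measurable lborel"
    using f g by auto
  have i: "integrable (lborel \<Otimes>\<^sub>M lborel) (\<lambda>p. f (fst p) * g (snd p))"
  proof (rule lborel_pair.Fubini_integrable)
    have "(\<lambda>x. LINT y|lborel. norm (f (fst (x, y)) * g (snd (x, y)))) = (\<lambda>x. norm (f x) * (LINT y|lborel. norm (g y)))"
      by (simp add: abs_mult)
    then show "integrable lborel (\<lambda>x. LINT y|lborel. norm (f (fst (x, y)) * g (snd (x, y))))"
      using f by simp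
  qed (use g in auto)
  then show "integrable lborel (\<lambda>p. f (fst p) * g (snd p))" by (simp add: lborel_prod)
  show "(LINT p|lborel. f (fst p) * g (snd p)) = (LINT x|lborel. f x) * (LINT y|lborel. g y)"
    using lborel_pair.integral_fst'[OF i] by (simp add: lborel_prod)
qed

text \<open>\<open>\<kappa> = 0\<close> is used for the time term and \<open>\<kappa> = 1\<close> for the energy, whose two halves are not integrable separately.\<close>

lemma convolution_swap:
  fixes U :: "'c::euclidean_space \<Rightarrow> real" and \<pi>1 \<pi>2 :: "'c \<Rightarrow> 'a::euclidean_space"
    and P \<rho> :: "'a \<Rightarrow> real" and \<kappa> :: real
  assumes [measurable]: "P \<in> borel_measurable borel" "\<rho> \<in> borel_measurable borel"
    and iP: "integrable lborel P" and \<rho>b: "\<And>x. \<bar>\<rho> x\<bar> \<le> B"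
    and i1: "integrable lborel (\<lambda>p. P (fst p) * (U (snd p) * (\<rho> (\<pi>1 (snd p) - fst p) - \<kappa> * \<rho> (\<pi>2 (snd p) - fst p))))"
    and i2: "integrable lborel (\<lambda>p. \<rho> (fst p) * (U (snd p) * (P (\<pi>1 (snd p) - fst p) - \<kappa> * P (\<pi>2 (snd p) - fst p))))"
  shows "(LINT x|lborel. P x * (LINT c|lborel. U c * (\<rho> (\<pi>1 c - x) - \<kappa> * \<rho> (\<pi>2 c - x))))
       = (LINT z|lborel. \<rho> z * (LINT c|lborel. U c * (P (\<pi>1 c - z) - \<kappa> * P (\<pi>2 c - z))))"
    "integrable lborel (\<lambda>z. \<rho> z * (LINT c|lborel. U c * (P (\<pi>1 c - z) - \<kappa> * P (\<pi>2 c - z))))"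
proof -
  have c1: "integrable lborel (\<lambda>x. P x * \<rho> (y - x))" for y
  proof (rule Bochner_Integration.integrable_bound)
    show "integrable lborel (\<lambda>x. B * P x)" using iP by simp
    show "AE x in lborel. norm (P x * \<rho> (y - x)) \<le> norm (B * P x)"
    proof (rule AE_I2)
      fix x show "norm (P x * \<rho> (y - x)) \<le> norm (B * P x)"
        using mult_left_mono[of "\<bar>\<rho> (y - x)\<bar>" "\<bar>B\<bar>" "\<bar>P x\<bar>"] order_trans[OF \<rho>b[of "y - x"] abs_ge_self]
        by (simp add: abs_mult mult.commute)
    qed
  qed simp
  \<comment> \<open>The reflection of the line of integration at \<open>y\<close> exchanges the two
    factors of a convolution; this is the whole content of the swap.\<close>
  have c2: "(LINT z|lborel. \<rho> z * P (y - z)) = (LINT x|lborel. P x * \<rho> (y - x))" for y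
    using integral_lborel_reflect[of "\<lambda>z. \<rho> z * P (y - z)" y] by (simp add: mult.commute)
  have c3: "integrable lborel (\<lambda>z. \<rho> z * P (y - z))" for y
  proof -
    have "integrable (distr lborel borel (\<lambda>x. y - x)) (\<lambda>x. P x * \<rho> (y - x))"
      using c1 by (simp add: lborel_distr_reflect)
    then have "integrable lborel (\<lambda>x. P (y - x) * \<rho> (y - (y - x)))"
      by (rule integrable_distr[rotated]) simp
    then show ?thesis by (simp add: mult.commute)
  qed
  have i1': "integrable (lborel \<Otimes>\<^sub>M lborel) (\<lambda>(x, c). P x * (U c * (\<rho> (\<pi>1 c - x) - \<kappa> * \<rho> (\<pi>2 c - x))))"
    using i1 by (simp only: lborel_prod case_prod_unfold)
  have i2': "integrable (lborel \<Otimes>\<^sub>M lborel) (\<lambda>(x, c). \<rho> x * (U c * (P (\<pi>1 c - x) - \<kappa> * P (\<pi>2 c - x))))"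
    using i2 by (simp only: lborel_prod case_prod_unfold)
  have "(LINT x|lborel. P x * (LINT c|lborel. U c * (\<rho> (\<pi>1 c - x) - \<kappa> * \<rho> (\<pi>2 c - x))))
      = (LINT x|lborel. LINT c|lborel. P x * (U c * (\<rho> (\<pi>1 c - x) - \<kappa> * \<rho> (\<pi>2 c - x))))"
    by simp
  also have "\<dots> = (LINT c|lborel. LINT x|lborel. P x * (U c * (\<rho> (\<pi>1 c - x) - \<kappa> * \<rho> (\<pi>2 c - x))))"
    by (rule lborel_pair.Fubini_integral[OF i1', symmetric])
  also have "\<dots> = (LINT c|lborel. U c * ((LINT x|lborel. P x * \<rho> (\<pi>1 c - x)) - \<kappa> * (LINT x|lborel. P x * \<rho> (\<pi>2 c - x))))"
  proof (rule Bochner_Integration.integral_cong[OF refl])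
    fix c
    have "(LINT x|lborel. P x * (U c * (\<rho> (\<pi>1 c - x) - \<kappa> * \<rho> (\<pi>2 c - x))))
       = (LINT x|lborel. U c * (P x * \<rho> (\<pi>1 c - x) - \<kappa> * (P x * \<rho> (\<pi>2 c - x))))"
      by (simp add: algebra_simps)
    also have "\<dots> = U c * ((LINT x|lborel. P x * \<rho> (\<pi>1 c - x)) - \<kappa> * (LINT x|lborel. P x * \<rho> (\<pi>2 c - x)))"
      using c1 by simp
    finally show "(LINT x|lborel. P x * (U c * (\<rho> (\<pi>1 c - x) - \<kappa> * \<rho> (\<pi>2 c - x)))) = \<dots>" .
  qed
  also have "\<dots> = (LINT c|lborel. LINT x|lborel. \<rho> x * (U c * (P (\<pi>1 c - x) - \<kappa> * P (\<pi>2 c - x))))"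
  proof (rule Bochner_Integration.integral_cong[OF refl])
    fix c
    have "(LINT x|lborel. \<rho> x * (U c * (P (\<pi>1 c - x) - \<kappa> * P (\<pi>2 c - x))))
       = (LINT x|lborel. U c * (\<rho> x * P (\<pi>1 c - x) - \<kappa> * (\<rho> x * P (\<pi>2 c - x))))"
      by (simp add: algebra_simps)
    also have "\<dots> = U c * ((LINT x|lborel. P x * \<rho> (\<pi>1 c - x)) - \<kappa> * (LINT x|lborel. P x * \<rho> (\<pi>2 c - x)))"
      using c3 by (simp add: c2)
    finally show "U c * ((LINT x|lborel. P x * \<rho> (\<pi>1 c - x)) - \<kappa> * (LINT x|lborel. P x * \<rho> (\<pi>2 c - x)))
      = (LINT x|lborel. \<rho> x * (U c * (P (\<pi>1 c - x) - \<kappa> * P (\<pi>2 c - x))))" by simp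
  qed
  also have "\<dots> = (LINT x|lborel. LINT c|lborel. \<rho> x * (U c * (P (\<pi>1 c - x) - \<kappa> * P (\<pi>2 c - x))))"
    by (rule lborel_pair.Fubini_integral[OF i2'])
  finally show "(LINT x|lborel. P x * (LINT c|lborel. U c * (\<rho> (\<pi>1 c - x) - \<kappa> * \<rho> (\<pi>2 c - x))))
       = (LINT z|lborel. \<rho> z * (LINT c|lborel. U c * (P (\<pi>1 c - z) - \<kappa> * P (\<pi>2 c - z))))"
    by simp
  show "integrable lborel (\<lambda>z. \<rho> z * (LINT c|lborel. U c * (P (\<pi>1 c - z) - \<kappa> * P (\<pi>2 c - z))))"
    using lborel_pair.integrable_fst'[OF i2'] by simp
qed

text \<open>Were \<open>H\<close> positive at the origin, it would exceed half that value on a ball,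
  and the bump of this radius, positive on the whole ball, would have positive integral against
  \<open>H\<close>. The same argument applies to \<open>- H\<close>.\<close>

lemma bump_integral_zero_imp_zero:
  fixes H :: "'a::euclidean_space \<Rightarrow> real"
  assumes lim: "(H \<longlongrightarrow> H 0) (at 0)"
    and int: "\<And>k. k > 0 \<Longrightarrow> integrable lborel (\<lambda>z. bump k z * H z)"
    and zero: "\<And>k. k > 0 \<Longrightarrow> (LINT z|lborel. bump k z * H z) = 0"
  shows "H 0 = 0"
proof -
  have pos: "\<not> G 0 > 0" if lim: "(G \<longlongrightarrow> G 0) (at 0)"
    and int: "\<And>k. k > 0 \<Longrightarrow> integrable lborel (\<lambda>z. bump k z * G z)"
    and zero: "\<And>k. k > 0 \<Longrightarrow> (LINT z|lborel. bump k z * G z) = 0" for G :: "'a \<Rightarrow> real"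
  proof
    assume G0: "G 0 > 0"
    have "\<forall>\<^sub>F z in at 0. G z > G 0 / 2" using lim G0 by (intro order_tendstoD) auto
    then obtain d where d: "d > 0" "\<And>z. z \<noteq> 0 \<Longrightarrow> dist z 0 < d \<Longrightarrow> G z > G 0 / 2"
      by (auto simp: eventually_at)
    have ge: "bump d z * (G 0 / 2) \<le> bump d z * G z" for z
    proof (cases "norm z < d")
      case True
      then have "G z \<ge> G 0 / 2" using d(2)[of z] G0 by (cases "z = 0") auto
      then show ?thesis by (intro mult_left_mono bump_bounds(1))
    qed (use bump_bounds(3)[of d z] d(1) in auto)
    have "(LINT z|lborel. bump d (z::'a) * (G 0 / 2)) \<le> (LINT z|lborel. bump d z * G z)"
      using int[OF d(1)] bump_integrable[OF d(1)] ge by (intro integral_mono) auto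
    then have "(LINT z|lborel. bump d (z::'a)) \<le> 0"
      using zero[OF d(1)] G0 by (simp add: mult_le_0_iff)
    then have "(LINT z|lborel. bump d (z::'a)) = 0"
      by (intro antisym Bochner_Integration.integral_nonneg bump_bounds(1))
    then have "AE z in lborel. bump d (z::'a) = 0"
      using integral_nonneg_eq_0_iff_AE[OF bump_integrable[OF d(1), where 'a='a]] by (simp add: bump_bounds(1))
    then have "AE z in lborel. z \<notin> ball (0::'a) d"
      by eventually_elim (use bump_bounds(4)[of _ d] in fastforce)
    then have "emeasure lborel (ball (0::'a) d) = 0"
      by (subst (asm) AE_iff_measurable[OF _ refl]) (auto simp: ball_def dist_norm)
    then show False
      using d(1) unit_ball_vol_pos[of "real DIM('a)"] by (simp add: emeasure_ball)
  qed
  have "\<not> H 0 > 0" using pos[OF lim int zero] .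
  moreover have "\<not> - H 0 > 0"
    using pos[of "\<lambda>z. - H z"] tendsto_minus[OF lim] int zero by simp
  ultimately show ?thesis by simp
qed

lemma sq_diff_bound: "\<bar>a * b\<bar> \<le> a\<^sup>2 + b\<^sup>2" for a b :: real
proof -
  have "2 * (\<bar>a\<bar> * \<bar>b\<bar>) \<le> a\<^sup>2 + b\<^sup>2"
    using sum_squares_bound[of "\<bar>a\<bar>" "\<bar>b\<bar>"] by (simp add: mult.assoc)
  moreover have "0 \<le> \<bar>a\<bar> * \<bar>b\<bar>" by simp
  ultimately show ?thesis unfolding abs_mult by linarith
qed

lemma energy_density_shift_eq:
  "(f (fst z - x) - f (snd z - x))\<^sup>2 * kern s (fst z) (snd z) = energy_density s f (z + (- x, - x))"
  using kern_shift[of s "fst z" "- x" "snd z"] by (simp add: energy_density_def)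

lemma finite_energy_shift:
  assumes "finite_energy s f"
  shows "integrable lborel (\<lambda>z. (f (fst z - x) - f (snd z - x))\<^sup>2 * kern s (fst z) (snd z))"
    "(LINT z|lborel. (f (fst z - x) - f (snd z - x))\<^sup>2 * kern s (fst z) (snd z)) = (LINT z|lborel. energy_density s f z)"
  unfolding energy_density_shift_eq
  using integrable_lborel_shift[OF assms[unfolded finite_energy_def]]
    integral_lborel_shift[of "energy_density s f"] assms[unfolded finite_energy_def] by auto

lemma integrable_indicator_Icc: "integrable lborel (indicator {a..b} :: real \<Rightarrow> real)"
  by (simp add: integrable_indicator_iff emeasure_lborel_Icc_eq)

text \<open>The kernel depends on differences only, so the energy of the shifted \<open>G\<close>
  does not depend on the shift. The inner integral is a constant and the integrability of
  \<open>f\<close> decides.\<close>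

lemma integrable_times_shifted_energy:
  fixes f G :: "'a::euclidean_space \<Rightarrow> real" and a b :: real
  assumes f: "integrable lborel f" and [measurable]: "G \<in> borel_measurable borel" and G: "finite_energy s G"
  shows "integrable lborel (\<lambda>p. f (fst p) * (indicator {a..b} (snd (snd p)) *
     ((G (fst (fst (snd p)) - fst p) - G (snd (fst (snd p)) - fst p))\<^sup>2 * kern s (fst (fst (snd p))) (snd (fst (snd p))))))"
proof -
  have [measurable]: "f \<in> borel_measurable borel" using f by auto
  define V where "V = (\<lambda>(x::'a) (q::('a \<times> 'a) \<times> real). (G (fst (fst q) - x) - G (snd (fst q) - x))\<^sup>2 * kern s (fst (fst q)) (snd (fst q))
     * indicator {a..b} (snd q))"
  have iV: "integrable lborel (V x)" 
    and vV: "(LINT q|lborel. V x q) = (LINT z|lborel. energy_density s G z) * (LINT t|lborel. indicator {a..b} t)" for x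
    using integrable_lborel_times[OF finite_energy_shift(1)[OF G] integrable_indicator_Icc, of x a b]
    unfolding V_def finite_energy_shift(2)[OF G] by simp_all
  have nV: "norm (f x * V x q) = norm (f x) * V x q" for x q
    by (simp add: V_def abs_mult kern_nonneg)
  have "integrable (lborel \<Otimes>\<^sub>M lborel) (\<lambda>p. f (fst p) * V (fst p) (snd p))"
  proof (rule lborel_pair.Fubini_integrable)
    have 1: "(\<lambda>p. f (fst p)) \<in> borel_measurable (borel :: ('a \<times> (('a \<times> 'a) \<times> real)) measure)"
      by (rule borel_comp_continuous[of f]) (simp, intro continuous_intros)
    have 2: "(\<lambda>p. G (fst (fst (snd p)) - fst p)) \<in> borel_measurable (borel :: ('a \<times> (('a \<times> 'a) \<times> real)) measure)"
      by (rule borel_comp_continuous[of G]) (simp, intro continuous_intros)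
    have 3: "(\<lambda>p. G (snd (fst (snd p)) - fst p)) \<in> borel_measurable (borel :: ('a \<times> (('a \<times> 'a) \<times> real)) measure)"
      by (rule borel_comp_continuous[of G]) (simp, intro continuous_intros)
    have 4: "(\<lambda>p. kern s (fst (fst (snd p))) (snd (fst (snd p)))) \<in> borel_measurable (borel :: ('a \<times> (('a \<times> 'a) \<times> real)) measure)"
      by (rule borel_comp_continuous[OF kern_measurable]) (intro continuous_intros)
    have 5: "(\<lambda>p. indicator {a..b} (snd (snd p)) :: real) \<in> borel_measurable (borel :: ('a \<times> (('a \<times> 'a) \<times> real)) measure)"
      by (rule borel_comp_continuous[of "indicator {a..b}"]) (simp, intro continuous_intros)
    note [measurable] = 1 2 3 4 5
    have "(\<lambda>p. f (fst p) * V (fst p) (snd p)) \<in> borel_measurable borel"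
      unfolding V_def by measurable
    then show "(\<lambda>p. f (fst p) * V (fst p) (snd p)) \<in> borel_measurable (lborel \<Otimes>\<^sub>M lborel)"
      by (simp add: lborel_prod)
    show "integrable lborel (\<lambda>x. LINT q|lborel. norm (f (fst (x, q)) * V (fst (x, q)) (snd (x, q))))"
      unfolding fst_conv snd_conv nV using f by (simp add: vV)
    show "AE x in lborel. integrable lborel (\<lambda>q. f (fst (x, q)) * V (fst (x, q)) (snd (x, q)))"
      using iV by simp
  qed
  then show ?thesis
    unfolding lborel_prod V_def by (simp add: mult_ac)
qed

text \<open>The linear core of the extension to test functions of finite energy: \<open>w\<close>
  stands for a solution, \<open>W\<close> for its nonlinearity, and one time factor
  \<open>\<theta>\<close> is fixed. Square integrability is assumed of the differences of
  \<open>W\<close> in space, matching the homogeneous seminorm.\<close>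

locale weak_pair =
  fixes s a b c :: real and w W :: "'a::euclidean_space \<times> real \<Rightarrow> real" and \<theta> \<theta>' :: "real \<Rightarrow> real"
  assumes s: "0 < s" "s < 1"
    and w_meas [measurable]: "w \<in> borel_measurable borel" and W_meas [measurable]: "W \<in> borel_measurable borel"
    and \<theta>_meas [measurable]: "\<theta> \<in> borel_measurable borel" and \<theta>'_meas [measurable]: "\<theta>' \<in> borel_measurable borel"
    and \<theta>_supp: "\<And>r. r \<notin> {a..b} \<Longrightarrow> \<theta> r = 0" "\<And>r. r \<notin> {a..b} \<Longrightarrow> \<theta>' r = 0"
    and \<theta>_bounded: "\<exists>B. \<forall>r. \<bar>\<theta> r\<bar> \<le> B" "\<exists>B. \<forall>r. \<bar>\<theta>' r\<bar> \<le> B"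
    and w_int: "integrable lborel (\<lambda>z. indicator {a..b} (snd z) * w z)"
    and W_int: "integrable lborel (\<lambda>q. indicator {a..b} (snd q) *
        ((W (fst (fst q), snd q) - W (snd (fst q), snd q))\<^sup>2 * kern s (fst (fst q)) (snd (fst q))))"
    and weak: "\<And>x k. k > 0 \<Longrightarrow> (LINT z|lborel. w z * (bump k (fst z - x) * \<theta>' (snd z)))
       = c * (LINT q|lborel. (W (fst (fst q), snd q) - W (snd (fst q), snd q)) *
          (bump k (fst (fst q) - x) - bump k (snd (fst q) - x)) * \<theta> (snd q) * kern s (fst (fst q)) (snd (fst q)))"
begin

definition "U1 z = w z * \<theta>' (snd z)"

definition "dW q = W (fst (fst q), snd q) - W (snd (fst q), snd q)"

definition "K q = kern s (fst (fst q)) (snd (fst q))"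

definition "U2 q = dW q * \<theta> (snd q) * K q"

lemma meas_time: "f \<in> borel_measurable borel \<Longrightarrow> (\<lambda>q::'b::topological_space \<times> real. f (snd q)) \<in> borel_measurable borel"
  by (rule borel_comp_continuous[of f]) (auto intro!: continuous_intros)

lemma K_meas [measurable]: "K \<in> borel_measurable borel"
  unfolding K_def by (rule borel_comp_continuous[OF kern_measurable]) (intro continuous_intros)

lemma dW_meas [measurable]: "dW \<in> borel_measurable borel"
proof -
  have "(\<lambda>q::('a\<times>'a)\<times>real. W (fst (fst q), snd q)) \<in> borel_measurable borel"
    "(\<lambda>q::('a\<times>'a)\<times>real. W (snd (fst q), snd q)) \<in> borel_measurable borel"
    by (rule borel_comp_continuous[OF W_meas], intro continuous_intros)+
  then show ?thesis unfolding dW_def by measurable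
qed

lemma U2_meas [measurable]: "U2 \<in> borel_measurable borel"
  using meas_time[OF \<theta>_meas] unfolding U2_def by measurable

lemma U1_meas [measurable]: "U1 \<in> borel_measurable borel"
  using meas_time[OF \<theta>'_meas] unfolding U1_def by measurable

lemma K_nonneg: "K q \<ge> 0" by (simp add: K_def kern_nonneg)

lemma U1_int: "integrable lborel U1"
proof -
  obtain B where B: "\<And>r. \<bar>\<theta>' r\<bar> \<le> B" using \<theta>_bounded by auto
  show ?thesis
  proof (rule Bochner_Integration.integrable_bound)
    show "integrable lborel (\<lambda>z. B * (indicator {a..b} (snd z) * w z))" using w_int by simp
    show "AE z in lborel. norm (U1 z) \<le> norm (B * (indicator {a..b} (snd z) * w z))"
    proof (rule AE_I2)
      fix z show "norm (U1 z) \<le> norm (B * (indicator {a..b} (snd z) * w z))"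
        using \<theta>_supp(2)[of "snd z"] mult_right_mono[OF order_trans[OF B[of "snd z"] abs_ge_self], of "\<bar>w z\<bar>"]
        by (cases "snd z \<in> {a..b}") (auto simp: U1_def abs_mult mult.commute)
    qed
  qed simp
qed

text \<open>The product of the two increments is bounded by the sum of their squares. One square is
  the unshifted energy of \<open>W\<close>, the other the shifted energy of \<open>G\<close>; both
  are integrable after multiplication with \<open>f\<close>.\<close>

lemma energy_int:
  assumes "finite_energy s G" "integrable lborel f" "G \<in> borel_measurable borel"
  shows "integrable lborel (\<lambda>p. f (fst p) * (U2 (snd p) * (G (fst (fst (snd p)) - fst p) - G (snd (fst (snd p)) - fst p))))"
proof -
  note [measurable] = assms(3)
  have fm[measurable]: "f \<in> borel_measurable borel" using assms(2) by auto
  obtain T where T: "\<And>r. \<bar>\<theta> r\<bar> \<le> T" using \<theta>_bounded by auto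
  let ?W = "\<lambda>q. indicator {a..b} (snd q) * ((dW q)\<^sup>2 * K q)"
  let ?G = "\<lambda>x q. indicator {a..b} (snd q) * ((G (fst (fst q) - x) - G (snd (fst q) - x))\<^sup>2 * K q)"
  have i1: "integrable lborel (\<lambda>p. f (fst p) * ?W (snd p))"
    using integrable_lborel_times(1)[OF assms(2) W_int] by (simp add: dW_def K_def)
  have i2: "integrable lborel (\<lambda>p. f (fst p) * ?G (fst p) (snd p))"
    using integrable_times_shifted_energy[OF assms(2,3,1)] by (simp add: K_def)
  have le: "norm (f x * (U2 q * (G (fst (fst q) - x) - G (snd (fst q) - x))))
      \<le> norm (T * (\<bar>f x * ?W q\<bar> + \<bar>f x * ?G x q\<bar>))" for x q
  proof (cases "snd q \<in> {a..b}")
    case True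
    define g where "g = G (fst (fst q) - x) - G (snd (fst q) - x)"
    have "norm (f x * (U2 q * g)) = \<bar>f x\<bar> * (\<bar>dW q * g\<bar> * \<bar>\<theta> (snd q)\<bar> * K q)"
      by (simp add: U2_def abs_mult K_nonneg)
    also have "\<dots> \<le> \<bar>f x\<bar> * (((dW q)\<^sup>2 + g\<^sup>2) * T * K q)"
      by (intro mult_left_mono mult_right_mono mult_mono K_nonneg sq_diff_bound T) auto
    also have "\<dots> = T * (\<bar>f x * ?W q\<bar> + \<bar>f x * ?G x q\<bar>)"
      using True by (simp add: abs_mult K_nonneg g_def algebra_simps)
    also have "\<dots> \<le> norm (T * (\<bar>f x * ?W q\<bar> + \<bar>f x * ?G x q\<bar>))" by simp
    finally show ?thesis unfolding g_def .
  next
    case False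
    then show ?thesis using \<theta>_supp(1) by (simp add: U2_def)
  qed
  show ?thesis
  proof (rule Bochner_Integration.integrable_bound)
    show "integrable lborel (\<lambda>p. T * (\<bar>f (fst p) * ?W (snd p)\<bar> + \<bar>f (fst p) * ?G (fst p) (snd p)\<bar>))"
      using i1 i2 by (intro integrable_mult_right Bochner_Integration.integrable_add integrable_abs)
    have "(\<lambda>p. f (fst p)) \<in> borel_measurable (borel :: ('a \<times> (('a \<times> 'a) \<times> real)) measure)"
      by (rule borel_comp_continuous[of f]) (simp, intro continuous_intros)
    moreover have "(\<lambda>p. G (fst (fst (snd p)) - fst p)) \<in> borel_measurable (borel :: ('a \<times> (('a \<times> 'a) \<times> real)) measure)"
      by (rule borel_comp_continuous[of G]) (simp, intro continuous_intros)
    moreover have "(\<lambda>p. G (snd (fst (snd p)) - fst p)) \<in> borel_measurable (borel :: ('a \<times> (('a \<times> 'a) \<times> real)) measure)"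
      by (rule borel_comp_continuous[of G]) (simp, intro continuous_intros)
    moreover have "(\<lambda>p. U2 (snd p)) \<in> borel_measurable (borel :: ('a \<times> (('a \<times> 'a) \<times> real)) measure)"
      by (intro borel_comp_continuous[OF U2_meas] continuous_intros)
    ultimately show "(\<lambda>p. f (fst p) * (U2 (snd p) * (G (fst (fst (snd p)) - fst p) - G (snd (fst (snd p)) - fst p)))) \<in> borel_measurable lborel"
      unfolding measurable_lborel1 by measurable
    show "AE p in lborel. norm (f (fst p) * (U2 (snd p) * (G (fst (fst (snd p)) - fst p) - G (snd (fst (snd p)) - fst p))))
       \<le> norm (T * (\<bar>f (fst p) * ?W (snd p)\<bar> + \<bar>f (fst p) * ?G (fst p) (snd p)\<bar>))"
      using le by (intro AE_I2)
  qed
qed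

text \<open>
  Instead of approximating \<open>P\<close> by test functions, the equation tested with the bump translated by \<open>x\<close> is
  integrated against \<open>P(x) dx\<close>. After the swap this says that a function of the translation, continuous at
  the origin, has vanishing integral against every bump.
\<close>

lemma weak_form_finite_energy:
  assumes P: "P \<in> borel_measurable borel" "integrable lborel P" "\<And>x. \<bar>P x\<bar> \<le> C" "finite_energy s P"
  shows "(LINT z|lborel. U1 z * P (fst z)) = c * (LINT q|lborel. U2 q * (P (fst (fst q)) - P (snd (fst q))))"
proof -
  note [measurable] = P(1)
  \<comment> \<open>\<open>H1\<close> and \<open>H2\<close> are the two sides of the claim for
    \<open>P\<close> translated by \<open>z\<close>; the claim is their balance at
    \<open>z = 0\<close>.\<close>
  define H1 where "H1 z = (LINT q|lborel. U1 q * P (fst q - z))" for z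
  define H2 where "H2 z = (LINT q|lborel. U2 q * (P (fst (fst q) - z) - P (snd (fst q) - z)))" for z
  define H where "H z = H1 z - c * H2 z" for z
  have U1int: "integrable lborel (\<lambda>p. f (fst p) * (U1 (snd p) * g (fst (snd p) - fst p)))"
    if fg: "integrable lborel f" "g \<in> borel_measurable borel" "\<And>x. \<bar>g x\<bar> \<le> B" for f g :: "'a \<Rightarrow> real" and B
  proof (rule Bochner_Integration.integrable_bound)
    show "integrable lborel (\<lambda>p. B * (f (fst p) * U1 (snd p)))"
      using integrable_lborel_times(1)[OF fg(1) U1_int] by simp
    have fm: "f \<in> borel_measurable borel" using fg(1) by auto
    have "(\<lambda>p. f (fst p)) \<in> borel_measurable (borel :: ('a \<times> ('a \<times> real)) measure)"
      by (intro borel_comp_continuous[OF fm] continuous_intros)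
    moreover have "(\<lambda>p. g (fst (snd p) - fst p)) \<in> borel_measurable (borel :: ('a \<times> ('a \<times> real)) measure)"
      by (intro borel_comp_continuous[OF fg(2)] continuous_intros)
    moreover have "(\<lambda>p. U1 (snd p)) \<in> borel_measurable (borel :: ('a \<times> ('a \<times> real)) measure)"
      by (intro borel_comp_continuous[OF U1_meas] continuous_intros)
    ultimately show "(\<lambda>p. f (fst p) * (U1 (snd p) * g (fst (snd p) - fst p))) \<in> borel_measurable lborel"
      unfolding measurable_lborel1 by measurable
    have "\<bar>f x\<bar> * (\<bar>u\<bar> * \<bar>g y\<bar>) \<le> \<bar>B\<bar> * (\<bar>f x\<bar> * \<bar>u\<bar>)" for x y u
      using mult_left_mono[OF order_trans[OF fg(3)[of y] abs_ge_self], of "\<bar>f x\<bar> * \<bar>u\<bar>"]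
      by (simp add: mult_ac)
    then show "AE p in lborel. norm (f (fst p) * (U1 (snd p) * g (fst (snd p) - fst p))) \<le> norm (B * (f (fst p) * U1 (snd p)))"
      by (intro AE_I2) (simp add: abs_mult)
  qed
  have bb: "\<bar>bump k x\<bar> \<le> 1" for k and x :: 'a using bump_bounds(1,2)[of k x] by simp
  \<comment> \<open>The time density is integrable by itself, so the second term of the swap is
    switched off by \<kappa> = 0. In \<open>swap2\<close> it is kept with \<kappa> = 1.\<close>
  have swap1: "(LINT x|lborel. P x * (LINT q|lborel. U1 q * bump k (fst q - x))) = (LINT z|lborel. bump k z * H1 z)"
    "integrable lborel (\<lambda>z. bump k z * H1 z)" if k: "k > 0" for k
    using convolution_swap[of P "bump k" 1 U1 fst 0 fst, OF P(1) bump_measurable P(2) bb]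
      U1int[OF P(2) bump_measurable bb] U1int[OF bump_integrable[OF k] P(1,3)]
    by (simp_all add: H1_def)
  have swap2: "(LINT x|lborel. P x * (LINT q|lborel. U2 q * (bump k (fst (fst q) - x) - bump k (snd (fst q) - x)))) = (LINT z|lborel. bump k z * H2 z)"
    "integrable lborel (\<lambda>z. bump k z * H2 z)" if k: "k > 0" for k
    using convolution_swap[of P "bump k" 1 U2 "\<lambda>q. fst (fst q)" 1 "\<lambda>q. snd (fst q)", OF P(1) bump_measurable P(2) bb]
      energy_int[OF bump_finite_energy[OF s k] P(2) bump_measurable]
      energy_int[OF P(4) bump_integrable[OF k] P(1)]
    by (simp_all add: H2_def)
  have "H 0 = 0"
  proof (rule bump_integral_zero_imp_zero)
    show "integrable lborel (\<lambda>z. bump k z * H z)" if "k > 0" for k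
      using swap1(2)[OF that] swap2(2)[OF that] by (simp add: H_def right_diff_distrib mult.left_commute)
    show "(LINT z|lborel. bump k z * H z) = 0" if "k > 0" for k
    proof -
      have "(LINT z|lborel. bump k z * H z) = (LINT z|lborel. bump k z * H1 z - c * (bump k z * H2 z))"
        by (simp add: H_def right_diff_distrib mult.left_commute)
      also have "\<dots> = (LINT z|lborel. bump k z * H1 z) - c * (LINT z|lborel. bump k z * H2 z)"
        using swap1(2)[OF that] swap2(2)[OF that] by simp
      also have "(LINT z|lborel. bump k z * H1 z) = (LINT x|lborel. P x * (c * (LINT q|lborel. U2 q * (bump k (fst (fst q) - x) - bump k (snd (fst q) - x)))))"
        unfolding swap1(1)[OF that, symmetric]
        using weak[OF that] by (simp add: U1_def U2_def dW_def K_def mult_ac)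
      also have "\<dots> = c * (LINT z|lborel. bump k z * H2 z)"
        unfolding swap2(1)[OF that, symmetric] by (simp add: mult.left_commute)
      finally show ?thesis by simp
    qed
    \<comment> \<open>\<open>P\<close> is merely bounded and measurable. A change of variables moves
      the translation onto the integrable density \<open>U1\<close>, where continuity of
      translations in L1 applies.\<close>
    have lim1: "(H1 \<longlongrightarrow> H1 0) (at 0)"
    proof -
      have lim: "((\<lambda>z. C * (LINT q|lborel. \<bar>U1 (q + (z, 0)) - U1 q\<bar>)) \<longlongrightarrow> C * 0) (at 0)"
      proof (rule tendsto_mult_left)
        have "filterlim (\<lambda>z::'a. (z, 0::real)) (at 0) (at 0)"
          unfolding filterlim_at by (auto intro!: tendsto_eq_intros simp: eventually_at_filter zero_prod_def)
        from filterlim_compose[OF translation_L1[OF U1_int] this]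
        show "((\<lambda>z. LINT q|lborel. \<bar>U1 (q + (z, 0)) - U1 q\<bar>) \<longlongrightarrow> 0) (at 0)" .
      qed
      have le: "norm (H1 z - H1 0) \<le> C * (LINT q|lborel. \<bar>U1 (q + (z, 0)) - U1 q\<bar>)" for z
      proof -
        have "(\<lambda>q::'a\<times>real. P (fst q - y)) \<in> borel_measurable borel" for y
          by (intro borel_comp_continuous[OF P(1)] continuous_intros)
        note [measurable] = this
        have Pm[measurable]: "(\<lambda>q::'a\<times>real. P (fst q)) \<in> borel_measurable borel"
          by (intro borel_comp_continuous[OF P(1)] continuous_intros)
        have iz: "integrable lborel (\<lambda>q. U1 (q + (z, 0)))" by (rule integrable_lborel_shift[OF U1_int])
        have im: "integrable lborel (\<lambda>q. V q * P (fst q))" if V: "integrable lborel V" for V :: "'a \<times> real \<Rightarrow> real"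
        proof (rule Bochner_Integration.integrable_bound)
          show "integrable lborel (\<lambda>q. C * V q)" using V by simp
          show "AE q in lborel. norm (V q * P (fst q)) \<le> norm (C * V q)"
          proof (rule AE_I2)
            fix q show "norm (V q * P (fst q)) \<le> norm (C * V q)"
              using mult_left_mono[OF order_trans[OF P(3)[of "fst q"] abs_ge_self], of "\<bar>V q\<bar>"]
              by (simp add: abs_mult mult.commute)
          qed
        qed (use V in measurable)
        have "H1 z = (LINT q|lborel. U1 (q + (z, 0)) * P (fst (q + (z, 0)) - z))"
          unfolding H1_def by (rule integral_lborel_shift[symmetric]) measurable
        also have "\<dots> = (LINT q|lborel. U1 (q + (z, 0)) * P (fst q))" by simp
        finally have "H1 z - H1 0 = (LINT q|lborel. (U1 (q + (z, 0)) - U1 q) * P (fst q))"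
          using im[OF iz] im[OF U1_int] by (simp add: H1_def left_diff_distrib)
        also have "norm \<dots> \<le> (LINT q|lborel. norm ((U1 (q + (z, 0)) - U1 q) * P (fst q)))"
          by (rule integral_norm_bound)
        also have "\<dots> \<le> (LINT q|lborel. C * \<bar>U1 (q + (z, 0)) - U1 q\<bar>)"
        proof (rule integral_mono)
          show "integrable lborel (\<lambda>q. norm ((U1 (q + (z, 0)) - U1 q) * P (fst q)))"
            by (intro integrable_norm im Bochner_Integration.integrable_diff iz U1_int)
          show "integrable lborel (\<lambda>q. C * \<bar>U1 (q + (z, 0)) - U1 q\<bar>)"
            by (intro integrable_mult_right integrable_abs Bochner_Integration.integrable_diff iz U1_int)
          show "norm ((U1 (q + (z, 0)) - U1 q) * P (fst q)) \<le> C * \<bar>U1 (q + (z, 0)) - U1 q\<bar>" for q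
            using mult_left_mono[OF P(3)[of "fst q"], of "\<bar>U1 (q + (z, 0)) - U1 q\<bar>"]
            by (simp add: abs_mult mult.commute)
        qed
        finally show ?thesis by simp
      qed
      have "((\<lambda>z. H1 z - H1 0) \<longlongrightarrow> 0) (at 0)"
        by (rule Lim_null_comparison[OF always_eventually[OF allI[OF le]]]) (use lim in simp)
      then show ?thesis by (simp add: LIM_zero_iff)
    qed
    \<comment> \<open>Shifting both space points by the same vector leaves the kernel unchanged, so
      the translation acts on \<open>p\<close>, the difference of \<open>P\<close> weighted with the
      root of the kernel, which is square integrable. The remaining factor \<open>g\<close> is
      square integrable as well, and Cauchy-Schwarz reduces the claim to continuity of translations
      in L2.\<close>
    have lim2: "(H2 \<longlongrightarrow> H2 0) (at 0)"
    proof -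
      define p where "p Z = (P (fst Z) - P (snd Z)) * sqrt (kern s (fst Z) (snd Z))" for Z
      have "(\<lambda>Z::'a\<times>'a. P (fst Z)) \<in> borel_measurable borel" "(\<lambda>Z::'a\<times>'a. P (snd Z)) \<in> borel_measurable borel"
        by (intro borel_comp_continuous[OF P(1)] continuous_intros)+
      then have pm[measurable]: "p \<in> borel_measurable borel"
        unfolding p_def by measurable
      have p2: "(p Z)\<^sup>2 = energy_density s P Z" for Z
        by (simp add: p_def energy_density_def power_mult_distrib kern_nonneg)
      have ip: "integrable lborel (\<lambda>Z. (p Z)\<^sup>2)" using P(4) by (simp add: p2 finite_energy_def)
      have ps: "p (Z + (- z, - z)) = (P (fst Z - z) - P (snd Z - z)) * sqrt (kern s (fst Z) (snd Z))" for Z z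
        using kern_shift[of s "fst Z" "-z" "snd Z"] by (simp add: p_def)
      define g where "g q = \<theta> (snd q) * dW q * sqrt (K q)" for q
      have [measurable]: "g \<in> borel_measurable borel"
        using meas_time[OF \<theta>_meas] unfolding g_def by measurable
      obtain T where T: "\<And>r. \<bar>\<theta> r\<bar> \<le> T" using \<theta>_bounded by auto
      have ig: "integrable lborel (\<lambda>q. (g q)\<^sup>2)"
      proof (rule Bochner_Integration.integrable_bound)
        show "integrable lborel (\<lambda>q. T\<^sup>2 * (indicator {a..b} (snd q) * ((dW q)\<^sup>2 * K q)))"
          using W_int by (simp add: dW_def K_def)
        show "AE q in lborel. norm ((g q)\<^sup>2) \<le> norm (T\<^sup>2 * (indicator {a..b} (snd q) * ((dW q)\<^sup>2 * K q)))"
        proof (rule AE_I2)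
          fix q :: "('a \<times> 'a) \<times> real"
          have "(\<theta> (snd q))\<^sup>2 \<le> T\<^sup>2 * indicator {a..b} (snd q)"
            using \<theta>_supp(1)[of "snd q"] power_mono[OF T[of "snd q"], of 2]
            by (auto simp: indicator_def)
          from mult_right_mono[OF this, of "(dW q)\<^sup>2 * K q"]
          show "norm ((g q)\<^sup>2) \<le> norm (T\<^sup>2 * (indicator {a..b} (snd q) * ((dW q)\<^sup>2 * K q)))"
            by (simp add: g_def power_mult_distrib K_nonneg mult_ac abs_mult)
        qed
      qed simp
      let ?e = "\<lambda>z. LINT Z|lborel. (p (Z + (- z, - z)) - p Z)\<^sup>2"
      let ?I = "LINT t|lborel. indicator {a..b} t :: real"
      have ie: "integrable lborel (\<lambda>Z. (p (Z + (- z, - z)) - p Z)\<^sup>2)" for z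
        by (rule translation_L2(1)[OF pm ip])
      have lime: "(?e \<longlongrightarrow> 0) (at 0)"
      proof -
        have "filterlim (\<lambda>z::'a. (- z, - z)) (at 0) (at 0)"
          unfolding filterlim_at by (auto intro!: tendsto_eq_intros simp: eventually_at_filter zero_prod_def)
        from filterlim_compose[OF translation_L2(2)[OF pm ip] this] show ?thesis .
      qed
      have le: "norm (H2 z - H2 0) \<le> sqrt (LINT q|lborel. (g q)\<^sup>2) * sqrt (?e z * ?I)" for z
      proof -
        define e where "e q = (p (fst q + (- z, - z)) - p (fst q)) * indicator {a..b} (snd q)" for q :: "('a\<times>'a)\<times>real"
        have e2: "(e q)\<^sup>2 = (p (fst q + (- z, - z)) - p (fst q))\<^sup>2 * indicator {a..b} (snd q)" for q
          by (simp add: e_def power_mult_distrib indicator_def)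
        have "(\<lambda>q::('a\<times>'a)\<times>real. p (fst q + (- z, - z))) \<in> borel_measurable borel" "(\<lambda>q::('a\<times>'a)\<times>real. p (fst q)) \<in> borel_measurable borel"
          by (intro borel_comp_continuous[OF pm] continuous_intros)+
        note [measurable] = this meas_time[OF borel_measurable_indicator[of "{a..b}" borel]]
        have em[measurable]: "e \<in> borel_measurable borel" unfolding e_def by measurable
        note iI = integrable_lborel_times[OF ie[of z] integrable_indicator_Icc[of a b]]
        have ge: "g q * (p (fst q + (- z, - z)) * indicator {a..b} (snd q)) = U2 q * (P (fst (fst q) - z) - P (snd (fst q) - z))" for q z
        proof (cases "snd q \<in> {a..b}")
          case True
          have "g q * p (fst q + (- z, - z)) = (\<theta> (snd q) * dW q * (P (fst (fst q) - z) - P (snd (fst q) - z))) * (sqrt (K q) * sqrt (K q))"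
            unfolding g_def ps K_def by (simp only: mult_ac)
          also have "sqrt (K q) * sqrt (K q) = K q" using K_nonneg[of q] by simp
          finally show ?thesis using True by (simp add: U2_def mult_ac)
        next
          case False
          then show ?thesis using \<theta>_supp(1) by (simp add: g_def U2_def)
        qed
        have iH: "integrable lborel (\<lambda>q. U2 q * (P (fst (fst q) - z) - P (snd (fst q) - z)))" for z
          unfolding ge[symmetric]
        proof (rule L2_Cauchy_Schwarz(1))
          have [measurable]: "(\<lambda>q::('a\<times>'a)\<times>real. p (fst q + (- z, - z))) \<in> borel_measurable borel"
            by (intro borel_comp_continuous[OF pm] continuous_intros)
          show "(\<lambda>q. p (fst q + (- z, - z)) * indicator {a..b} (snd q)) \<in> borel_measurable lborel"
            unfolding measurable_lborel1 by measurable
          have eq: "(p (fst q + (- z, - z)) * indicator {a..b} (snd q))\<^sup>2 = (p (fst q + (- z, - z)))\<^sup>2 * indicator {a..b} (snd q)" for q :: "('a\<times>'a)\<times>real"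
            by (simp add: power_mult_distrib indicator_def)
          show "integrable lborel (\<lambda>q. (p (fst q + (- z, - z)) * indicator {a..b} (snd q))\<^sup>2)"
            unfolding eq by (rule integrable_lborel_times[OF integrable_lborel_shift[OF ip] integrable_indicator_Icc])
        qed (use ig in auto)
        have ge': "g q * e q = U2 q * (P (fst (fst q) - z) - P (snd (fst q) - z)) - U2 q * (P (fst (fst q) - 0) - P (snd (fst q) - 0))" for q
          unfolding ge[symmetric] e_def by (simp add: algebra_simps flip: zero_prod_def)
        have "H2 z - H2 0 = (LINT q|lborel. g q * e q)"
          unfolding H2_def ge' using iH[of z] iH[of 0] by simp
        also have "norm \<dots> \<le> sqrt (LINT q|lborel. (g q)\<^sup>2) * sqrt (LINT q|lborel. (e q)\<^sup>2)"
          unfolding real_norm_def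
          by (rule L2_Cauchy_Schwarz) (use ig iI in \<open>auto simp: e2\<close>)
        also have "(LINT q|lborel. (e q)\<^sup>2) = ?e z * ?I"
          using iI(2) by (simp add: e2)
        finally show ?thesis .
      qed
      have "((\<lambda>z. sqrt (LINT q|lborel. (g q)\<^sup>2) * sqrt (?e z * ?I)) \<longlongrightarrow> sqrt (LINT q|lborel. (g q)\<^sup>2) * sqrt (0 * ?I)) (at 0)"
        by (intro tendsto_mult_left tendsto_real_sqrt tendsto_mult_right lime)
      then have "((\<lambda>z. H2 z - H2 0) \<longlongrightarrow> 0) (at 0)"
        by (intro Lim_null_comparison[OF always_eventually[OF allI[OF le]]]) simp
      then show ?thesis by (simp add: LIM_zero_iff)
    qed
    show "(H \<longlongrightarrow> H 0) (at 0)"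
      unfolding H_def by (intro tendsto_intros lim1 lim2)
  qed
  then show ?thesis by (simp add: H_def H1_def H2_def)
qed

end

subsection \<open>Weak solutions tested in space only\<close>

text \<open>Solutions are measurable for the completed measure, whereas Fubini arguments run on the
  Borel product. This lemma carries integrals over to Borel representatives.\<close>

lemma lebesgue_AE_eq_borel:
  fixes f g :: "'a::euclidean_space \<Rightarrow> real"
  assumes g: "g \<in> borel_measurable borel" and eq: "AE z in lborel. f z = g z"
  shows "f \<in> borel_measurable lebesgue" "integral\<^sup>L lebesgue f = integral\<^sup>L lborel g"
    "integrable lebesgue f \<longleftrightarrow> integrable lborel g"
proof -
  have gl: "g \<in> borel_measurable lebesgue" using g by (intro measurable_completion) simp
  have "AE z in lebesgue. g z = f z" using AE_completion[OF eq] by eventually_elim simp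
  from borel_measurable_AE[OF gl this] show fl: "f \<in> borel_measurable lebesgue" .
  have "integral\<^sup>L lebesgue f = integral\<^sup>L lebesgue g"
    by (rule integral_cong_AE[OF fl gl AE_completion[OF eq]])
  then show "integral\<^sup>L lebesgue f = integral\<^sup>L lborel g" using g by (simp add: integral_completion)
  have "integrable lebesgue f \<longleftrightarrow> integrable lebesgue g"
    by (rule integrable_cong_AE[OF fl gl AE_completion[OF eq]])
  then show "integrable lebesgue f \<longleftrightarrow> integrable lborel g" using g by (simp add: integrable_completion)
qed

lemma AE_lborel_fst:
  assumes "AE x in (lborel :: 'a::euclidean_space measure). R x"
  shows "AE z in (lborel :: ('a \<times> 'b::euclidean_space) measure). R (fst z)"
proof -
  obtain N where N: "N \<in> null_sets (lborel :: 'a measure)" "{x. \<not> R x} \<subseteq> N"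
    using assms by (auto simp: eventually_ae_filter)
  have "N \<times> UNIV \<in> null_sets (lborel \<Otimes>\<^sub>M lborel :: ('a \<times> 'b) measure)"
    using N(1) by (auto simp: null_sets_def lborel.emeasure_pair_measure_Times)
  then show ?thesis using N(2) unfolding lborel_prod by (elim AE_I') auto
qed

lemma AE_lborel_snd:
  assumes "AE x in (lborel :: 'b::euclidean_space measure). R x"
  shows "AE z in (lborel :: ('a::euclidean_space \<times> 'b) measure). R (snd z)"
proof -
  obtain N where N: "N \<in> null_sets (lborel :: 'b measure)" "{x. \<not> R x} \<subseteq> N"
    using assms by (auto simp: eventually_ae_filter)
  have "UNIV \<times> N \<in> null_sets (lborel \<Otimes>\<^sub>M lborel :: ('a \<times> 'b) measure)"
    using N(1) by (auto simp: null_sets_def lborel.emeasure_pair_measure_Times)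
  then show ?thesis using N(2) unfolding lborel_prod by (elim AE_I') auto
qed

lemma AE_lborel_null_cover:
  assumes "AE x in (lborel :: 'a::euclidean_space measure). R x"
  obtains N where "N \<in> sets borel" "AE x in lborel. x \<notin> N" "\<And>x. x \<notin> N \<Longrightarrow> R x"
proof -
  obtain N where "N \<in> null_sets (lborel :: 'a measure)" "{x. \<not> R x} \<subseteq> N"
    using assms by (auto simp: eventually_ae_filter)
  then show ?thesis using that[of N] AE_not_in by fastforce
qed

text \<open>The exceptional set is first enlarged to a Borel null set, since sections of
  \<open>R\<close> itself need not be measurable.\<close>

lemma AE_lborel_sections:
  fixes R :: "'a::euclidean_space \<times> 'b::euclidean_space \<Rightarrow> bool"
  assumes "AE z in lborel. R z"
  shows "AE x in lborel. AE y in lborel. R (x, y)" "AE y in lborel. AE x in lborel. R (x, y)"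
proof -
  obtain N where N: "N \<in> sets borel" "AE z in lborel. z \<notin> N" "\<And>z. z \<notin> N \<Longrightarrow> R z"
    using AE_lborel_null_cover[OF assms] by blast
  have N': "N \<in> sets (lborel \<Otimes>\<^sub>M lborel)" using N(1) unfolding lborel_prod sets_lborel .
  have S: "{z \<in> space (lborel \<Otimes>\<^sub>M lborel). (fst z, snd z) \<notin> N} \<in> sets (lborel \<Otimes>\<^sub>M lborel)"
  proof -
    have "{z \<in> space (lborel \<Otimes>\<^sub>M lborel). (fst z, snd z) \<notin> N} = space (lborel \<Otimes>\<^sub>M lborel) - N" by auto
    then show ?thesis using N' by (metis sets.compl_sets)
  qed
  have a: "AE x in lborel. AE y in lborel. (x, y) \<notin> N"
    by (rule lborel_pair.AE_pair[OF N(2)[folded lborel_prod]])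
  then show "AE x in lborel. AE y in lborel. R (x, y)"
  proof eventually_elim
    case (elim _)
    then show ?case by eventually_elim (rule N(3))
  qed
  have "AE y in lborel. AE x in lborel. (x, y) \<notin> N"
    using a lborel_pair.AE_commute[OF S] by blast
  then show "AE y in lborel. AE x in lborel. R (x, y)"
  proof eventually_elim
    case (elim _)
    then show ?case by eventually_elim (rule N(3))
  qed
qed

lemma AE_lborel_sectionsI:
  fixes N :: "('a::euclidean_space \<times> 'b::euclidean_space) set"
  assumes "N \<in> sets borel" "AE y in lborel. AE x in lborel. (x, y) \<notin> N"
  shows "AE z in lborel. z \<notin> N"
proof -
  have N': "N \<in> sets (lborel \<Otimes>\<^sub>M lborel)" using assms(1) unfolding lborel_prod sets_lborel .
  have S: "{z \<in> space (lborel \<Otimes>\<^sub>M lborel). (fst z, snd z) \<notin> N} \<in> sets (lborel \<Otimes>\<^sub>M lborel)"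
  proof -
    have "{z \<in> space (lborel \<Otimes>\<^sub>M lborel). (fst z, snd z) \<notin> N} = space (lborel \<Otimes>\<^sub>M lborel) - N" by auto
    then show ?thesis using N' by (metis sets.compl_sets)
  qed
  have "AE x in lborel. AE y in lborel. (x, y) \<notin> N"
    using assms(2) lborel_pair.AE_commute[OF S] by blast
  then have "AE z in lborel \<Otimes>\<^sub>M lborel. z \<notin> N"
    using S by (intro lborel_pair.AE_pair_measure) simp_all
  then show ?thesis unfolding lborel_prod .
qed

text \<open>Allows a solution to be replaced by its representative at both space points of the
  double integral. The exceptional set is treated in each time slice separately.\<close>

lemma AE_lborel_spacetime_lift:
  fixes R :: "'a::euclidean_space \<times> real \<Rightarrow> bool"
  assumes "AE z in lborel. R z"
  shows "AE q in (lborel :: (('a \<times> 'a) \<times> real) measure). R (fst (fst q), snd q)"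
    "AE q in (lborel :: (('a \<times> 'a) \<times> real) measure). R (snd (fst q), snd q)"
proof -
  obtain N where N: "N \<in> sets borel" "AE z in lborel. z \<notin> N" "\<And>z. z \<notin> N \<Longrightarrow> R z"
    using AE_lborel_null_cover[OF assms] by blast
  note sec = AE_lborel_sections(2)[OF N(2)]
  let ?f = "\<lambda>q::('a \<times> 'a) \<times> real. (fst (fst q), snd q)" and ?g = "\<lambda>q::('a \<times> 'a) \<times> real. (snd (fst q), snd q)"
  have "?f \<in> borel_measurable borel" "?g \<in> borel_measurable borel"
    by (intro borel_measurable_continuous_onI continuous_intros)+
  then have m: "?f -` N \<in> sets borel" "?g -` N \<in> sets borel"
    using N(1) by (auto dest: measurable_sets[of _ borel borel N])
  have "AE t in lborel. AE Z in lborel. (Z, t) \<notin> ?f -` N"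
    using sec by eventually_elim (drule AE_lborel_fst[where 'b='a], simp)
  from AE_lborel_sectionsI[OF m(1) this]
  show "AE q in (lborel :: (('a \<times> 'a) \<times> real) measure). R (fst (fst q), snd q)"
    by eventually_elim (use N(3) in auto)
  have "AE t in lborel. AE Z in lborel. (Z, t) \<notin> ?g -` N"
    using sec by eventually_elim (drule AE_lborel_snd[where 'a='a], simp)
  from AE_lborel_sectionsI[OF m(2) this]
  show "AE q in (lborel :: (('a \<times> 'a) \<times> real) measure). R (snd (fst q), snd q)"
    by eventually_elim (use N(3) in auto)
qed

section \<open>Mollification in time\<close>

definition smooth_step :: "real \<Rightarrow> (real \<Rightarrow> real) \<Rightarrow> (real \<Rightarrow> real) \<Rightarrow> bool" where
  "smooth_step d \<eta> H \<longleftrightarrow> smooth_fun \<eta> \<and> smooth_fun H \<and> (\<forall>r. (H has_real_derivative \<eta> r) (at r)) \<and>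
    (\<forall>r. \<eta> r \<ge> 0) \<and> (\<forall>r. r \<notin> {0..d} \<longrightarrow> \<eta> r = 0) \<and> (\<forall>r\<le>0. H r = 0) \<and> (\<forall>r\<ge>d. H r = 1) \<and>
    (\<forall>r. 0 \<le> H r \<and> H r \<le> 1) \<and> integrable lborel \<eta> \<and> (LINT r|lborel. \<eta> r) = 1 \<and> (\<exists>B. \<forall>r. \<bar>\<eta> r\<bar> \<le> B)"

lemma smooth_step_ex:
  assumes "d > 0"
  shows "\<exists>\<eta> H. smooth_step d \<eta> H"
proof -
  obtain \<eta> H :: "real \<Rightarrow> real" where H: "smooth_fun \<eta>" "smooth_fun H"
    "\<And>r. (H has_real_derivative \<eta> r) (at r)" "\<And>r. \<eta> r \<ge> 0" "\<And>r. r \<notin> {0..d} \<Longrightarrow> \<eta> r = 0"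
    "\<And>r. r \<le> 0 \<Longrightarrow> H r = 0" "\<And>r. r \<ge> d \<Longrightarrow> H r = 1" "\<And>r. 0 \<le> H r \<and> H r \<le> 1"
    using smooth_step_exists[OF assms] by metis
  have cont: "isCont \<eta> x" for x
    using smooth_fun_imp_continuous[OF H(1), of UNIV] continuous_on_eq_continuous_at open_UNIV by blast
  have "has_bochner_integral lborel (\<lambda>x. \<eta> x * indicator {0 .. d} x) (H d - H 0)"
    using assms H(3) cont by (intro has_bochner_integral_FTC_Icc_real) auto
  moreover have "(\<lambda>x. \<eta> x * indicator {0 .. d} x) = \<eta>" using H(5) by (force simp: indicator_def)
  ultimately have i: "integrable lborel \<eta>" "(LINT r|lborel. \<eta> r) = 1"
    using H(6)[of 0] H(7)[of d] by (auto simp: has_bochner_integral_iff)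
  have "bounded (\<eta> ` {0..d})"
    by (intro compact_imp_bounded compact_continuous_image smooth_fun_imp_continuous H(1)) auto
  then obtain B where B: "\<And>r. r \<in> {0..d} \<Longrightarrow> \<bar>\<eta> r\<bar> \<le> B" unfolding bounded_iff real_norm_def by blast
  have "\<bar>\<eta> r\<bar> \<le> \<bar>B\<bar>" for r using B[of r] H(5)[of r] by (cases "r \<in> {0..d}") auto
  then show ?thesis using H i unfolding smooth_step_def by blast
qed

text \<open>\<open>\<eta>\<close> is a probability density, so an average of values close to
  \<open>L\<close> is close to \<open>L\<close>. Closeness almost everywhere has to suffice, because
  Borel representatives match the solutions only at almost every time.\<close>

lemma smooth_step_average:
  assumes st: "smooth_step d \<eta> H" and [measurable]: "m \<in> borel_measurable borel"
    and m: "AE r in lborel. r \<in> {t..t + d} \<longrightarrow> \<bar>m r - L\<bar> \<le> e"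
  shows "integrable lborel (\<lambda>r. \<eta> (r - t) * m r)" "\<bar>(LINT r|lborel. \<eta> (r - t) * m r) - L\<bar> \<le> e"
proof -
  have [measurable]: "\<eta> \<in> borel_measurable borel" and i: "integrable lborel \<eta>" and i1: "(LINT r|lborel. \<eta> r) = 1"
    and pos: "\<And>r. \<eta> r \<ge> 0" and out: "\<And>r. r \<notin> {0..d} \<Longrightarrow> \<eta> r = 0"
    using st unfolding smooth_step_def by auto
  have it: "integrable lborel (\<lambda>r. \<eta> (r - t))" using integrable_lborel_shift[OF i, of "-t"] by simp
  have it1: "(LINT r|lborel. \<eta> (r - t)) = 1" using integral_lborel_shift[of \<eta> "-t"] i1 by simp
  have le: "AE r in lborel. norm (\<eta> (r - t) * (m r - L)) \<le> e * \<eta> (r - t)"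
    using m
  proof eventually_elim
    case (elim r)
    then show ?case using out[of "r - t"] pos[of "r - t"]
        mult_left_mono[of "\<bar>m r - L\<bar>" e "\<eta> (r - t)"]
      by (cases "r \<in> {t..t+d}") (auto simp: abs_mult mult.commute[of e])
  qed
  have i2: "integrable lborel (\<lambda>r. \<eta> (r - t) * (m r - L))"
  proof (rule Bochner_Integration.integrable_bound)
    show "integrable lborel (\<lambda>r. e * \<eta> (r - t))" using it by simp
    show "AE r in lborel. norm (\<eta> (r - t) * (m r - L)) \<le> norm (e * \<eta> (r - t))"
      using le by eventually_elim simp
  qed simp
  have "integrable lborel (\<lambda>r. \<eta> (r - t) * (m r - L) + L * \<eta> (r - t))"
    using i2 it by simp
  then show "integrable lborel (\<lambda>r. \<eta> (r - t) * m r)" by (simp add: algebra_simps)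
  have "(LINT r|lborel. \<eta> (r - t) * m r) = (LINT r|lborel. \<eta> (r - t) * (m r - L) + L * \<eta> (r - t))"
    by (simp add: algebra_simps)
  also have "\<dots> = (LINT r|lborel. \<eta> (r - t) * (m r - L)) + L"
    using i2 it by (simp add: it1)
  finally have "(LINT r|lborel. \<eta> (r - t) * m r) - L = (LINT r|lborel. \<eta> (r - t) * (m r - L))" by simp
  also have "\<bar>\<dots>\<bar> \<le> (LINT r|lborel. norm (\<eta> (r - t) * (m r - L)))"
    using integral_norm_bound[of lborel "\<lambda>r. \<eta> (r - t) * (m r - L)"] by simp
  also have "\<dots> \<le> (LINT r|lborel. e * \<eta> (r - t))"
    using le i2 it by (intro integral_mono_AE) auto
  also have "\<dots> = e" by (simp add: it1)
  finally show "\<bar>(LINT r|lborel. \<eta> (r - t) * m r) - L\<bar> \<le> e" .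
qed

text \<open>Serves both equations: \<open>F\<close> will be \<open>phi n\<close> for
  \<open>u\<close> and \<open>phi_eps n \<epsilon>\<close> for \<open>v\<close>. The function
  \<open>w\<close> carries continuity in L1 at every positive time, \<open>w'\<close> carries joint
  Borel measurability, and the two agree only almost everywhere.\<close>

locale borel_weak_solution =
  fixes s :: real and F :: "real \<Rightarrow> real" and w :: "'a::euclidean_space \<Rightarrow> real \<Rightarrow> real" and w' :: "'a \<times> real \<Rightarrow> real"
  assumes s: "0 < s" "s < 1"
    and F_meas [measurable]: "F \<in> borel_measurable borel"
    and w'_meas [measurable]: "w' \<in> borel_measurable borel"
    and w'_eq: "AE z in lborel. snd z > 0 \<longrightarrow> w (fst z) (snd z) = w' z"
    and L1: "L1_cont {0<..} w" and L2: "L2loc_Hs s (\<lambda>x t. F (w x t))" and weak: "weak_eq s F w"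
begin

definition "W z = F (w' z)"

lemma W_meas [measurable]: "W \<in> borel_measurable borel" unfolding W_def by measurable

lemma w_eq_time: "AE t in lborel. t > 0 \<longrightarrow> (AE x in lborel. w x t = w' (x, t))"
  using AE_lborel_sections(2)[OF w'_eq] by eventually_elim auto

lemma W_diff_int:
  assumes "0 < a" "a < b"
  shows "integrable lborel (\<lambda>q. indicator {a..b} (snd q) *
        ((W (fst (fst q), snd q) - W (snd (fst q), snd q))\<^sup>2 * kern s (fst (fst q)) (snd (fst q))))"
proof -
  let ?f = "\<lambda>q. indicat_real ((UNIV \<times> UNIV) \<times> {a..b}) q *\<^sub>R ((F (w (fst (fst q)) (snd q)) - F (w (snd (fst q)) (snd q)))\<^sup>2 * kern s (fst (fst q)) (snd (fst q)))"
  let ?g = "\<lambda>q. indicator {a..b} (snd q) *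
        ((W (fst (fst q), snd q) - W (snd (fst q), snd q))\<^sup>2 * kern s (fst (fst q)) (snd (fst q)))"
  have f: "integrable lebesgue ?f" 
    using conjunct2[OF L2[unfolded L2loc_Hs_def], rule_format, OF assms]
    unfolding set_integrable_def case_prod_unfold .
  have "(\<lambda>q::('a\<times>'a)\<times>real. W (fst (fst q), snd q)) \<in> borel_measurable borel"
    "(\<lambda>q::('a\<times>'a)\<times>real. W (snd (fst q), snd q)) \<in> borel_measurable borel"
    by (rule borel_comp_continuous[OF W_meas], intro continuous_intros)+
  moreover have "(\<lambda>q::('a\<times>'a)\<times>real. kern s (fst (fst q)) (snd (fst q))) \<in> borel_measurable borel"
    by (rule borel_comp_continuous[OF kern_measurable]) (intro continuous_intros)
  moreover have "(\<lambda>q::('a\<times>'a)\<times>real. indicator {a..b} (snd q) :: real) \<in> borel_measurable borel"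
    by (rule borel_comp_continuous[of "indicator {a..b}"]) (simp, intro continuous_intros)
  ultimately have g: "?g \<in> borel_measurable borel" by measurable
  have "AE q in lborel. ?f q = ?g q"
    using AE_lborel_spacetime_lift[OF w'_eq]
  proof eventually_elim
    case (elim q)
    obtain x y t where q: "q = ((x, y), t)" by (metis surj_pair)
    show ?case
    proof (cases "t \<in> {a..b}")
      case True
      then show ?thesis using elim assms by (simp add: q W_def)
    qed (simp add: q)
  qed
  from lebesgue_AE_eq_borel(3)[OF g this] f show ?thesis by simp
qed

lemma w_integrable: "t > 0 \<Longrightarrow> integrable lebesgue (\<lambda>x. w x t)"
  using L1 unfolding L1_cont_def by auto

lemma L1_tendsto:
  assumes "t > 0"
  shows "((\<lambda>t'. LINT x|lebesgue. \<bar>w x t' - w x t\<bar>) \<longlongrightarrow> 0) (at t)"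
proof -
  have "at t within {0<..} = at t" by (rule at_within_open) (use assms in auto)
  then show ?thesis
    using conjunct2[OF L1[unfolded L1_cont_def], rule_format, of t] assms by simp
qed

lemma L1_bound:
  assumes "0 < a"
  shows "\<exists>M. \<forall>t\<in>{a..b}. (LINT x|lebesgue. \<bar>w x t\<bar>) \<le> M"
proof -
  have "continuous_on {a..b} (\<lambda>t. LINT x|lebesgue. \<bar>w x t\<bar>)"
    unfolding continuous_on_def
  proof
    fix t assume t: "t \<in> {a..b}"
    have "((\<lambda>t'. (LINT x|lebesgue. \<bar>w x t'\<bar>) - (LINT x|lebesgue. \<bar>w x t\<bar>)) \<longlongrightarrow> 0) (at t within {a..b})"
    proof (rule Lim_null_comparison)
      show "((\<lambda>t'. LINT x|lebesgue. \<bar>w x t' - w x t\<bar>) \<longlongrightarrow> 0) (at t within {a..b})"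
        using L1_tendsto[of t] t assms by (auto intro: tendsto_within_subset)
      have "norm ((LINT x|lebesgue. \<bar>w x t'\<bar>) - (LINT x|lebesgue. \<bar>w x t\<bar>)) \<le> (LINT x|lebesgue. \<bar>w x t' - w x t\<bar>)"
        if "t' \<in> {a..b}" for t'
      proof -
        note i = w_integrable[of t'] w_integrable[of t]
        have p: "t' > 0" "t > 0" using that t assms by auto
        have "(LINT x|lebesgue. \<bar>w x t'\<bar>) - (LINT x|lebesgue. \<bar>w x t\<bar>) = (LINT x|lebesgue. \<bar>w x t'\<bar> - \<bar>w x t\<bar>)"
          using i p by simp
        also have "norm \<dots> \<le> (LINT x|lebesgue. norm (\<bar>w x t'\<bar> - \<bar>w x t\<bar>))"
          by (rule integral_norm_bound)
        also have "\<dots> \<le> (LINT x|lebesgue. \<bar>w x t' - w x t\<bar>)"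
          using i p by (intro integral_mono) (auto intro!: integrable_abs)
        finally show ?thesis .
      qed
      then show "\<forall>\<^sub>F t' in at t within {a..b}. norm ((LINT x|lebesgue. \<bar>w x t'\<bar>) - (LINT x|lebesgue. \<bar>w x t\<bar>)) \<le> (LINT x|lebesgue. \<bar>w x t' - w x t\<bar>)"
        by (simp add: eventually_at_filter)
    qed
    then show "((\<lambda>t. LINT x|lebesgue. \<bar>w x t\<bar>) \<longlongrightarrow> (LINT x|lebesgue. \<bar>w x t\<bar>)) (at t within {a..b})"
      by (simp add: LIM_zero_iff)
  qed
  then have "bounded ((\<lambda>t. LINT x|lebesgue. \<bar>w x t\<bar>) ` {a..b})"
    by (intro compact_imp_bounded compact_continuous_image) auto
  then show ?thesis unfolding bounded_iff real_norm_def by (metis abs_ge_self image_eqI order_trans)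
qed

lemma section_meas [measurable]: "(\<lambda>x. w' (x, t)) \<in> borel_measurable borel"
  by (rule borel_comp_continuous[OF w'_meas]) (intro continuous_intros)

lemma w_int_spacetime:
  assumes "0 < a"
  shows "integrable lborel (\<lambda>z. indicator {a..b} (snd z) * w' z)"
proof (rule integrableI_bounded)
  have im[measurable]: "(\<lambda>z::'a\<times>real. indicator {a..b} (snd z) :: real) \<in> borel_measurable borel"
    by (rule borel_comp_continuous[of "indicator {a..b}"]) (simp, intro continuous_intros)
  show m: "(\<lambda>z. indicator {a..b} (snd z) * w' z) \<in> borel_measurable lborel"
    unfolding measurable_lborel1 by measurable
  obtain M where M: "\<And>t. t \<in> {a..b} \<Longrightarrow> (LINT x|lebesgue. \<bar>w x t\<bar>) \<le> M" using L1_bound[OF assms] by blast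
  have m2: "(\<lambda>z. ennreal (norm (indicator {a..b} (snd z) * w' z))) \<in> borel_measurable (lborel \<Otimes>\<^sub>M lborel)"
    using m by (simp add: lborel_prod)
  have "(\<integral>\<^sup>+z. ennreal (norm (indicator {a..b} (snd z) * w' z)) \<partial>lborel)
      = (\<integral>\<^sup>+t. \<integral>\<^sup>+x. ennreal (norm (indicator {a..b} t * w' (x, t))) \<partial>lborel \<partial>lborel)"
    using lborel_pair.nn_integral_snd[OF m2] by (simp add: lborel_prod)
  also have "\<dots> \<le> (\<integral>\<^sup>+t. ennreal M * indicator {a..b} t \<partial>lborel)"
  proof (rule nn_integral_mono_AE)
    show "AE t in lborel. (\<integral>\<^sup>+x. ennreal (norm (indicator {a..b} t * w' (x, t))) \<partial>lborel) \<le> ennreal M * indicator {a..b} t"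
      using w_eq_time
    proof eventually_elim
      case (elim t)
      show ?case
      proof (cases "t \<in> {a..b}")
        case True
        then have t: "t > 0" using assms by auto
        have eq: "AE x in lborel. w x t = w' (x, t)" using elim t by simp
        have i: "integrable lborel (\<lambda>x. w' (x, t))"
          using lebesgue_AE_eq_borel(3)[OF section_meas eq] w_integrable[OF t] by simp
        have eq2: "AE x in lborel. \<bar>w x t\<bar> = \<bar>w' (x, t)\<bar>" using eq by eventually_elim simp
        have "(\<integral>\<^sup>+x. ennreal (norm (indicator {a..b} t * w' (x, t))) \<partial>lborel) = (\<integral>\<^sup>+x. ennreal (norm (w' (x, t))) \<partial>lborel)"
          using True by simp
        also have "\<dots> = ennreal (LINT x|lborel. norm (w' (x, t)))"
          by (rule nn_integral_eq_integral) (use i in auto)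
        also have "(LINT x|lborel. norm (w' (x, t))) = (LINT x|lebesgue. \<bar>w x t\<bar>)"
          using lebesgue_AE_eq_borel(2)[OF _ eq2] by simp
        also have "ennreal \<dots> \<le> ennreal M" using M[OF True] by (rule ennreal_leI)
        finally show ?thesis using True by simp
      qed auto
    qed
  qed
  also have "\<dots> = ennreal M * emeasure lborel {a..b}" by (simp add: nn_integral_cmult)
  also have "\<dots> < \<infinity>" by (auto simp: ennreal_mult_less_top emeasure_lborel_Icc_eq)
  finally show "(\<integral>\<^sup>+z. ennreal (norm (indicator {a..b} (snd z) * w' z)) \<partial>lborel) < \<infinity>" .
qed

end

lemma smooth_fun_shift_diff:
  fixes H :: "real \<Rightarrow> real"
  assumes "smooth_fun H"
  shows "smooth_fun (\<lambda>r. H (r - t1) - H (r - t2))"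
proof -
  have "smooth_expr (\<lambda>r. H (r + (- t1)) + (- 1) * H (r + (- t2)))"
    by (intro smooth_expr.add smooth_expr.mult smooth_expr.const smooth_expr.comp[OF assms] smooth_expr.linear bounded_linear_ident)
  then show ?thesis using smooth_expr_imp_smooth_fun by fastforce
qed

context borel_weak_solution
begin

definition "bilinear_density P q = (W (fst (fst q), snd q) - W (snd (fst q), snd q)) *
   (P (fst (fst q)) - P (snd (fst q))) * kern s (fst (fst q)) (snd (fst q))"

lemma W_lift_meas:
  "(\<lambda>q::('a\<times>'a)\<times>real. W (fst (fst q), snd q)) \<in> borel_measurable borel"
  "(\<lambda>q::('a\<times>'a)\<times>real. W (snd (fst q), snd q)) \<in> borel_measurable borel"
  by (rule borel_comp_continuous[OF W_meas], intro continuous_intros)+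

lemma kern_lift_meas: "(\<lambda>q::('a\<times>'a)\<times>real. kern s (fst (fst q)) (snd (fst q))) \<in> borel_measurable borel"
  by (rule borel_comp_continuous[OF kern_measurable]) (intro continuous_intros)

lemma indicator_time_meas:
  assumes "A \<in> sets borel"
  shows "(\<lambda>q::'b::topological_space \<times> real. indicator A (snd q) :: real) \<in> borel_measurable borel"
  by (rule borel_comp_continuous[OF borel_measurable_indicator[OF assms]]) (intro continuous_intros)

lemma bilinear_density_meas:
  assumes "P \<in> borel_measurable borel"
  shows "bilinear_density P \<in> borel_measurable borel"
proof -
  have "(\<lambda>q::('a\<times>'a)\<times>real. P (fst (fst q))) \<in> borel_measurable borel" "(\<lambda>q::('a\<times>'a)\<times>real. P (snd (fst q))) \<in> borel_measurable borel"
    by (rule borel_comp_continuous[OF assms], intro continuous_intros)+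
  note [measurable] = this W_lift_meas kern_lift_meas
  show ?thesis unfolding bilinear_density_def by measurable
qed

lemma bilinear_density_int:
  assumes "P \<in> borel_measurable borel" "finite_energy s P" "0 < a" "a < b"
  shows "integrable lborel (\<lambda>q. indicator {a..b} (snd q) * bilinear_density P q)"
proof (rule Bochner_Integration.integrable_bound)
  note i1 = W_diff_int[OF assms(3,4)]
  note i2 = integrable_lborel_times(1)[OF assms(2)[unfolded finite_energy_def] integrable_indicator_Icc[of a b]]
  show "integrable lborel (\<lambda>q. indicator {a..b} (snd q) *
        ((W (fst (fst q), snd q) - W (snd (fst q), snd q))\<^sup>2 * kern s (fst (fst q)) (snd (fst q)))
       + energy_density s P (fst q) * indicator {a..b} (snd q))"
    using i1 i2 by (rule Bochner_Integration.integrable_add)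
  note [measurable] = bilinear_density_meas[OF assms(1)] indicator_time_meas
  show "(\<lambda>q. indicator {a..b} (snd q) * bilinear_density P q) \<in> borel_measurable lborel"
    unfolding measurable_lborel1 by measurable
  show "AE q in lborel. norm (indicator {a..b} (snd q) * bilinear_density P q) \<le> norm (indicator {a..b} (snd q) *
        ((W (fst (fst q), snd q) - W (snd (fst q), snd q))\<^sup>2 * kern s (fst (fst q)) (snd (fst q)))
       + energy_density s P (fst q) * indicator {a..b} (snd q))"
  proof (rule AE_I2)
    fix q :: "('a\<times>'a)\<times>real"
    define u v k where "u = W (fst (fst q), snd q) - W (snd (fst q), snd q)" "v = P (fst (fst q)) - P (snd (fst q))"
      "k = kern s (fst (fst q)) (snd (fst q))"
    have k: "k \<ge> 0" by (simp add: u_v_k_def kern_nonneg)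
    have "\<bar>u * v * k\<bar> \<le> u\<^sup>2 * k + v\<^sup>2 * k"
      using mult_right_mono[OF sq_diff_bound[of u v] k] k by (simp add: abs_mult algebra_simps)
    then show "norm (indicator {a..b} (snd q) * bilinear_density P q) \<le> norm (indicator {a..b} (snd q) *
        ((W (fst (fst q), snd q) - W (snd (fst q), snd q))\<^sup>2 * kern s (fst (fst q)) (snd (fst q)))
       + energy_density s P (fst q) * indicator {a..b} (snd q))"
      using k unfolding bilinear_density_def energy_density_def u_v_k_def[symmetric]
      by (cases "snd q \<in> {a..b}") simp_all
  qed
qed

lemma weak_with_bump:
  assumes \<theta>: "smooth_fun \<theta>" "\<And>r. (\<theta> has_real_derivative \<theta>' r) (at r)" and a: "0 < a" "\<And>r. r \<notin> {a..b} \<Longrightarrow> \<theta> r = 0"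
    "\<And>r. r \<notin> {a..b} \<Longrightarrow> \<theta>' r = 0" and [measurable]: "\<theta> \<in> borel_measurable borel" "\<theta>' \<in> borel_measurable borel" and k: "k > 0"
  shows "(LINT z|lborel. w' z * (bump k (fst z - x) * \<theta>' (snd z)))
       = (cNs DIM('a) s / 2) * (LINT q|lborel. (W (fst (fst q), snd q) - W (snd (fst q), snd q)) *
          (bump k (fst (fst q) - x) - bump k (snd (fst q) - x)) * \<theta> (snd q) * kern s (fst (fst q)) (snd (fst q)))"
proof -
  define \<zeta> where "\<zeta> = (\<lambda>z::'a\<times>real. bump k (fst z - x) * \<theta> (snd z))"
  have tf: "test_fun \<zeta>" and dtz: "\<And>y r. dt \<zeta> (y, r) = bump k (y - x) * \<theta>' r"
    using test_fun_bump_times[OF \<theta> a(1,2) k, where x=x] by (auto simp: \<zeta>_def)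
  have bm: "(\<lambda>z::'a\<times>real. bump k (fst z - x)) \<in> borel_measurable borel"
    by (rule borel_comp_continuous[OF bump_measurable]) (intro continuous_intros)
  have tm: "(\<lambda>z::'a\<times>real. \<theta>' (snd z)) \<in> borel_measurable borel"
    by (rule borel_comp_continuous[OF assms(7)]) (intro continuous_intros)
  have bm2: "(\<lambda>q::('a\<times>'a)\<times>real. bump k (fst (fst q) - x)) \<in> borel_measurable borel"
    "(\<lambda>q::('a\<times>'a)\<times>real. bump k (snd (fst q) - x)) \<in> borel_measurable borel"
    by (rule borel_comp_continuous[OF bump_measurable], intro continuous_intros)+
  have tm2: "(\<lambda>q::('a\<times>'a)\<times>real. \<theta> (snd q)) \<in> borel_measurable borel"
    by (rule borel_comp_continuous[OF assms(6)]) (intro continuous_intros)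
  have "(LINT z:UNIV \<times> {0<..}|lebesgue. w (fst z) (snd z) * dt \<zeta> z) = (LINT z|lborel. w' z * (bump k (fst z - x) * \<theta>' (snd z)))"
    unfolding set_lebesgue_integral_def
  proof (rule lebesgue_AE_eq_borel(2))
    note [measurable] = bm tm
    show "(\<lambda>z. w' z * (bump k (fst z - x) * \<theta>' (snd z))) \<in> borel_measurable borel" by measurable
    show "AE z in lborel. indicat_real (UNIV \<times> {0<..}) z *\<^sub>R (w (fst z) (snd z) * dt \<zeta> z) = w' z * (bump k (fst z - x) * \<theta>' (snd z))"
      using w'_eq
    proof eventually_elim
      case (elim z)
      show ?case
      proof (cases "snd z > 0")
        case True
        then show ?thesis using elim by (cases z) (simp add: dtz)
      next
        case False
        \<comment> \<open>Nothing relates \<open>w'\<close> to the solution at nonpositive times,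
          but the support of the time factor stays away from them.\<close>
        then have "\<theta>' (snd z) = 0" using a(1) by (intro a(3)) auto
        then show ?thesis using False by (cases z) simp
      qed
    qed
  qed
  moreover have "(LINT q:(UNIV \<times> UNIV) \<times> {0<..}|lebesgue.
              (case q of ((x, y), t) \<Rightarrow> (F (w x t) - F (w y t)) * (\<zeta> (x, t) - \<zeta> (y, t)) * kern s x y))
      = (LINT q|lborel. (W (fst (fst q), snd q) - W (snd (fst q), snd q)) *
          (bump k (fst (fst q) - x) - bump k (snd (fst q) - x)) * \<theta> (snd q) * kern s (fst (fst q)) (snd (fst q)))"
    unfolding set_lebesgue_integral_def
  proof (rule lebesgue_AE_eq_borel(2))
    note [measurable] = bm2 tm2 W_lift_meas kern_lift_meas
    show "(\<lambda>q. (W (fst (fst q), snd q) - W (snd (fst q), snd q)) *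
          (bump k (fst (fst q) - x) - bump k (snd (fst q) - x)) * \<theta> (snd q) * kern s (fst (fst q)) (snd (fst q))) \<in> borel_measurable borel"
      by measurable
    show "AE q in lborel. indicat_real ((UNIV \<times> UNIV) \<times> {0<..}) q *\<^sub>R 
        (case q of ((x, y), t) \<Rightarrow> (F (w x t) - F (w y t)) * (\<zeta> (x, t) - \<zeta> (y, t)) * kern s x y)
       = (W (fst (fst q), snd q) - W (snd (fst q), snd q)) *
          (bump k (fst (fst q) - x) - bump k (snd (fst q) - x)) * \<theta> (snd q) * kern s (fst (fst q)) (snd (fst q))"
      using AE_lborel_spacetime_lift[OF w'_eq]
    proof eventually_elim
      case (elim q)
      obtain y z t where q: "q = ((y, z), t)" by (metis surj_pair)
      show ?case
      proof (cases "t > 0")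
        case True
        then show ?thesis using elim by (simp add: q \<zeta>_def W_def algebra_simps)
      next
        case False
        then have "\<theta> t = 0" using a(1) by (intro a(2)) auto
        then show ?thesis using False by (simp add: q)
      qed
    qed
  qed
  ultimately show ?thesis
    using weak[unfolded weak_eq_def, rule_format, OF tf] by simp
qed

text \<open>The time factor is a difference of two smooth steps, which tends to the indicator of the
  interval. Its derivative is a difference of two mollifiers, which pick out the pairing with
  \<open>P\<close> at the two end points. Continuity in L1 makes the result valid for every pair of
  positive times rather than almost every one.\<close>

lemma time_identity:
  assumes t: "0 < t1" "t1 < t2"
    and P: "P \<in> borel_measurable borel" "integrable lborel P" "\<And>x. \<bar>P x\<bar> \<le> C" "finite_energy s P"
  shows "(LINT x|lebesgue. (w x t2 - w x t1) * P x)
     = - (cNs DIM('a) s / 2) * (LINT q|lborel. indicator {t1<..t2} (snd q) * bilinear_density P q)"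
proof -
  note [measurable] = P(1)
  have Pl[measurable]: "P \<in> borel_measurable lebesgue" using P(1) by (intro measurable_completion) simp
  define d where "d n = 1 / (real n + 1)" for n :: nat
  have d: "d n > 0" "d n \<le> 1" for n by (auto simp: d_def)
  have dlim: "d \<longlonglongrightarrow> 0" unfolding d_def using LIMSEQ_inverse_real_of_nat by (simp add: inverse_eq_divide add.commute)
  obtain \<eta> H where st: "\<And>n. smooth_step (d n) (\<eta> n) (H n)"
    using smooth_step_ex[OF d(1)] by metis
  \<comment> \<open>\<open>m\<close> is continuous because it is built from \<open>w\<close>;
    \<open>m'\<close> is measurable in time because it is built from the Borel representative. The
    averages are formed with \<open>m'\<close> and converge to values of \<open>m\<close>.\<close>
  define m where "m r = (LINT x|lebesgue. w x r * P x)" for r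
  define m' where "m' r = (LINT x|lborel. w' (x, r) * P x)" for r
  have C0: "C \<ge> 0" using P(3)[of 0] by linarith
  have iwP: "integrable lebesgue (\<lambda>x. f x * P x)" if "integrable lebesgue f" for f :: "'a \<Rightarrow> real"
  proof (rule Bochner_Integration.integrable_bound)
    show "integrable lebesgue (\<lambda>x. C * f x)" using that by simp
    show "(\<lambda>x. f x * P x) \<in> borel_measurable lebesgue" using that Pl by (intro borel_measurable_times) auto
    show "AE x in lebesgue. norm (f x * P x) \<le> norm (C * f x)"
    proof (rule AE_I2)
      fix x show "norm (f x * P x) \<le> norm (C * f x)"
        using mult_left_mono[OF P(3)[of x], of "\<bar>f x\<bar>"] C0 by (simp add: abs_mult mult.commute)
    qed
  qed
  have m_lip: "\<bar>m r - m t\<bar> \<le> C * (LINT x|lebesgue. \<bar>w x r - w x t\<bar>)" if "r > 0" "t > 0" for r t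
  proof -
    note i = w_integrable[OF that(1)] w_integrable[OF that(2)]
    have id: "integrable lebesgue (\<lambda>x. w x r - w x t)" using i by simp
    have "m r - m t = (LINT x|lebesgue. (w x r - w x t) * P x)"
      unfolding m_def using iwP[OF i(1)] iwP[OF i(2)] by (simp add: left_diff_distrib)
    also have "\<bar>\<dots>\<bar> \<le> (LINT x|lebesgue. norm ((w x r - w x t) * P x))"
      using integral_norm_bound[of lebesgue "\<lambda>x. (w x r - w x t) * P x"] by simp
    also have "\<dots> \<le> (LINT x|lebesgue. C * \<bar>w x r - w x t\<bar>)"
    proof (rule integral_mono)
      show "norm ((w x r - w x t) * P x) \<le> C * \<bar>w x r - w x t\<bar>" for x
        using mult_left_mono[OF P(3)[of x], of "\<bar>w x r - w x t\<bar>"] by (simp add: abs_mult mult.commute)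
    qed (use iwP[OF id] id in \<open>auto intro!: integrable_abs\<close>)
    finally show ?thesis by simp
  qed
  have m_lim: "(m \<longlongrightarrow> m t) (at t)" if "t > 0" for t
  proof -
    have "((\<lambda>r. m r - m t) \<longlongrightarrow> 0) (at t)"
    proof (rule Lim_null_comparison)
      show "((\<lambda>r. C * (LINT x|lebesgue. \<bar>w x r - w x t\<bar>)) \<longlongrightarrow> 0) (at t)"
        using tendsto_mult_left[OF L1_tendsto[OF that], of C] by simp
      have "\<forall>\<^sub>F r in at t. r > 0"
        using that by (intro order_tendstoD(1)[OF tendsto_ident_at]) 
      then show "\<forall>\<^sub>F r in at t. norm (m r - m t) \<le> C * (LINT x|lebesgue. \<bar>w x r - w x t\<bar>)"
        by eventually_elim (use m_lip that in simp)
    qed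
    then show ?thesis by (simp add: LIM_zero_iff)
  qed
  have w'P: "(\<lambda>z. w' z * P (fst z)) \<in> borel_measurable borel"
  proof -
    have [measurable]: "(\<lambda>z::'a\<times>real. P (fst z)) \<in> borel_measurable borel"
      by (rule borel_comp_continuous[OF P(1)]) (intro continuous_intros)
    show ?thesis by measurable
  qed
  have m'_meas[measurable]: "m' \<in> borel_measurable borel"
  proof -
    have "(\<lambda>(r, x). w' (x, r) * P x) \<in> borel_measurable (lborel \<Otimes>\<^sub>M lborel)"
      unfolding lborel_prod measurable_lborel1 case_prod_unfold
      using borel_comp_continuous[OF w'P, of "\<lambda>z. (snd z, fst z)"] by (simp add: continuous_intros)
    then have "(\<lambda>r. LINT x|lborel. w' (x, r) * P x) \<in> borel_measurable lborel"
      by (rule lborel.borel_measurable_lebesgue_integral)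
    then show ?thesis unfolding m'_def by simp
  qed
  have m'_eq: "AE r in lborel. r > 0 \<longrightarrow> m' r = m r"
    using w_eq_time
  proof eventually_elim
    case (elim r)
    show ?case
    proof
      assume "r > 0"
      with elim have "AE x in lborel. w x r = w' (x, r)" by simp
      then have "AE x in lborel. w x r * P x = w' (x, r) * P x" by eventually_elim simp
      then show "m' r = m r"
        unfolding m_def m'_def by (intro lebesgue_AE_eq_borel(2)[symmetric]) auto
    qed
  qed
  have avg: "(\<forall>\<^sub>F n in sequentially. integrable lborel (\<lambda>r. \<eta> n (r - t) * m' r)) \<and> (\<lambda>n. LINT r|lborel. \<eta> n (r - t) * m' r) \<longlonglongrightarrow> m t" if "t > 0" for t
  proof -
    have ev: "\<forall>\<^sub>F n in sequentially. integrable lborel (\<lambda>r. \<eta> n (r - t) * m' r) \<and> \<bar>(LINT r|lborel. \<eta> n (r - t) * m' r) - m t\<bar> \<le> e"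
      if e: "e > 0" for e
    proof -
      obtain \<delta> where \<delta>: "\<delta> > 0" "\<And>r. r \<noteq> t \<Longrightarrow> dist r t < \<delta> \<Longrightarrow> dist (m r) (m t) < e"
        using tendstoD[OF m_lim[OF \<open>t > 0\<close>] e] by (auto simp: eventually_at)
      have "\<forall>\<^sub>F n in sequentially. d n < \<delta>" using dlim \<delta>(1) by (rule order_tendstoD(2))
      then show ?thesis
      proof eventually_elim
        case (elim n)
        have "AE r in lborel. r \<in> {t..t + d n} \<longrightarrow> \<bar>m' r - m t\<bar> \<le> e"
          using m'_eq
        proof eventually_elim
          fix r assume r: "r > 0 \<longrightarrow> m' r = m r"
          show "r \<in> {t..t + d n} \<longrightarrow> \<bar>m' r - m t\<bar> \<le> e"
            using r \<delta>(2)[of r] elim \<open>t > 0\<close> e by (cases "r = t") (auto simp: dist_real_def)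
        qed
        from smooth_step_average[OF st m'_meas this] show ?case by blast
      qed
    qed
    have "(\<lambda>n. LINT r|lborel. \<eta> n (r - t) * m' r) \<longlonglongrightarrow> m t"
    proof (rule tendstoI)
      fix e :: real assume "e > 0"
      then show "\<forall>\<^sub>F n in sequentially. dist (LINT r|lborel. \<eta> n (r - t) * m' r) (m t) < e"
        using ev[of "e/2"] by (auto elim!: eventually_mono simp: dist_real_def)
    qed
    moreover have "\<forall>\<^sub>F n in sequentially. integrable lborel (\<lambda>r. \<eta> n (r - t) * m' r)"
      using ev[of 1] by (auto elim: eventually_mono)
    ultimately show ?thesis by blast
  qed
  define \<theta> where "\<theta> n r = H n (r - t1) - H n (r - t2)" for n r
  define \<theta>' where "\<theta>' n r = \<eta> n (r - t1) - \<eta> n (r - t2)" for n r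
  \<comment> \<open>All widths \<open>d n\<close> are at most 1, so every time factor is supported
    in this one interval.\<close>
  let ?b = "t2 + 1"
  have \<eta>m[measurable]: "\<eta> n \<in> borel_measurable borel" and Hm: "H n \<in> borel_measurable borel" for n
    using st[of n] smooth_fun_imp_continuous[of "H n" UNIV] unfolding smooth_step_def
    by (auto intro: borel_measurable_continuous_onI)
  have \<theta>m[measurable]: "\<theta> n \<in> borel_measurable borel" "\<theta>' n \<in> borel_measurable borel" for n
  proof -
    note [measurable] = Hm
    show "\<theta> n \<in> borel_measurable borel" unfolding \<theta>_def by measurable
    show "\<theta>' n \<in> borel_measurable borel" unfolding \<theta>'_def by measurable
  qed
  have \<theta>_s: "smooth_fun (\<theta> n)" for n
    unfolding \<theta>_def using st[of n] by (intro smooth_fun_shift_diff) (simp add: smooth_step_def)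
  have \<theta>_d: "(\<theta> n has_real_derivative \<theta>' n r) (at r)" for n r
  proof -
    have Hd: "(H n has_real_derivative \<eta> n r) (at r)" for r using st[of n] by (simp add: smooth_step_def)
    have "((\<lambda>r. H n (r + (- t))) has_real_derivative \<eta> n (r + (- t))) (at r)" for t
      using Hd[of "r + (- t)"] unfolding DERIV_shift .
    from DERIV_diff[OF this[of t1] this[of t2]] show ?thesis unfolding \<theta>_def \<theta>'_def by simp
  qed
  have \<theta>_out: "\<theta> n r = 0" "\<theta>' n r = 0" if "r \<notin> {t1..?b}" for n r
    using that st[of n] t d[of n] unfolding smooth_step_def \<theta>_def \<theta>'_def by auto
  have \<theta>_b: "\<bar>\<theta> n r\<bar> \<le> 1" for n r
  proof -
    have "0 \<le> H n x \<and> H n x \<le> 1" for x using st[of n] by (simp add: smooth_step_def)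
    from this[of "r - t1"] this[of "r - t2"] show ?thesis unfolding \<theta>_def by auto
  qed
  have \<theta>'_b: "\<exists>B. \<forall>r. \<bar>\<theta>' n r\<bar> \<le> B" for n
  proof -
    obtain B where B: "\<And>r. \<bar>\<eta> n r\<bar> \<le> B" using st[of n] unfolding smooth_step_def by blast
    have "\<bar>\<theta>' n r\<bar> \<le> 2 * B" for r using B[of "r - t1"] B[of "r - t2"] unfolding \<theta>'_def by linarith
    then show ?thesis by blast
  qed
  have eq: "(LINT r|lborel. \<theta>' n r * m' r) = (cNs DIM('a) s / 2) * (LINT q|lborel. \<theta> n (snd q) * bilinear_density P q)" for n
  proof -
    interpret L: weak_pair s t1 ?b "cNs DIM('a) s / 2" w' W "\<theta> n" "\<theta>' n"
    proof
      show "\<exists>B. \<forall>r. \<bar>\<theta> n r\<bar> \<le> B" using \<theta>_b by blast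
      show "\<exists>B. \<forall>r. \<bar>\<theta>' n r\<bar> \<le> B" by (rule \<theta>'_b)
      show "integrable lborel (\<lambda>z. indicator {t1..?b} (snd z) * w' z)" by (rule w_int_spacetime[OF t(1)])
      show "integrable lborel (\<lambda>q. indicator {t1..?b} (snd q) *
        ((W (fst (fst q), snd q) - W (snd (fst q), snd q))\<^sup>2 * kern s (fst (fst q)) (snd (fst q))))"
        using t by (intro W_diff_int) auto
      show "(LINT z|lborel. w' z * (bump k (fst z - x) * \<theta>' n (snd z)))
       = (cNs DIM('a) s / 2) * (LINT q|lborel. (W (fst (fst q), snd q) - W (snd (fst q), snd q)) *
          (bump k (fst (fst q) - x) - bump k (snd (fst q) - x)) * \<theta> n (snd q) * kern s (fst (fst q)) (snd (fst q)))"
        if "k > 0" for k x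
        by (rule weak_with_bump[OF \<theta>_s \<theta>_d t(1) \<theta>_out(1) \<theta>_out(2) \<theta>m that])
    qed (use s \<theta>_out \<theta>m in simp_all)
    have "(LINT z|lborel. L.U1 z * P (fst z)) = (LINT r|lborel. \<theta>' n r * m' r)"
    proof -
      have int: "integrable lborel (\<lambda>z. L.U1 z * P (fst z))"
      proof (rule Bochner_Integration.integrable_bound)
        show "integrable lborel (\<lambda>z. C * L.U1 z)" using L.U1_int by simp
        have [measurable]: "(\<lambda>z::'a\<times>real. P (fst z)) \<in> borel_measurable borel"
          by (rule borel_comp_continuous[OF P(1)]) (intro continuous_intros)
        show "(\<lambda>z. L.U1 z * P (fst z)) \<in> borel_measurable lborel"
          unfolding measurable_lborel1 using L.U1_meas by measurable
        show "AE z in lborel. norm (L.U1 z * P (fst z)) \<le> norm (C * L.U1 z)"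
        proof (rule AE_I2)
          fix z show "norm (L.U1 z * P (fst z)) \<le> norm (C * L.U1 z)"
            using mult_left_mono[OF P(3)[of "fst z"], of "\<bar>L.U1 z\<bar>"] C0 by (simp add: abs_mult mult.commute)
        qed
      qed
      have int': "integrable (lborel \<Otimes>\<^sub>M lborel) (\<lambda>(x, r). L.U1 (x, r) * P x)"
        using int unfolding lborel_prod case_prod_unfold by simp
      have "(LINT z|lborel. L.U1 z * P (fst z)) = (LINT r|lborel. LINT x|lborel. L.U1 (x, r) * P x)"
        using lborel_pair.integral_snd[OF int'] unfolding lborel_prod case_prod_unfold by simp
      also have "\<dots> = (LINT r|lborel. \<theta>' n r * m' r)"
        unfolding m'_def integral_mult_right_zero[symmetric] by (simp add: L.U1_def mult_ac)
      finally show ?thesis .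
    qed
    moreover have "L.U2 q * (P (fst (fst q)) - P (snd (fst q))) = \<theta> n (snd q) * bilinear_density P q" for q
      by (simp add: L.U2_def L.dW_def L.K_def bilinear_density_def)
    ultimately show ?thesis using L.weak_form_finite_energy[OF P] by simp
  qed
  have lim1: "(\<lambda>n. LINT r|lborel. \<theta>' n r * m' r) \<longlonglongrightarrow> m t1 - m t2"
  proof -
    have t2: "t2 > 0" using t by simp
    have "(\<lambda>n. (LINT r|lborel. \<eta> n (r - t1) * m' r) - (LINT r|lborel. \<eta> n (r - t2) * m' r)) \<longlonglongrightarrow> m t1 - m t2"
      using avg[OF t(1)] avg[OF t2] by (intro tendsto_diff) auto
    moreover have "\<forall>\<^sub>F n in sequentially. (LINT r|lborel. \<eta> n (r - t1) * m' r) - (LINT r|lborel. \<eta> n (r - t2) * m' r) = (LINT r|lborel. \<theta>' n r * m' r)"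
      using conjunct1[OF avg[OF t(1)]] conjunct1[OF avg[OF t2]]
      by eventually_elim (simp add: \<theta>'_def left_diff_distrib)
    ultimately show ?thesis by (rule Lim_transform_eventually)
  qed
  have lim2: "(\<lambda>n. LINT q|lborel. \<theta> n (snd q) * bilinear_density P q) \<longlonglongrightarrow> (LINT q|lborel. indicator {t1<..t2} (snd q) * bilinear_density P q)"
  proof (rule integral_dominated_convergence)
    note [measurable] = bilinear_density_meas[OF P(1)] indicator_time_meas
    show "(\<lambda>q. indicator {t1<..t2} (snd q) * bilinear_density P q) \<in> borel_measurable lborel"
      unfolding measurable_lborel1 by measurable
    show "(\<lambda>q. \<theta> n (snd q) * bilinear_density P q) \<in> borel_measurable lborel" for n
    proof -
      have [measurable]: "(\<lambda>q::('a\<times>'a)\<times>real. \<theta> n (snd q)) \<in> borel_measurable borel"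
        by (rule borel_comp_continuous[OF \<theta>m(1)]) (intro continuous_intros)
      show ?thesis unfolding measurable_lborel1 by measurable
    qed
    show "integrable lborel (\<lambda>q. \<bar>indicator {t1..?b} (snd q) * bilinear_density P q\<bar>)"
      by (intro integrable_abs bilinear_density_int P) (use t in auto)
    show "AE q in lborel. (\<lambda>n. \<theta> n (snd q) * bilinear_density P q) \<longlonglongrightarrow> indicator {t1<..t2} (snd q) * bilinear_density P q"
    proof (rule AE_I2)
      fix q :: "('a\<times>'a)\<times>real"
      have "\<forall>\<^sub>F n in sequentially. H n r = indicator {0<..} r" for r
      proof (cases "r > 0")
        case True
        have "\<forall>\<^sub>F n in sequentially. d n < r" using dlim True by (rule order_tendstoD(2))
        then show ?thesis
          by eventually_elim (use st True in \<open>auto simp: smooth_step_def\<close>)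
      next
        case False
        then show ?thesis using st by (intro always_eventually) (auto simp: smooth_step_def)
      qed
      from this[of "snd q - t1"] this[of "snd q - t2"]
      have "\<forall>\<^sub>F n in sequentially. \<theta> n (snd q) = indicator {t1<..t2} (snd q)"
        by eventually_elim (use t in \<open>auto simp: \<theta>_def indicator_def\<close>)
      then have "(\<lambda>n. \<theta> n (snd q)) \<longlonglongrightarrow> indicator {t1<..t2} (snd q)" by (rule tendsto_eventually)
      then show "(\<lambda>n. \<theta> n (snd q) * bilinear_density P q) \<longlonglongrightarrow> indicator {t1<..t2} (snd q) * bilinear_density P q"
        by (rule tendsto_mult_right)
    qed
    show "AE q in lborel. norm (\<theta> n (snd q) * bilinear_density P q) \<le> \<bar>indicator {t1..?b} (snd q) * bilinear_density P q\<bar>" for n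
    proof (rule AE_I2)
      fix q :: "('a\<times>'a)\<times>real"
      show "norm (\<theta> n (snd q) * bilinear_density P q) \<le> \<bar>indicator {t1..?b} (snd q) * bilinear_density P q\<bar>"
        using mult_right_mono[OF \<theta>_b[of n "snd q"], of "\<bar>bilinear_density P q\<bar>"] \<theta>_out(1)[of "snd q" n]
        by (cases "snd q \<in> {t1..?b}") (simp_all add: abs_mult)
    qed
  qed
  have "m t1 - m t2 = (cNs DIM('a) s / 2) * (LINT q|lborel. indicator {t1<..t2} (snd q) * bilinear_density P q)"
    using LIMSEQ_unique[OF lim1] tendsto_mult_left[OF lim2, of "cNs DIM('a) s / 2"] unfolding eq by blast
  moreover have "(LINT x|lebesgue. (w x t2 - w x t1) * P x) = m t2 - m t1"
    unfolding m_def using iwP[OF w_integrable[OF t(1)]] iwP[OF w_integrable[of t2]] t by (simp add: left_diff_distrib)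
  ultimately show ?thesis by simp
qed

end

subsection \<open>Convex primitives of the ramp\<close>

definition ramp :: "real \<Rightarrow> real \<Rightarrow> real" where
  "ramp d r = min 1 (max 0 (r / d))"

lemma ramp_bounds: "0 \<le> ramp d r" "ramp d r \<le> 1"
  by (auto simp: ramp_def)

lemma ramp_nonpos: "r \<le> 0 \<Longrightarrow> d > 0 \<Longrightarrow> ramp d r = 0"
  using divide_nonpos_pos[of r d] by (simp add: ramp_def)

lemma ramp_mono: "d > 0 \<Longrightarrow> x \<le> y \<Longrightarrow> ramp d x \<le> ramp d y"
proof -
  assume "d > 0" "x \<le> y"
  then have "x / d \<le> y / d" by (simp add: divide_right_mono)
  then show ?thesis unfolding ramp_def by (auto simp: min_def max_def)
qed

lemma ramp_Lipschitz: "d > 0 \<Longrightarrow> \<bar>ramp d x - ramp d y\<bar> \<le> \<bar>x - y\<bar> / d"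
proof -
  assume "d > 0"
  then have "\<bar>x - y\<bar> / d = \<bar>x / d - y / d\<bar>" by (simp add: diff_divide_distrib[symmetric])
  then show ?thesis unfolding ramp_def by (auto simp: min_def max_def abs_if)
qed

text \<open>Pointwise source of the sign of the combined energy terms.\<close>

lemma ramp_monotone_product: "d > 0 \<Longrightarrow> 0 \<le> (x - y) * (ramp d x - ramp d y)"
  using ramp_mono[of d x y] ramp_mono[of d y x] by (cases "x \<le> y") (auto simp: zero_le_mult_iff)

lemma ramp_measurable [measurable]: "ramp d \<in> borel_measurable borel"
  unfolding ramp_def by measurable

lemma ramp_tendsto_1:
  assumes "r > 0" "d \<longlonglongrightarrow> 0" "\<And>j. d j > (0::real)"
  shows "(\<lambda>j. ramp (d j) r) \<longlonglongrightarrow> 1"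
proof (rule tendsto_eventually)
  have "\<forall>\<^sub>F j in sequentially. d j < r" using assms by (intro order_tendstoD(2)) auto
  then show "\<forall>\<^sub>F j in sequentially. ramp (d j) r = 1"
  proof eventually_elim
    case (elim j)
    then have "r / d j \<ge> 1" using assms(3)[of j] by simp
    then show ?case by (simp add: ramp_def)
  qed
qed

text \<open>Strictness lets the narrowing ramp reach 1 at all values above the threshold. Only
  positive arguments are compared, since the nonlinearity has no meaning elsewhere.\<close>

locale strict_mono_pos =
  fixes \<phi> :: "real \<Rightarrow> real"
  assumes \<phi>_meas [measurable]: "\<phi> \<in> borel_measurable borel"
    and \<phi>_mono: "\<And>x y. 0 < x \<Longrightarrow> x < y \<Longrightarrow> \<phi> x < \<phi> y"
begin

lemma \<phi>_mono_le: "0 < x \<Longrightarrow> x \<le> y \<Longrightarrow> \<phi> x \<le> \<phi> y"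
  using \<phi>_mono[of x y] by (cases "x = y") auto

text \<open>
  \<open>Jf\<close> is convex in its first and \<open>Jb\<close> in its second argument, with the same ramp as derivative up to sign.
\<close>

definition Jf :: "real \<Rightarrow> real \<Rightarrow> real \<Rightarrow> real" where
  "Jf d r k = (LINT \<sigma>|lborel. indicator {k<..r} \<sigma> * ramp d (\<phi> \<sigma> - \<phi> k))"

definition Jb :: "real \<Rightarrow> real \<Rightarrow> real \<Rightarrow> real" where
  "Jb d r k = (LINT \<sigma>|lborel. indicator {k<..r} \<sigma> * ramp d (\<phi> r - \<phi> \<sigma>))"

lemma integrable_indicator_Ioc: "integrable lborel (indicator {a<..b} :: real \<Rightarrow> real)"
  by (cases "a \<le> b") (simp_all add: integrable_indicator_iff)

lemma integral_indicator_Ioc_max: "(LINT \<sigma>|lborel. indicator {a<..b} \<sigma>) = max 0 (b - a :: real)"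
  by (cases "a \<le> b") simp_all

lemma integral_indicator_Ioc: "a \<le> b \<Longrightarrow> (LINT \<sigma>|lborel. indicator {a<..b} \<sigma> * c) = (b - a) * (c::real)"
  by simp

lemma J_integrable:
  "integrable lborel (\<lambda>\<sigma>. indicator {a<..b} \<sigma> * ramp d (\<phi> \<sigma> - c))"
  "integrable lborel (\<lambda>\<sigma>. indicator {a<..b} \<sigma> * ramp d (c - \<phi> \<sigma>))"
  by (rule Bochner_Integration.integrable_bound[OF integrable_indicator_Ioc[of a b]];
      use ramp_bounds in \<open>auto simp: indicator_def\<close>)+

lemma J_nonneg: "0 \<le> Jf d r k" "0 \<le> Jb d r k"
  unfolding Jf_def Jb_def by (auto intro!: Bochner_Integration.integral_nonneg simp: ramp_bounds)

lemma J_le: "Jf d r k \<le> max 0 (r - k)" "Jb d r k \<le> max 0 (r - k)"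
proof -
  note m = integral_indicator_Ioc_max[of k r]
  show "Jf d r k \<le> max 0 (r - k)" unfolding Jf_def m[symmetric]
    by (intro integral_mono J_integrable integrable_indicator_Ioc) (auto simp: indicator_def ramp_bounds)
  show "Jb d r k \<le> max 0 (r - k)" unfolding Jb_def m[symmetric]
    by (intro integral_mono J_integrable integrable_indicator_Ioc) (auto simp: indicator_def ramp_bounds)
qed

text \<open>The tangent inequality at the new value \<open>r2\<close>, as in an implicit Euler step.
  It follows from comparing integrands: between \<open>r1\<close> and \<open>r2\<close> the ramp
  lies on the correct side of its value at \<open>r2\<close>, by monotonicity, so nothing has to be
  differentiated.\<close>

lemma Jf_convex:
  assumes d: "d > 0" and k: "0 < k" and r: "0 < r1" "0 < r2"
  shows "Jf d r2 k - Jf d r1 k \<le> (r2 - r1) * ramp d (\<phi> r2 - \<phi> k)"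
proof (cases "r1 \<le> r2")
  case True
  have "Jf d r2 k - Jf d r1 k = (LINT \<sigma>|lborel. indicator {k<..r2} \<sigma> * ramp d (\<phi> \<sigma> - \<phi> k) - indicator {k<..r1} \<sigma> * ramp d (\<phi> \<sigma> - \<phi> k))"
    unfolding Jf_def by (simp add: J_integrable)
  also have "\<dots> \<le> (LINT \<sigma>|lborel. indicator {r1<..r2} \<sigma> * ramp d (\<phi> r2 - \<phi> k))"
  proof (rule integral_mono)
    fix \<sigma>
    have "ramp d (\<phi> \<sigma> - \<phi> k) \<le> ramp d (\<phi> r2 - \<phi> k)" if "k < \<sigma>" "\<sigma> \<le> r2"
      using \<phi>_mono_le[of \<sigma> r2] that k by (intro ramp_mono d) auto
    then show "indicator {k<..r2} \<sigma> * ramp d (\<phi> \<sigma> - \<phi> k) - indicator {k<..r1} \<sigma> * ramp d (\<phi> \<sigma> - \<phi> k)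
        \<le> indicator {r1<..r2} \<sigma> * ramp d (\<phi> r2 - \<phi> k)"
      using True ramp_bounds by (auto simp: indicator_def)
  qed (auto intro!: J_integrable Bochner_Integration.integrable_diff integrable_mult_left integrable_indicator_Ioc)
  finally show ?thesis using True by (simp add: integral_indicator_Ioc)
next
  case False
  have "(r1 - r2) * ramp d (\<phi> r2 - \<phi> k) = (LINT \<sigma>|lborel. indicator {r2<..r1} \<sigma> * ramp d (\<phi> r2 - \<phi> k))"
    using False by simp
  also have "\<dots> \<le> (LINT \<sigma>|lborel. indicator {k<..r1} \<sigma> * ramp d (\<phi> \<sigma> - \<phi> k) - indicator {k<..r2} \<sigma> * ramp d (\<phi> \<sigma> - \<phi> k))"
  proof (rule integral_mono)
    fix \<sigma>
    have 1: "ramp d (\<phi> r2 - \<phi> k) \<le> ramp d (\<phi> \<sigma> - \<phi> k)" if "r2 < \<sigma>"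
      using \<phi>_mono_le[of r2 \<sigma>] that r by (intro ramp_mono d) auto
    have 2: "ramp d (\<phi> r2 - \<phi> k) = 0" if "r2 \<le> k"
      using \<phi>_mono_le[of r2 k] that r d by (intro ramp_nonpos) auto
    show "indicator {r2<..r1} \<sigma> * ramp d (\<phi> r2 - \<phi> k)
      \<le> indicator {k<..r1} \<sigma> * ramp d (\<phi> \<sigma> - \<phi> k) - indicator {k<..r2} \<sigma> * ramp d (\<phi> \<sigma> - \<phi> k)"
      using 1 2 False by (auto simp: indicator_def)
  qed (auto intro!: J_integrable Bochner_Integration.integrable_diff integrable_mult_left integrable_indicator_Ioc)
  also have "\<dots> = Jf d r1 k - Jf d r2 k"
    unfolding Jf_def by (simp add: J_integrable)
  finally show ?thesis by (simp add: algebra_simps)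
qed

text \<open>Mirror image of \<open>Jf_convex\<close>: the slope in the second argument is minus the
  ramp, which decreases in absolute value as the argument grows. The tangent is again taken at the
  new value.\<close>

lemma Jb_convex:
  assumes d: "d > 0" and k: "0 < k1" "0 < k2" and r: "0 < r"
  shows "Jb d r k2 - Jb d r k1 \<le> - ((k2 - k1) * ramp d (\<phi> r - \<phi> k2))"
proof (cases "k1 \<le> k2")
  case True
  have "(k2 - k1) * ramp d (\<phi> r - \<phi> k2) = (LINT \<sigma>|lborel. indicator {k1<..k2} \<sigma> * ramp d (\<phi> r - \<phi> k2))"
    using True by simp
  also have "\<dots> \<le> (LINT \<sigma>|lborel. indicator {k1<..r} \<sigma> * ramp d (\<phi> r - \<phi> \<sigma>) - indicator {k2<..r} \<sigma> * ramp d (\<phi> r - \<phi> \<sigma>))"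
  proof (rule integral_mono)
    fix \<sigma>
    have 1: "ramp d (\<phi> r - \<phi> k2) \<le> ramp d (\<phi> r - \<phi> \<sigma>)" if "\<sigma> \<le> k2" "k1 < \<sigma>"
      using \<phi>_mono_le[of \<sigma> k2] that k by (intro ramp_mono d) auto
    have 2: "ramp d (\<phi> r - \<phi> k2) = 0" if "r \<le> k2"
      using \<phi>_mono_le[of r k2] that r d by (intro ramp_nonpos) auto
    show "indicator {k1<..k2} \<sigma> * ramp d (\<phi> r - \<phi> k2)
      \<le> indicator {k1<..r} \<sigma> * ramp d (\<phi> r - \<phi> \<sigma>) - indicator {k2<..r} \<sigma> * ramp d (\<phi> r - \<phi> \<sigma>)"
      using 1 2 True by (auto simp: indicator_def)
  qed (auto intro!: J_integrable Bochner_Integration.integrable_diff integrable_mult_left integrable_indicator_Ioc)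
  also have "\<dots> = Jb d r k1 - Jb d r k2"
    unfolding Jb_def by (simp add: J_integrable)
  finally show ?thesis by simp
next
  case False
  have "Jb d r k2 - Jb d r k1 = (LINT \<sigma>|lborel. indicator {k2<..r} \<sigma> * ramp d (\<phi> r - \<phi> \<sigma>) - indicator {k1<..r} \<sigma> * ramp d (\<phi> r - \<phi> \<sigma>))"
    unfolding Jb_def by (simp add: J_integrable)
  also have "\<dots> \<le> (LINT \<sigma>|lborel. indicator {k2<..k1} \<sigma> * ramp d (\<phi> r - \<phi> k2))"
  proof (rule integral_mono)
    fix \<sigma>
    have "ramp d (\<phi> r - \<phi> \<sigma>) \<le> ramp d (\<phi> r - \<phi> k2)" if "k2 < \<sigma>"
      using \<phi>_mono_le[of k2 \<sigma>] that k by (intro ramp_mono d) auto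
    then show "indicator {k2<..r} \<sigma> * ramp d (\<phi> r - \<phi> \<sigma>) - indicator {k1<..r} \<sigma> * ramp d (\<phi> r - \<phi> \<sigma>)
        \<le> indicator {k2<..k1} \<sigma> * ramp d (\<phi> r - \<phi> k2)"
      using False ramp_bounds by (auto simp: indicator_def)
  qed (auto intro!: J_integrable Bochner_Integration.integrable_diff integrable_mult_left integrable_indicator_Ioc)
  also have "\<dots> = (k1 - k2) * ramp d (\<phi> r - \<phi> k2)" using False by simp
  finally show ?thesis by (simp add: algebra_simps)
qed

lemma J_tendsto:
  assumes d: "d \<longlonglongrightarrow> 0" "\<And>j. d j > 0" and k: "0 < k"
  shows "(\<lambda>j. Jf (d j) r k) \<longlonglongrightarrow> max 0 (r - k)" "(\<lambda>j. Jb (d j) r k) \<longlonglongrightarrow> max 0 (r - k)"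
proof -
  note m = integral_indicator_Ioc_max[of k r]
  \<comment> \<open>At the right end point the argument of the ramp in \<open>Jb\<close> is 0 and
    there is no convergence to 1. In \<open>Jf\<close> the corresponding point is the left end,
    which the interval excludes.\<close>
  have ae: "AE \<sigma> in lborel. \<sigma> \<noteq> r" by (rule AE_lborel_singleton)
  show "(\<lambda>j. Jf (d j) r k) \<longlonglongrightarrow> max 0 (r - k)"
    unfolding Jf_def m[symmetric]
  proof (rule integral_dominated_convergence[OF _ _ integrable_indicator_Ioc[of k r]])
    show "AE \<sigma> in lborel. (\<lambda>j. indicator {k<..r} \<sigma> * ramp (d j) (\<phi> \<sigma> - \<phi> k)) \<longlonglongrightarrow> indicator {k<..r} \<sigma>"
      using ramp_tendsto_1[OF _ d] \<phi>_mono[OF k] by (intro AE_I2) (auto simp: indicator_def)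
    show "AE \<sigma> in lborel. norm (indicator {k<..r} \<sigma> * ramp (d j) (\<phi> \<sigma> - \<phi> k)) \<le> indicator {k<..r} \<sigma>" for j
      using ramp_bounds by (intro AE_I2) (auto simp: indicator_def)
  qed auto
  show "(\<lambda>j. Jb (d j) r k) \<longlonglongrightarrow> max 0 (r - k)"
    unfolding Jb_def m[symmetric]
  proof (rule integral_dominated_convergence[OF _ _ integrable_indicator_Ioc[of k r]])
    show "AE \<sigma> in lborel. (\<lambda>j. indicator {k<..r} \<sigma> * ramp (d j) (\<phi> r - \<phi> \<sigma>)) \<longlonglongrightarrow> indicator {k<..r} \<sigma>"
      using ae
    proof eventually_elim
      case (elim \<sigma>)
      then show ?case
        using ramp_tendsto_1[OF _ d, of "\<phi> r - \<phi> \<sigma>"] \<phi>_mono[of \<sigma> r] k by (auto simp: indicator_def)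
    qed
    show "AE \<sigma> in lborel. norm (indicator {k<..r} \<sigma> * ramp (d j) (\<phi> r - \<phi> \<sigma>)) \<le> indicator {k<..r} \<sigma>" for j
      using ramp_bounds by (intro AE_I2) (auto simp: indicator_def)
  qed auto
qed

lemma J_measurable:
  "(\<lambda>z. Jf d (fst z) (snd z)) \<in> borel_measurable borel"
  "(\<lambda>z. Jb d (fst z) (snd z)) \<in> borel_measurable borel"
proof -
  have 1: "(\<lambda>p::(real \<times> real) \<times> real. indicator {snd (fst p)<..fst (fst p)} (snd p) :: real) \<in> borel_measurable borel"
  proof -
    have "(\<lambda>p::(real \<times> real) \<times> real. indicator {snd (fst p)<..fst (fst p)} (snd p) :: real)
      = (\<lambda>p. if snd (fst p) < snd p \<and> snd p \<le> fst (fst p) then 1 else 0)"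
      by (auto simp: indicator_def fun_eq_iff)
    then show ?thesis by (simp add: borel_prod[symmetric])
  qed
  have 2: "(\<lambda>p::(real \<times> real) \<times> real. \<phi> (snd p)) \<in> borel_measurable borel" 
    "(\<lambda>p::(real \<times> real) \<times> real. \<phi> (fst (fst p))) \<in> borel_measurable borel" 
    "(\<lambda>p::(real \<times> real) \<times> real. \<phi> (snd (fst p))) \<in> borel_measurable borel"
    by (rule borel_comp_continuous[OF \<phi>_meas], intro continuous_intros)+
  note [measurable] = 1 2
  have "(\<lambda>p::(real \<times> real) \<times> real. indicator {snd (fst p)<..fst (fst p)} (snd p) * ramp d (\<phi> (snd p) - \<phi> (snd (fst p)))) \<in> borel_measurable borel"
    by measurable
  then have "(\<lambda>(z, \<sigma>). indicator {snd z<..fst z} \<sigma> * ramp d (\<phi> \<sigma> - \<phi> (snd z))) \<in> borel_measurable (lborel \<Otimes>\<^sub>M lborel)"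
    unfolding lborel_prod case_prod_unfold by simp
  from lborel.borel_measurable_lebesgue_integral[OF this]
  show "(\<lambda>z. Jf d (fst z) (snd z)) \<in> borel_measurable borel" unfolding Jf_def by simp
  have "(\<lambda>p::(real \<times> real) \<times> real. indicator {snd (fst p)<..fst (fst p)} (snd p) * ramp d (\<phi> (fst (fst p)) - \<phi> (snd p))) \<in> borel_measurable borel"
    by measurable
  then have "(\<lambda>(z, \<sigma>). indicator {snd z<..fst z} \<sigma> * ramp d (\<phi> (fst z) - \<phi> \<sigma>)) \<in> borel_measurable (lborel \<Otimes>\<^sub>M lborel)"
    unfolding lborel_prod case_prod_unfold by simp
  from lborel.borel_measurable_lebesgue_integral[OF this]
  show "(\<lambda>z. Jb d (fst z) (snd z)) \<in> borel_measurable borel" unfolding Jb_def by simp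
qed

end

lemma strict_mono_pos_phi:
  assumes "n \<ge> 0"
  shows "strict_mono_pos (phi n)"
proof
  show "phi n \<in> borel_measurable borel" unfolding phi_def by measurable
  show "phi n x < phi n y" if "0 < x" "x < y" for x y
  proof (cases "n > 0")
    case True
    then show ?thesis using powr_less_mono2_neg[of "- n" x y] that by (simp add: phi_def)
  next
    case False
    then show ?thesis using that assms by (simp add: phi_def)
  qed
qed

subsection \<open>Time averages of the energy\<close>

text \<open>The weight \<open>l\<close> separates a factor that vanishes with the time step, the
  oscillation, from one that is merely bounded, the energy of the test function.\<close>

lemma weighted_AM_GM: "\<bar>u * v\<bar> \<le> u\<^sup>2 / (2 * l) + l / 2 * v\<^sup>2" if "l > 0" for u v l :: real
proof -
  have "0 \<le> (\<bar>u\<bar> - l * \<bar>v\<bar>)\<^sup>2" by simp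
  then have "2 * l * (\<bar>u\<bar> * \<bar>v\<bar>) \<le> u\<^sup>2 + l\<^sup>2 * v\<^sup>2"
    by (simp add: power2_diff power_mult_distrib algebra_simps)
  then have "\<bar>u\<bar> * \<bar>v\<bar> \<le> (u\<^sup>2 + l\<^sup>2 * v\<^sup>2) / (2 * l)"
    using that by (simp add: pos_le_divide_eq mult.commute)
  also have "\<dots> = u\<^sup>2 / (2 * l) + l / 2 * v\<^sup>2"
    using that by (simp add: field_simps power2_eq_square)
  finally show ?thesis by (simp add: abs_mult)
qed

context borel_weak_solution
begin

definition "incr t Z = W (fst Z, t) - W (snd Z, t)"

definition "time_energy t = (LINT Z|lborel. (incr t Z)\<^sup>2 * kern s (fst Z) (snd Z))"

definition "bilinear_at t P = (LINT Z|lborel. incr t Z * (P (fst Z) - P (snd Z)) * kern s (fst Z) (snd Z))"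

text \<open>Integrating over \<open>Z\<close> and the last variable gives \<open>osc h t\<close>:
  the squared energy distance between the nonlinearity at time \<open>t\<close> and at the times of
  the window of length \<open>h\<close> before it, summed over that window without division by
  \<open>h\<close>.\<close>

definition "osc_density h p = indicator {snd (fst p) - h<..snd (fst p)} (snd p) *
   ((incr (snd p) (fst (fst p)) - incr (snd (fst p)) (fst (fst p)))\<^sup>2 * kern s (fst (fst (fst p))) (snd (fst (fst p))))"

definition "osc h t = (LINT Z|lborel. LINT r|lborel. osc_density h ((Z, t), r))"

text \<open>The times at which arguments for a single time slice are legitimate. Almost every
  positive time qualifies, by Fubini.\<close>

definition "good t \<longleftrightarrow> t > 0 \<and> (AE x in lborel. w x t = w' (x, t)) \<and>
   integrable lborel (\<lambda>Z. (incr t Z)\<^sup>2 * kern s (fst Z) (snd Z))"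

lemma goodD: "good t \<Longrightarrow> t > 0" "good t \<Longrightarrow> AE x in lborel. w x t = w' (x, t)"
  "good t \<Longrightarrow> integrable lborel (\<lambda>Z. (incr t Z)\<^sup>2 * kern s (fst Z) (snd Z))"
  by (auto simp: good_def)

lemma good_integrable:
  assumes "good t" shows "integrable lborel (\<lambda>x. w' (x, t))"
  using lebesgue_AE_eq_borel(3)[OF section_meas goodD(2)[OF assms]] w_integrable[OF goodD(1)[OF assms]] by simp

lemma incr_meas [measurable]: "incr t \<in> borel_measurable borel"
proof -
  have "(\<lambda>Z. W (fst Z, t)) \<in> borel_measurable borel" "(\<lambda>Z. W (snd Z, t)) \<in> borel_measurable borel"
    by (rule borel_comp_continuous[OF W_meas], intro continuous_intros)+
  then show ?thesis unfolding incr_def by measurable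
qed

lemma incr_q: "W (fst (fst q), snd q) - W (snd (fst q), snd q) = incr (snd q) (fst q)"
  by (simp add: incr_def)

lemma incr_joint_meas: "(\<lambda>q. incr (snd q) (fst q)) \<in> borel_measurable borel"
  unfolding incr_q[symmetric] using W_lift_meas by measurable

lemma kern_fst_meas: "(\<lambda>q::('a \<times> 'a) \<times> real. kern s (fst (fst q)) (snd (fst q))) \<in> borel_measurable borel"
  by (rule kern_lift_meas)

lemma AE_good: "AE t in lborel. t > 0 \<longrightarrow> good t"
proof -
  \<comment> \<open>Energy is integrable on compact subintervals of the positive times only, so
    countably many of them are used. The right ends \<open>n + 2\<close> keep every interval
    nondegenerate.\<close>
  have 1: "AE t in lborel. \<forall>n::nat. integrable lborel (\<lambda>Z. indicator {1 / (real n + 1)..real n + 2} t * ((incr t Z)\<^sup>2 * kern s (fst Z) (snd Z)))"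
    unfolding AE_all_countable
  proof
    fix n :: nat
    have "1 / (real n + 1) \<le> 1" by simp
    then have lt: "1 / (real n + 1) < real n + 2" by linarith
    have "integrable (lborel \<Otimes>\<^sub>M lborel) (\<lambda>(Z, t). indicator {1 / (real n + 1)..real n + 2} t * ((incr t Z)\<^sup>2 * kern s (fst Z) (snd Z)))"
      using W_diff_int[OF _ lt] unfolding lborel_prod case_prod_unfold incr_q by simp
    from lborel_pair.AE_integrable_snd[OF this]
    show "AE t in lborel. integrable lborel (\<lambda>Z. indicator {1 / (real n + 1)..real n + 2} t * ((incr t Z)\<^sup>2 * kern s (fst Z) (snd Z)))" .
  qed
  show ?thesis
    using 1 w_eq_time
  proof eventually_elim
    case (elim t)
    show ?case
    proof
      assume t: "t > 0"
      obtain m :: nat where m: "1 / t < real m" using reals_Archimedean2 by blast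
      obtain k :: nat where k: "t < real k" using reals_Archimedean2 by blast
      define n where "n = m + k"
      have "1 / (real n + 1) \<le> t"
      proof -
        have "1 \<le> real m * t" using m t by (simp add: field_simps)
        also have "\<dots> \<le> (real n + 1) * t" using t by (intro mult_right_mono) (auto simp: n_def)
        finally show ?thesis by (simp add: field_simps)
      qed
      moreover have "t \<le> real n + 2" using k by (simp add: n_def)
      ultimately have "t \<in> {1 / (real n + 1)..real n + 2}" by simp
      with elim(1)[rule_format, of n] have "integrable lborel (\<lambda>Z. (incr t Z)\<^sup>2 * kern s (fst Z) (snd Z))" by simp
      then show "good t" using elim(2) t by (simp add: good_def)
    qed
  qed
qed

lemma bilinear_at_int:
  assumes "good t" "P \<in> borel_measurable borel" "finite_energy s P"
  shows "integrable lborel (\<lambda>Z. incr t Z * (P (fst Z) - P (snd Z)) * kern s (fst Z) (snd Z))"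
proof (rule Bochner_Integration.integrable_bound)
  show "integrable lborel (\<lambda>Z. (incr t Z)\<^sup>2 * kern s (fst Z) (snd Z) + energy_density s P Z)"
    using goodD(3)[OF assms(1)] assms(3) by (simp add: finite_energy_def)
  note [measurable] = borel_measurable_fst_comp[OF assms(2), where 'b='a] borel_measurable_snd_comp[OF assms(2), where 'a='a]
  show "(\<lambda>Z. incr t Z * (P (fst Z) - P (snd Z)) * kern s (fst Z) (snd Z)) \<in> borel_measurable lborel"
    unfolding measurable_lborel1 by measurable
  show "AE Z in lborel. norm (incr t Z * (P (fst Z) - P (snd Z)) * kern s (fst Z) (snd Z))
     \<le> norm ((incr t Z)\<^sup>2 * kern s (fst Z) (snd Z) + energy_density s P Z)"
  proof (rule AE_I2)
    fix Z :: "'a \<times> 'a"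
    show "norm (incr t Z * (P (fst Z) - P (snd Z)) * kern s (fst Z) (snd Z))
     \<le> norm ((incr t Z)\<^sup>2 * kern s (fst Z) (snd Z) + energy_density s P Z)"
      using mult_right_mono[OF sq_diff_bound[of "incr t Z" "P (fst Z) - P (snd Z)"] kern_nonneg[of s "fst Z" "snd Z"]]
      by (simp add: abs_mult energy_density_def kern_nonneg distrib_right)
  qed
qed

lemma osc_density_slice:
  assumes "good t" "0 < h" "h < t"
  shows "integrable lborel (\<lambda>q. osc_density h ((fst q, t), snd q))"
    "(LINT q|lborel. osc_density h ((fst q, t), snd q)) = osc h t"
proof -
  let ?I = "\<lambda>q::('a \<times> 'a) \<times> real. indicator {t - h<..t} (snd q) :: real"
  show i: "integrable lborel (\<lambda>q. osc_density h ((fst q, t), snd q))"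
  proof (rule Bochner_Integration.integrable_bound)
    have i1: "integrable lborel (\<lambda>q. indicator {t - h..t} (snd q) * ((incr (snd q) (fst q))\<^sup>2 * kern s (fst (fst q)) (snd (fst q))))"
      using W_diff_int[of "t - h" t] assms unfolding incr_q by simp
    have i2: "integrable lborel (\<lambda>q. ((incr t (fst q))\<^sup>2 * kern s (fst (fst q)) (snd (fst q))) * indicator {t - h..t} (snd q))"
      by (rule integrable_lborel_times(1)[OF goodD(3)[OF assms(1)] integrable_indicator_Icc])
    show "integrable lborel (\<lambda>q. 2 * (indicator {t - h..t} (snd q) * ((incr (snd q) (fst q))\<^sup>2 * kern s (fst (fst q)) (snd (fst q))))
       + 2 * (((incr t (fst q))\<^sup>2 * kern s (fst (fst q)) (snd (fst q))) * indicator {t - h..t} (snd q)))"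
      using i1 i2 by simp
    have "(\<lambda>q::('a \<times> 'a) \<times> real. incr t (fst q)) \<in> borel_measurable borel"
      by (rule borel_comp_continuous[OF incr_meas]) (intro continuous_intros)
    note [measurable] = this incr_joint_meas kern_fst_meas indicator_time_meas
    show "(\<lambda>q. osc_density h ((fst q, t), snd q)) \<in> borel_measurable lborel"
      unfolding measurable_lborel1 osc_density_def fst_conv snd_conv by measurable
    show "AE q in lborel. norm (osc_density h ((fst q, t), snd q))
      \<le> norm (2 * (indicator {t - h..t} (snd q) * ((incr (snd q) (fst q))\<^sup>2 * kern s (fst (fst q)) (snd (fst q))))
       + 2 * (((incr t (fst q))\<^sup>2 * kern s (fst (fst q)) (snd (fst q))) * indicator {t - h..t} (snd q)))"
    proof (rule AE_I2)
      fix q :: "('a \<times> 'a) \<times> real"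
      define u v k where "u = incr (snd q) (fst q)" "v = incr t (fst q)" "k = kern s (fst (fst q)) (snd (fst q))"
      have k: "k \<ge> 0" by (simp add: u_v_k_def kern_nonneg)
      have "(u - v)\<^sup>2 \<le> 2 * u\<^sup>2 + 2 * v\<^sup>2"
        using zero_le_power2[of "u + v"] by (simp add: power2_eq_square algebra_simps)
      from mult_right_mono[OF this k] have "(u - v)\<^sup>2 * k \<le> 2 * (u\<^sup>2 * k) + 2 * (v\<^sup>2 * k)"
        by (simp add: algebra_simps)
      then show "norm (osc_density h ((fst q, t), snd q))
      \<le> norm (2 * (indicator {t - h..t} (snd q) * ((incr (snd q) (fst q))\<^sup>2 * kern s (fst (fst q)) (snd (fst q))))
       + 2 * (((incr t (fst q))\<^sup>2 * kern s (fst (fst q)) (snd (fst q))) * indicator {t - h..t} (snd q)))"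
        unfolding osc_density_def fst_conv snd_conv u_v_k_def[symmetric] using k
        by (cases "snd q \<in> {t - h<..t}") (auto simp: indicator_def)
    qed
  qed
  have "integrable (lborel \<Otimes>\<^sub>M lborel) (\<lambda>q. osc_density h ((fst q, t), snd q))"
    using i unfolding lborel_prod .
  from lborel_pair.integral_fst'[OF this]
  show "(LINT q|lborel. osc_density h ((fst q, t), snd q)) = osc h t"
    unfolding lborel_prod osc_def by simp
qed

text \<open>The equation supplies the energy pairing averaged over the time step, while the
  comparison of both solutions needs it at the end point \<open>t\<close>. The weighted AM-GM
  inequality bounds the discrepancy by the oscillation and the energy of \<open>P\<close>.\<close>

lemma bilinear_time_average:
  assumes t: "good t" "0 < h" "h < t" and l: "l > 0"
    and P: "P \<in> borel_measurable borel" "finite_energy s P"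
  shows "\<bar>(LINT q|lborel. indicator {t - h<..t} (snd q) * bilinear_density P q) - h * bilinear_at t P\<bar>
    \<le> osc h t / (2 * l) + h * (l / 2 * (LINT Z|lborel. energy_density s P Z))"
proof -
  let ?I = "indicator {t - h<..t} :: real \<Rightarrow> real"
  have iI: "integrable lborel ?I" "(LINT r|lborel. ?I r) = h"
    using t by (simp_all add: integrable_indicator_iff)
  note i0 = integrable_lborel_times[OF bilinear_at_int[OF t(1) P] iI(1)]
  note iE = integrable_lborel_times[OF P(2)[unfolded finite_energy_def] iI(1)]
  note iO = osc_density_slice[OF t]
  have i1: "integrable lborel (\<lambda>q. ?I (snd q) * bilinear_density P q)"
  proof (rule Bochner_Integration.integrable_bound)
    show "integrable lborel (\<lambda>q. indicator {t - h..t} (snd q) * bilinear_density P q)"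
      using t by (intro bilinear_density_int P) auto
    note [measurable] = bilinear_density_meas[OF P(1)] indicator_time_meas
    show "(\<lambda>q. ?I (snd q) * bilinear_density P q) \<in> borel_measurable lborel"
      unfolding measurable_lborel1 by measurable
    show "AE q in lborel. norm (?I (snd q) * bilinear_density P q) \<le> norm (indicator {t - h..t} (snd q) * bilinear_density P q)"
      by (intro AE_I2) (auto simp: indicator_def)
  qed
  define D where "D q = ?I (snd q) * bilinear_density P q - (incr t (fst q) * (P (fst (fst q)) - P (snd (fst q))) * kern s (fst (fst q)) (snd (fst q))) * ?I (snd q)" for q
  have iD: "integrable lborel D" unfolding D_def using i1 i0 by simp
  have "(LINT q|lborel. D q) = (LINT q|lborel. ?I (snd q) * bilinear_density P q) - h * bilinear_at t P"
    unfolding D_def using i1 i0(1) by (simp add: i0(2)[unfolded iI(2), folded bilinear_at_def])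
  moreover have "\<bar>LINT q|lborel. D q\<bar> \<le> (LINT q|lborel. osc_density h ((fst q, t), snd q) / (2 * l) + l / 2 * (energy_density s P (fst q) * ?I (snd q)))"
  proof -
    have "\<bar>LINT q|lborel. D q\<bar> \<le> (LINT q|lborel. norm (D q))" using integral_norm_bound[of lborel D] by simp
    also have "\<dots> \<le> (LINT q|lborel. osc_density h ((fst q, t), snd q) / (2 * l) + l / 2 * (energy_density s P (fst q) * ?I (snd q)))"
    proof (rule integral_mono)
      show "integrable lborel (\<lambda>q. norm (D q))" using iD by simp
      show "integrable lborel (\<lambda>q. osc_density h ((fst q, t), snd q) / (2 * l) + l / 2 * (energy_density s P (fst q) * ?I (snd q)))"
        using iO iE by simp
      fix q :: "('a \<times> 'a) \<times> real"
      define u v k where "u = incr (snd q) (fst q) - incr t (fst q)" "v = P (fst (fst q)) - P (snd (fst q))" "k = kern s (fst (fst q)) (snd (fst q))"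
      have k: "k \<ge> 0" by (simp add: u_v_k_def kern_nonneg)
      have "\<bar>u * v\<bar> * k \<le> (u\<^sup>2 / (2 * l) + l / 2 * v\<^sup>2) * k"
        by (rule mult_right_mono[OF weighted_AM_GM[OF l] k])
      then have *: "\<bar>u * v\<bar> * k \<le> u\<^sup>2 * k / (2 * l) + l / 2 * (v\<^sup>2 * k)"
        by (simp add: algebra_simps)
      have Dq: "D q = ?I (snd q) * (u * v * k)"
        unfolding D_def bilinear_density_def incr_q u_v_k_def by (simp add: algebra_simps)
      have "norm (D q) = ?I (snd q) * (\<bar>u * v\<bar> * k)" unfolding Dq using k by (simp add: abs_mult)
      also have "\<dots> \<le> ?I (snd q) * (u\<^sup>2 * k / (2 * l) + l / 2 * (v\<^sup>2 * k))"
        using * by (intro mult_left_mono) auto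
      also have "\<dots> = osc_density h ((fst q, t), snd q) / (2 * l) + l / 2 * (energy_density s P (fst q) * ?I (snd q))"
        unfolding osc_density_def energy_density_def fst_conv snd_conv u_v_k_def[symmetric] by (simp add: algebra_simps)
      finally show "norm (D q) \<le> \<dots>" .
    qed
    finally show ?thesis .
  qed
  moreover have "(LINT q|lborel. osc_density h ((fst q, t), snd q) / (2 * l) + l / 2 * (energy_density s P (fst q) * ?I (snd q)))
      = osc h t / (2 * l) + h * (l / 2 * (LINT Z|lborel. energy_density s P Z))"
    using iO iE(1) by (simp add: iE(2)[unfolded iI(2)])
  ultimately show ?thesis by linarith
qed

lemma osc_density_meas: "osc_density h \<in> borel_measurable borel"
proof -
  have 1: "(\<lambda>p::(('a \<times> 'a) \<times> real) \<times> real. indicator {snd (fst p) - h<..snd (fst p)} (snd p) :: real) \<in> borel_measurable borel"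
  proof -
    have "(\<lambda>p::(('a \<times> 'a) \<times> real) \<times> real. indicator {snd (fst p) - h<..snd (fst p)} (snd p) :: real)
      = (\<lambda>p. indicator {0..<h} (snd (fst p) - snd p))"
      by (auto simp: indicator_def fun_eq_iff)
    moreover have "(\<lambda>p::(('a \<times> 'a) \<times> real) \<times> real. indicator {0..<h} (snd (fst p) - snd p) :: real) \<in> borel_measurable borel"
      by (rule borel_comp_continuous[OF borel_measurable_indicator]) (simp, intro continuous_intros)
    ultimately show ?thesis by simp
  qed
  have 2: "(\<lambda>p::(('a \<times> 'a) \<times> real) \<times> real. incr (snd p) (fst (fst p))) \<in> borel_measurable borel"
    using borel_comp_continuous[OF incr_joint_meas, of "\<lambda>p::(('a \<times> 'a) \<times> real) \<times> real. (fst (fst p), snd p)"]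
    by (simp add: continuous_intros)
  have 3: "(\<lambda>p::(('a \<times> 'a) \<times> real) \<times> real. incr (snd (fst p)) (fst (fst p))) \<in> borel_measurable borel"
    using borel_comp_continuous[OF incr_joint_meas, of "\<lambda>p::(('a \<times> 'a) \<times> real) \<times> real. fst p"]
    by (simp add: continuous_intros)
  have 4: "(\<lambda>p::(('a \<times> 'a) \<times> real) \<times> real. kern s (fst (fst (fst p))) (snd (fst (fst p)))) \<in> borel_measurable borel"
    using borel_comp_continuous[OF kern_fst_meas, of "\<lambda>p::(('a \<times> 'a) \<times> real) \<times> real. fst p"]
    by (simp add: continuous_intros)
  note [measurable] = 1 2 3 4
  show ?thesis unfolding osc_density_def by measurable
qed

text \<open>The Steklov averages of the energy increments converge, by continuity of translations in time.\<close>

lemma osc_small: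
  assumes T: "0 < T1" "T1 < T2" and e: "e > 0"
  shows "\<exists>h0>0. \<forall>h. 0 < h \<and> h \<le> h0 \<longrightarrow> integrable lborel (\<lambda>t. indicator {T1..T2} t * osc h t) \<and>
     (LINT t|lborel. indicator {T1..T2} t * osc h t) \<le> e * h"
proof -
  \<comment> \<open>Chosen so that its squared L2 norm is the energy over the time interval. The
    interval starts at \<open>T1/2\<close> to leave room for backward shifts.\<close>
  define G where "G q = indicator {T1/2..T2} (snd q) * incr (snd q) (fst q) * sqrt (kern s (fst (fst q)) (snd (fst q)))" for q
  note [measurable] = incr_joint_meas kern_fst_meas indicator_time_meas
  have Gm: "G \<in> borel_measurable borel" unfolding G_def by measurable
  have G2: "(G q)\<^sup>2 = indicator {T1/2..T2} (snd q) * ((incr (snd q) (fst q))\<^sup>2 * kern s (fst (fst q)) (snd (fst q)))" for q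
    by (simp add: G_def power_mult_distrib kern_nonneg indicator_def)
  have Gi: "integrable lborel (\<lambda>q. (G q)\<^sup>2)"
    unfolding G2 using W_diff_int[of "T1/2" T2] T unfolding incr_q by simp
  define S where "S r = (LINT q|lborel. (G (q + (0, - r)) - G q)\<^sup>2)" for r
  have Si: "integrable lborel (\<lambda>q. (G (q + (0, - r)) - G q)\<^sup>2)" for r
    by (rule translation_L2(1)[OF Gm Gi])
  have "(S \<longlongrightarrow> 0) (at 0)"
  proof -
    have "filterlim (\<lambda>r::real. (0::'a\<times>'a, - r)) (at 0) (at 0)"
      unfolding filterlim_at by (auto intro!: tendsto_eq_intros simp: eventually_at_filter zero_prod_def)
    from filterlim_compose[OF translation_L2(2)[OF Gm Gi] this] show ?thesis unfolding S_def .
  qed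
  then obtain \<delta> where \<delta>: "\<delta> > 0" "\<And>r. r \<noteq> 0 \<Longrightarrow> \<bar>r\<bar> < \<delta> \<Longrightarrow> \<bar>S r\<bar> < e"
    using tendstoD[of S 0 "at 0" e] e by (auto simp: eventually_at)
  have S_le: "S r \<le> e" if "\<bar>r\<bar> < \<delta>" for r
  proof (cases "r = 0")
    case True
    then show ?thesis using e by (simp add: S_def flip: zero_prod_def)
  next
    case False
    then show ?thesis using \<delta>(2)[of r] that by auto
  qed
  \<comment> \<open>The first bound makes the translations small in L2; the second keeps shifted
    times inside the support of the indicator in \<open>G\<close>.\<close>
  define h0 where "h0 = min (\<delta> / 2) (T1 / 2)"
  have h0: "h0 > 0" using \<delta>(1) T by (simp add: h0_def)
  show ?thesis
  proof (intro exI[of _ h0] conjI[OF h0] allI impI)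
    fix h assume h: "0 < h \<and> h \<le> h0"
    define f where "f p = indicator {T1..T2} (snd (fst p)) * osc_density h p" for p :: "(('a \<times> 'a) \<times> real) \<times> real"
    have "(\<lambda>p::(('a \<times> 'a) \<times> real) \<times> real. indicator {T1..T2} (snd (fst p)) :: real) \<in> borel_measurable borel"
      by (rule borel_comp_continuous[OF borel_measurable_indicator]) (simp, intro continuous_intros)
    then have fm[measurable]: "f \<in> borel_measurable borel" unfolding f_def using osc_density_meas by measurable
    have f0: "f p \<ge> 0" for p by (simp add: f_def osc_density_def kern_nonneg)
    \<comment> \<open>Writing the earlier time as \<open>snd q - r\<close> turns the moving window
      into the fixed range of \<open>r\<close> below \<open>h\<close>, and the oscillation into the
      difference of \<open>G\<close> and its translate in time.\<close>
    have fle: "f (q, snd q - r) \<le> indicator {0..<h} r * (G (q + (0, - r)) - G q)\<^sup>2" for q r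
    proof (cases "snd q \<in> {T1..T2} \<and> r \<in> {0..<h}")
      case True
      then have "snd q \<in> {T1/2..T2}" "snd q - r \<in> {T1/2..T2}" using h by (auto simp: h0_def)
      then have "(G (q + (0, - r)) - G q) = (incr (snd q - r) (fst q) - incr (snd q) (fst q)) * sqrt (kern s (fst (fst q)) (snd (fst q)))"
        by (simp add: G_def left_diff_distrib)
      then show ?thesis using True
        by (simp add: f_def osc_density_def power_mult_distrib kern_nonneg indicator_def)
    next
      case False
      then show ?thesis by (auto simp: f_def osc_density_def indicator_def)
    qed
    have fm': "(\<lambda>p. ennreal (f p)) \<in> borel_measurable (lborel \<Otimes>\<^sub>M lborel)"
      unfolding lborel_prod by measurable
    have fm2: "(\<lambda>p. f (fst p, snd (fst p) - snd p)) \<in> borel_measurable borel"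
      by (rule borel_comp_continuous[OF fm]) (intro continuous_intros)
    have fm2': "(\<lambda>p. ennreal (f (fst p, snd (fst p) - snd p))) \<in> borel_measurable (lborel \<Otimes>\<^sub>M lborel)"
      unfolding lborel_prod using fm2 by measurable
    have "(\<integral>\<^sup>+p. ennreal (f p) \<partial>lborel) = (\<integral>\<^sup>+q. \<integral>\<^sup>+r. ennreal (f (q, r)) \<partial>lborel \<partial>lborel)"
      using lborel.nn_integral_fst[OF fm'] by (simp add: lborel_prod)
    also have "\<dots> = (\<integral>\<^sup>+q. \<integral>\<^sup>+r. ennreal (f (q, snd q - r)) \<partial>lborel \<partial>lborel)"
    proof (rule nn_integral_cong)
      fix q
      have "(\<lambda>r. f (q, r)) \<in> borel_measurable borel"
        by (rule borel_comp_continuous[OF fm]) (intro continuous_intros)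
      then show "(\<integral>\<^sup>+r. ennreal (f (q, r)) \<partial>lborel) = (\<integral>\<^sup>+r. ennreal (f (q, snd q - r)) \<partial>lborel)"
        by (intro nn_integral_lborel_reflect[symmetric]) measurable
    qed
    also have "\<dots> = (\<integral>\<^sup>+r. \<integral>\<^sup>+q. ennreal (f (q, snd q - r)) \<partial>lborel \<partial>lborel)"
      using lborel.nn_integral_fst[OF fm2'] lborel_pair.nn_integral_snd[OF fm2'] by simp
    also have "\<dots> \<le> (\<integral>\<^sup>+r. ennreal e * indicator {0..<h} r \<partial>lborel)"
    proof (rule nn_integral_mono)
      fix r :: real
      have "(\<integral>\<^sup>+q. ennreal (f (q, snd q - r)) \<partial>lborel) \<le> (\<integral>\<^sup>+q. ennreal (indicator {0..<h} r * (G (q + (0, - r)) - G q)\<^sup>2) \<partial>lborel)"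
        by (intro nn_integral_mono ennreal_leI fle)
      also have "\<dots> = ennreal (indicator {0..<h} r * S r)"
        unfolding S_def using Si[of r] by (subst nn_integral_eq_integral) auto
      also have "\<dots> \<le> ennreal (e * indicator {0..<h} r)"
        using S_le[of r] h \<delta>(1) by (intro ennreal_leI) (auto simp: indicator_def h0_def)
      also have "\<dots> = ennreal e * indicator {0..<h} r"
        using e by (auto simp: indicator_def)
      finally show "(\<integral>\<^sup>+q. ennreal (f (q, snd q - r)) \<partial>lborel) \<le> ennreal e * indicator {0..<h} r" .
    qed
    also have "\<dots> = ennreal (e * h)"
      using h e by (simp add: nn_integral_cmult ennreal_mult)
    finally have nf: "(\<integral>\<^sup>+p. ennreal (f p) \<partial>lborel) \<le> ennreal (e * h)" .
    have fi: "integrable lborel f"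
      by (rule integrableI_bounded) (use fm nf f0 in \<open>auto intro: le_less_trans\<close>)
    have fi': "integrable (lborel \<Otimes>\<^sub>M lborel) f" using fi unfolding lborel_prod .
    have fI: "(LINT p|lborel. f p) \<le> e * h"
    proof -
      have "ennreal (LINT p|lborel. f p) = (\<integral>\<^sup>+p. ennreal (f p) \<partial>lborel)"
        using nn_integral_eq_integral[OF fi] f0 by simp
      then have "ennreal (LINT p|lborel. f p) \<le> ennreal (e * h)" using nf by simp
      then show ?thesis using e h by (simp add: ennreal_le_iff)
    qed
    define g where "g q = (LINT r|lborel. f (q, r))" for q
    have gi: "integrable lborel g" "(LINT q|lborel. g q) = (LINT p|lborel. f p)"
      using lborel_pair.integrable_fst'[OF fi'] lborel_pair.integral_fst'[OF fi']
      unfolding g_def lborel_prod by simp_all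
    have gi': "integrable (lborel \<Otimes>\<^sub>M lborel) (\<lambda>(Z, t). g (Z, t))" using gi(1) unfolding lborel_prod by simp
    have eq: "(LINT Z|lborel. g (Z, t)) = indicator {T1..T2} t * osc h t" for t
      unfolding g_def f_def osc_def by simp
    show "integrable lborel (\<lambda>t. indicator {T1..T2} t * osc h t) \<and>
     (LINT t|lborel. indicator {T1..T2} t * osc h t) \<le> e * h"
      using lborel_pair.integrable_snd[OF gi'] lborel_pair.integral_snd[OF gi'] fI gi(2)
      unfolding eq lborel_prod by simp
  qed
qed

lemma time_energy_int:
  assumes "0 < a" "a < b"
  shows "integrable lborel (\<lambda>t. indicator {a..b} t * time_energy t)"
proof -
  have "integrable (lborel \<Otimes>\<^sub>M lborel) (\<lambda>(Z, t). indicator {a..b} t * ((incr t Z)\<^sup>2 * kern s (fst Z) (snd Z)))"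
    using W_diff_int[OF assms] unfolding lborel_prod case_prod_unfold incr_q .
  from lborel_pair.integrable_snd[OF this] show ?thesis by (simp add: time_energy_def)
qed

end

subsection \<open>Doubling the time variable\<close>

text \<open>Both nonlinearities are expressed through one \<phi>; the constant \<kappa> cancels in
  all increments. The sign conditions on \<open>a\<close> and \<open>b\<close> hold everywhere, so
  \<phi> is only ever evaluated at positive arguments.\<close>

locale doubling = strict_mono_pos \<phi> + U: borel_weak_solution s \<phi> u a + V: borel_weak_solution s \<psi> v b
  for s :: real and \<phi> \<psi> :: "real \<Rightarrow> real" and u v :: "'a::euclidean_space \<Rightarrow> real \<Rightarrow> real" and a b :: "'a \<times> real \<Rightarrow> real" +
  fixes \<epsilon> \<kappa> :: real
  assumes eps: "\<epsilon> > 0" and \<psi>: "\<And>r. \<psi> r = \<phi> (r + \<epsilon>) - \<kappa>"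
    and a_pos: "\<And>z. a z > 0" and b_nonneg: "\<And>z. b z \<ge> 0"
begin

text \<open>The function \<open>P\<close> of the overview, formed with the Borel representatives and
  with the two times independent of each other.\<close>

definition "cutoff d t \<tau> x = ramp d (\<phi> (a (x, t)) - \<phi> (b (x, \<tau>) + \<epsilon>))"

definition "c2 = cNs DIM('a) s / 2"

lemma c2_nonneg: "c2 \<ge> 0"
proof -
  have "Gamma ((real DIM('a) + 2 * s) / 2) > 0" using U.s by (intro Gamma_real_pos) (simp add: add_pos_pos)
  moreover have "Gamma (1 - s) > 0" using U.s by (intro Gamma_real_pos) simp
  ultimately show ?thesis using U.s by (simp add: c2_def cNs_def)
qed

lemma b_eps_pos: "b z + \<epsilon> > 0" using b_nonneg[of z] eps by simp

lemma b_section_meas [measurable]: "(\<lambda>x. b (x, \<tau>)) \<in> borel_measurable borel" by (rule V.section_meas)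

lemma a_section_meas [measurable]: "(\<lambda>x. a (x, t)) \<in> borel_measurable borel" by (rule U.section_meas)

lemma V_incr: "V.incr \<tau> Z = \<phi> (b (fst Z, \<tau>) + \<epsilon>) - \<phi> (b (snd Z, \<tau>) + \<epsilon>)"
  by (simp add: V.incr_def V.W_def \<psi>)

lemma U_incr: "U.incr t Z = \<phi> (a (fst Z, t)) - \<phi> (a (snd Z, t))"
  by (simp add: U.incr_def U.W_def)

lemma cutoff_meas [measurable]: "cutoff d t \<tau> \<in> borel_measurable borel"
  unfolding cutoff_def by measurable

lemma cutoff_bounded: "\<bar>cutoff d t \<tau> x\<bar> \<le> 1"
  using ramp_bounds by (simp add: cutoff_def)

lemma cutoff_integrable:
  assumes "U.good t" "d > 0"
  shows "integrable lborel (cutoff d t \<tau>)"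
proof (rule Bochner_Integration.integrable_bound)
  show "integrable lborel (\<lambda>x. a (x, t) / \<epsilon>)" using U.good_integrable[OF assms(1)] by simp
  show "AE x in lborel. norm (cutoff d t \<tau> x) \<le> norm (a (x, t) / \<epsilon>)"
  proof (rule AE_I2)
    fix x
    show "norm (cutoff d t \<tau> x) \<le> norm (a (x, t) / \<epsilon>)"
    proof (cases "a (x, t) \<ge> \<epsilon>")
      case True
      then have "1 \<le> a (x, t) / \<epsilon>" using eps by simp
      then show ?thesis using cutoff_bounded[of d t \<tau> x] by (simp only: real_norm_def)
    next
      case False
      then have "\<phi> (a (x, t)) \<le> \<phi> (b (x, \<tau>) + \<epsilon>)"
        using b_nonneg[of "(x, \<tau>)"] by (intro \<phi>_mono_le a_pos) simp
      then have "cutoff d t \<tau> x = 0" unfolding cutoff_def using assms(2) by (intro ramp_nonpos) auto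
      then show ?thesis by simp
    qed
  qed
qed simp

lemma cutoff_diff: "\<bar>cutoff d t \<tau> x - cutoff d t \<tau> y\<bar> \<le> \<bar>U.incr t (x, y) - V.incr \<tau> (x, y)\<bar> / d" if "d > 0"
  using ramp_Lipschitz[OF that, of "\<phi> (a (x, t)) - \<phi> (b (x, \<tau>) + \<epsilon>)" "\<phi> (a (y, t)) - \<phi> (b (y, \<tau>) + \<epsilon>)"]
  by (simp add: cutoff_def U_incr V_incr algebra_simps)

lemma cutoff_monotone: "0 \<le> (U.incr t (x, y) - V.incr \<tau> (x, y)) * (cutoff d t \<tau> x - cutoff d t \<tau> y)" if "d > 0"
  using ramp_monotone_product[OF that, of "\<phi> (a (x, t)) - \<phi> (b (x, \<tau>) + \<epsilon>)" "\<phi> (a (y, t)) - \<phi> (b (y, \<tau>) + \<epsilon>)"]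
  by (simp add: cutoff_def U_incr V_incr algebra_simps)

text \<open>The ramp has Lipschitz constant \<open>1 / d\<close>, and the square of a difference is
  at most twice the sum of the squares; hence \<open>2 / d\<^sup>2\<close>. The bound degenerates as
  the ramp narrows.\<close>

lemma cutoff_energy:
  assumes "U.good t" "V.good \<tau>" "d > 0"
  shows "finite_energy s (cutoff d t \<tau>)"
    "(LINT Z|lborel. energy_density s (cutoff d t \<tau>) Z) \<le> 2 / d\<^sup>2 * (U.time_energy t + V.time_energy \<tau>)"
proof -
  let ?E = "\<lambda>Z. 2 / d\<^sup>2 * ((U.incr t Z)\<^sup>2 * kern s (fst Z) (snd Z) + (V.incr \<tau> Z)\<^sup>2 * kern s (fst Z) (snd Z))"
  have iE: "integrable lborel ?E" using U.goodD(3)[OF assms(1)] V.goodD(3)[OF assms(2)] by simp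
  have le: "energy_density s (cutoff d t \<tau>) Z \<le> ?E Z" for Z
  proof -
    define p q where "p = U.incr t Z" "q = V.incr \<tau> Z"
    have "(cutoff d t \<tau> (fst Z) - cutoff d t \<tau> (snd Z))\<^sup>2 \<le> (\<bar>p - q\<bar> / d)\<^sup>2"
      using power_mono[OF cutoff_diff[OF assms(3), of t \<tau> "fst Z" "snd Z"], of 2] by (simp add: p_q_def)
    also have "\<dots> = (p - q)\<^sup>2 / d\<^sup>2" by (simp add: power_divide)
    also have "\<dots> \<le> (2 * p\<^sup>2 + 2 * q\<^sup>2) / d\<^sup>2"
      using zero_le_power2[of "p + q"] by (intro divide_right_mono) (auto simp: power2_eq_square algebra_simps)
    finally have "(cutoff d t \<tau> (fst Z) - cutoff d t \<tau> (snd Z))\<^sup>2 \<le> 2 / d\<^sup>2 * (p\<^sup>2 + q\<^sup>2)"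
      by (simp add: field_simps)
    from mult_right_mono[OF this kern_nonneg[of s "fst Z" "snd Z"]]
    show ?thesis unfolding energy_density_def p_q_def by (simp add: algebra_simps)
  qed
  have nn: "energy_density s (cutoff d t \<tau>) Z \<ge> 0" for Z by (simp add: energy_density_def kern_nonneg)
  show fe: "finite_energy s (cutoff d t \<tau>)"
    unfolding finite_energy_def
  proof (rule Bochner_Integration.integrable_bound[OF iE])
    show "energy_density s (cutoff d t \<tau>) \<in> borel_measurable lborel"
      using energy_density_measurable[OF cutoff_meas] by simp
    show "AE Z in lborel. norm (energy_density s (cutoff d t \<tau>) Z) \<le> norm (?E Z)"
    proof (rule AE_I2)
      fix Z show "norm (energy_density s (cutoff d t \<tau>) Z) \<le> norm (?E Z)"
        using le[of Z] nn[of Z] by (metis abs_of_nonneg order_trans real_norm_def)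
    qed
  qed
  have "(LINT Z|lborel. energy_density s (cutoff d t \<tau>) Z) \<le> (LINT Z|lborel. ?E Z)"
    using fe iE le unfolding finite_energy_def by (intro integral_mono) auto
  also have "\<dots> = 2 / d\<^sup>2 * (U.time_energy t + V.time_energy \<tau>)"
    using U.goodD(3)[OF assms(1)] V.goodD(3)[OF assms(2)]
    by (simp only: U.time_energy_def V.time_energy_def integral_mult_right_zero Bochner_Integration.integral_add)
  finally show "(LINT Z|lborel. energy_density s (cutoff d t \<tau>) Z) \<le> 2 / d\<^sup>2 * (U.time_energy t + V.time_energy \<tau>)" .
qed

lemma bilinear_sign:
  assumes "U.good t" "V.good \<tau>" "d > 0"
  shows "V.bilinear_at \<tau> (cutoff d t \<tau>) \<le> U.bilinear_at t (cutoff d t \<tau>)"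
  unfolding U.bilinear_at_def V.bilinear_at_def
proof (rule integral_mono)
  note fe = cutoff_energy(1)[OF assms]
  show "integrable lborel (\<lambda>Z. V.incr \<tau> Z * (cutoff d t \<tau> (fst Z) - cutoff d t \<tau> (snd Z)) * kern s (fst Z) (snd Z))"
    by (rule V.bilinear_at_int[OF assms(2) cutoff_meas fe])
  show "integrable lborel (\<lambda>Z. U.incr t Z * (cutoff d t \<tau> (fst Z) - cutoff d t \<tau> (snd Z)) * kern s (fst Z) (snd Z))"
    by (rule U.bilinear_at_int[OF assms(1) cutoff_meas fe])
  fix Z :: "'a \<times> 'a"
  show "V.incr \<tau> Z * (cutoff d t \<tau> (fst Z) - cutoff d t \<tau> (snd Z)) * kern s (fst Z) (snd Z)
     \<le> U.incr t Z * (cutoff d t \<tau> (fst Z) - cutoff d t \<tau> (snd Z)) * kern s (fst Z) (snd Z)"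
    using cutoff_monotone[OF assms(3), of t "fst Z" "snd Z" \<tau>]
    by (intro mult_right_mono[OF _ kern_nonneg]) (simp add: algebra_simps)
qed

lemma excess_le_a: "max 0 (a (x, t) - (b (x, \<tau>) + \<epsilon>)) \<le> a (x, t)"
  using a_pos[of "(x, t)"] b_eps_pos[of "(x, \<tau>)"] by simp

definition "avg J z = (LINT x|lborel. J (a (x, fst z)) (b (x, snd z) + \<epsilon>))"

text \<open>A common frame for \<open>Jf\<close>, \<open>Jb\<close> and their limit, so that
  measurability, integrability and bounds uniform in the ramp width are proved once.\<close>

definition "excess_like J \<longleftrightarrow> (\<lambda>z. J (fst z) (snd z)) \<in> borel_measurable borel \<and> (\<forall>r k. 0 \<le> J r k \<and> J r k \<le> max 0 (r - k :: real))"

lemma excess_like_J: "excess_like (Jf d)" "excess_like (Jb d)" "excess_like (\<lambda>r k. max 0 (r - k))"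
proof -
  show "excess_like (Jf d)" "excess_like (Jb d)"
    unfolding excess_like_def using J_measurable J_nonneg J_le by auto
  have "(\<lambda>z::real \<times> real. max 0 (fst z - snd z)) \<in> borel_measurable borel"
    by (intro borel_measurable_continuous_onI continuous_intros)
  then show "excess_like (\<lambda>r k. max 0 (r - k))" unfolding excess_like_def by auto
qed

lemma avg_meas:
  assumes "excess_like J"
  shows "avg J \<in> borel_measurable borel"
proof -
  have 1: "(\<lambda>p::(real \<times> real) \<times> 'a. a (snd p, fst (fst p))) \<in> borel_measurable borel"
    by (rule borel_comp_continuous[OF U.w'_meas]) (intro continuous_intros)
  have 2: "(\<lambda>p::(real \<times> real) \<times> 'a. b (snd p, snd (fst p))) \<in> borel_measurable borel"
    by (rule borel_comp_continuous[OF V.w'_meas]) (intro continuous_intros)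
  have "(\<lambda>p::(real \<times> real) \<times> 'a. (a (snd p, fst (fst p)), b (snd p, snd (fst p)) + \<epsilon>)) \<in> borel \<rightarrow>\<^sub>M (borel \<Otimes>\<^sub>M borel)"
    using 1 2 by measurable
  then have "(\<lambda>p::(real \<times> real) \<times> 'a. (a (snd p, fst (fst p)), b (snd p, snd (fst p)) + \<epsilon>)) \<in> borel_measurable borel"
    by (simp add: borel_prod)
  from measurable_compose[OF this conjunct1[OF assms[unfolded excess_like_def]]]
  have "(\<lambda>(z, x). J (a (x, fst z)) (b (x, snd z) + \<epsilon>)) \<in> borel_measurable (lborel \<Otimes>\<^sub>M lborel)"
    unfolding lborel_prod case_prod_unfold by simp
  from lborel.borel_measurable_lebesgue_integral[OF this] show ?thesis unfolding avg_def by simp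
qed

lemma excess_likeD: "excess_like J \<Longrightarrow> 0 \<le> J r k" "excess_like J \<Longrightarrow> J r k \<le> max 0 (r - k)"
  by (auto simp: excess_like_def)

lemma excess_like_section_meas:
  assumes "excess_like J" shows "(\<lambda>x. J (a (x, t)) (b (x, \<tau>) + \<epsilon>)) \<in> borel_measurable borel"
proof -
  have "(\<lambda>x. (a (x, t), b (x, \<tau>) + \<epsilon>)) \<in> borel_measurable borel"
    unfolding borel_prod[symmetric] by measurable
  from measurable_compose[OF this conjunct1[OF assms[unfolded excess_like_def]]] show ?thesis by simp
qed

lemma excess_like_int:
  assumes "excess_like J" "U.good t"
  shows "integrable lborel (\<lambda>x. J (a (x, t)) (b (x, \<tau>) + \<epsilon>))"
proof (rule Bochner_Integration.integrable_bound[OF U.good_integrable[OF assms(2)]])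
  show "(\<lambda>x. J (a (x, t)) (b (x, \<tau>) + \<epsilon>)) \<in> borel_measurable lborel"
    using excess_like_section_meas[OF assms(1)] by simp
  show "AE x in lborel. norm (J (a (x, t)) (b (x, \<tau>) + \<epsilon>)) \<le> norm (a (x, t))"
    using order_trans[OF excess_likeD(2)[OF assms(1)] excess_le_a] excess_likeD(1)[OF assms(1)]
    by (intro AE_I2) (auto simp: a_pos less_imp_le)
qed

lemma cutoff_times_integrable:
  assumes "integrable lborel f"
  shows "integrable lborel (\<lambda>x. f x * cutoff d t \<tau> x)"
proof (rule Bochner_Integration.integrable_bound[OF assms])
  show "AE x in lborel. norm (f x * cutoff d t \<tau> x) \<le> norm (f x)"
  proof (rule AE_I2)
    fix x show "norm (f x * cutoff d t \<tau> x) \<le> norm (f x)"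
      using mult_left_mono[OF cutoff_bounded[of d t \<tau> x], of "\<bar>f x\<bar>"] by (simp add: abs_mult)
  qed
qed (use assms in measurable)

text \<open>Convexity of \<open>Jf\<close> at each point, with the second solution frozen, bounds
  the increment by the increment of \<open>u\<close> paired with the cutoff at the end time. The
  time identity turns this pairing into an averaged energy, and the average is then replaced by the
  value at \<open>t\<close>.\<close>

lemma step_forward:
  assumes t: "U.good t" "U.good (t - h)" "V.good \<tau>" and h: "h > 0" and d: "d > 0" and l: "l > 0"
  shows "avg (Jf d) (t, \<tau>) - avg (Jf d) (t - h, \<tau>) \<le> c2 * (U.osc h t / (2 * l)
    + h * (l / 2 * (LINT Z|lborel. energy_density s (cutoff d t \<tau>) Z)) - h * U.bilinear_at t (cutoff d t \<tau>))"
proof -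
  note fe = cutoff_energy(1)[OF t(1,3) d]
  have ht: "h < t" "0 < t - h" using U.goodD(1)[OF t(2)] by auto
  have "avg (Jf d) (t, \<tau>) - avg (Jf d) (t - h, \<tau>) = (LINT x|lborel. Jf d (a (x, t)) (b (x, \<tau>) + \<epsilon>) - Jf d (a (x, t - h)) (b (x, \<tau>) + \<epsilon>))"
    unfolding avg_def unfolding fst_conv snd_conv using excess_like_int[OF excess_like_J(1) t(1)] excess_like_int[OF excess_like_J(1) t(2)] by simp
  also have "\<dots> \<le> (LINT x|lborel. (a (x, t) - a (x, t - h)) * cutoff d t \<tau> x)"
  proof (rule integral_mono)
    show "Jf d (a (x, t)) (b (x, \<tau>) + \<epsilon>) - Jf d (a (x, t - h)) (b (x, \<tau>) + \<epsilon>) \<le> (a (x, t) - a (x, t - h)) * cutoff d t \<tau> x" for x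
      unfolding cutoff_def by (rule Jf_convex[OF d b_eps_pos a_pos a_pos])
    show "integrable lborel (\<lambda>x. (a (x, t) - a (x, t - h)) * cutoff d t \<tau> x)"
      using U.good_integrable[OF t(1)] U.good_integrable[OF t(2)] by (intro cutoff_times_integrable) simp
  qed (use excess_like_int[OF excess_like_J(1) t(1)] excess_like_int[OF excess_like_J(1) t(2)] in simp)
  also have "\<dots> = (LINT x|lebesgue. (u x t - u x (t - h)) * cutoff d t \<tau> x)"
  proof (rule lebesgue_AE_eq_borel(2)[symmetric])
    show "AE x in lborel. (u x t - u x (t - h)) * cutoff d t \<tau> x = (a (x, t) - a (x, t - h)) * cutoff d t \<tau> x"
      using U.goodD(2)[OF t(1)] U.goodD(2)[OF t(2)] by eventually_elim simp
  qed measurable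
  also have "\<dots> = - c2 * (LINT q|lborel. indicator {t - h<..t} (snd q) * U.bilinear_density (cutoff d t \<tau>) q)"
    unfolding c2_def using h
    by (intro U.time_identity[OF ht(2) _ cutoff_meas cutoff_integrable[OF t(1) d] cutoff_bounded fe]) simp
  also have "\<dots> \<le> c2 * (U.osc h t / (2 * l) + h * (l / 2 * (LINT Z|lborel. energy_density s (cutoff d t \<tau>) Z)) - h * U.bilinear_at t (cutoff d t \<tau>))"
  proof -
    have "- (LINT q|lborel. indicator {t - h<..t} (snd q) * U.bilinear_density (cutoff d t \<tau>) q)
       \<le> U.osc h t / (2 * l) + h * (l / 2 * (LINT Z|lborel. energy_density s (cutoff d t \<tau>) Z)) - h * U.bilinear_at t (cutoff d t \<tau>)"
      using U.bilinear_time_average[OF t(1) h ht(1) l cutoff_meas fe] by linarith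
    from mult_left_mono[OF this c2_nonneg] show ?thesis by simp
  qed
  finally show ?thesis .
qed

text \<open>Same argument in the other time. Raising the second solution lowers the excess, so its
  energy pairing enters with the opposite sign to that in \<open>step_forward\<close>.\<close>

lemma step_backward:
  assumes t: "U.good t" "V.good \<tau>" "V.good (\<tau> - h)" and h: "h > 0" and d: "d > 0" and l: "l > 0"
  shows "avg (Jb d) (t, \<tau>) - avg (Jb d) (t, \<tau> - h) \<le> c2 * (V.osc h \<tau> / (2 * l)
    + h * (l / 2 * (LINT Z|lborel. energy_density s (cutoff d t \<tau>) Z)) + h * V.bilinear_at \<tau> (cutoff d t \<tau>))"
proof -
  note fe = cutoff_energy(1)[OF t(1,2) d]
  have ht: "h < \<tau>" "0 < \<tau> - h" using V.goodD(1)[OF t(3)] by auto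
  have "avg (Jb d) (t, \<tau>) - avg (Jb d) (t, \<tau> - h) = (LINT x|lborel. Jb d (a (x, t)) (b (x, \<tau>) + \<epsilon>) - Jb d (a (x, t)) (b (x, \<tau> - h) + \<epsilon>))"
    unfolding avg_def using excess_like_int[OF excess_like_J(2) t(1)] by simp
  also have "\<dots> \<le> (LINT x|lborel. - ((b (x, \<tau>) - b (x, \<tau> - h)) * cutoff d t \<tau> x))"
  proof (rule integral_mono)
    show "Jb d (a (x, t)) (b (x, \<tau>) + \<epsilon>) - Jb d (a (x, t)) (b (x, \<tau> - h) + \<epsilon>) \<le> - ((b (x, \<tau>) - b (x, \<tau> - h)) * cutoff d t \<tau> x)" for x
      using Jb_convex[OF d b_eps_pos[of "(x, \<tau> - h)"] b_eps_pos[of "(x, \<tau>)"] a_pos[of "(x, t)"]] by (simp add: cutoff_def)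
    show "integrable lborel (\<lambda>x. - ((b (x, \<tau>) - b (x, \<tau> - h)) * cutoff d t \<tau> x))"
      using V.good_integrable[OF t(2)] V.good_integrable[OF t(3)]
      by (intro Bochner_Integration.integrable_minus cutoff_times_integrable) simp
  qed (use excess_like_int[OF excess_like_J(2) t(1)] in simp)
  also have "\<dots> = - (LINT x|lborel. (b (x, \<tau>) - b (x, \<tau> - h)) * cutoff d t \<tau> x)" by simp
  also have "(LINT x|lborel. (b (x, \<tau>) - b (x, \<tau> - h)) * cutoff d t \<tau> x) = (LINT x|lebesgue. (v x \<tau> - v x (\<tau> - h)) * cutoff d t \<tau> x)"
  proof (rule lebesgue_AE_eq_borel(2)[symmetric])
    show "AE x in lborel. (v x \<tau> - v x (\<tau> - h)) * cutoff d t \<tau> x = (b (x, \<tau>) - b (x, \<tau> - h)) * cutoff d t \<tau> x"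
      using V.goodD(2)[OF t(2)] V.goodD(2)[OF t(3)] by eventually_elim simp
  qed measurable
  also have "\<dots> = - c2 * (LINT q|lborel. indicator {\<tau> - h<..\<tau>} (snd q) * V.bilinear_density (cutoff d t \<tau>) q)"
    unfolding c2_def using h
    by (intro V.time_identity[OF ht(2) _ cutoff_meas cutoff_integrable[OF t(1) d] cutoff_bounded fe]) simp
  also have "- \<dots> \<le> c2 * (V.osc h \<tau> / (2 * l) + h * (l / 2 * (LINT Z|lborel. energy_density s (cutoff d t \<tau>) Z)) + h * V.bilinear_at \<tau> (cutoff d t \<tau>))"
  proof -
    have "(LINT q|lborel. indicator {\<tau> - h<..\<tau>} (snd q) * V.bilinear_density (cutoff d t \<tau>) q)
       \<le> V.osc h \<tau> / (2 * l) + h * (l / 2 * (LINT Z|lborel. energy_density s (cutoff d t \<tau>) Z)) + h * V.bilinear_at \<tau> (cutoff d t \<tau>)"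
      using V.bilinear_time_average[OF t(2) h ht(1) l cutoff_meas fe] by linarith
    from mult_left_mono[OF this c2_nonneg] show ?thesis by simp
  qed
  finally show ?thesis .
qed

text \<open>The two energy pairings use the same cutoff and subtract to a nonnegative quantity,
  which is dropped. Each step contributes \<open>l / 2\<close> times the energy of the cutoff, which
  \<open>cutoff_energy\<close> estimates.\<close>

lemma step_inequality:
  assumes t: "U.good t" "U.good (t - h)" "V.good \<tau>" "V.good (\<tau> - h)" and h: "h > 0" and d: "d > 0" and l: "l > 0"
  shows "(avg (Jf d) (t, \<tau>) - avg (Jf d) (t - h, \<tau>)) + (avg (Jb d) (t, \<tau>) - avg (Jb d) (t, \<tau> - h)) \<le>
    c2 / (2 * l) * (U.osc h t + V.osc h \<tau>) + h * (c2 * l * (2 / d\<^sup>2)) * (U.time_energy t + V.time_energy \<tau>)"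
proof -
  let ?E = "LINT Z|lborel. energy_density s (cutoff d t \<tau>) Z"
  have "(avg (Jf d) (t, \<tau>) - avg (Jf d) (t - h, \<tau>)) + (avg (Jb d) (t, \<tau>) - avg (Jb d) (t, \<tau> - h)) \<le>
     c2 * (U.osc h t / (2 * l) + V.osc h \<tau> / (2 * l) + h * l * ?E - h * (U.bilinear_at t (cutoff d t \<tau>) - V.bilinear_at \<tau> (cutoff d t \<tau>)))"
    using add_mono[OF step_forward[OF t(1-3) h d l] step_backward[OF t(1,3,4) h d l]] by (simp add: algebra_simps)
  also have "\<dots> \<le> c2 * (U.osc h t / (2 * l) + V.osc h \<tau> / (2 * l) + h * l * (2 / d\<^sup>2 * (U.time_energy t + V.time_energy \<tau>)) - 0)"
    using cutoff_energy(2)[OF t(1,3) d] bilinear_sign[OF t(1,3) d] h l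
    by (intro mult_left_mono c2_nonneg diff_mono add_mono order_refl mult_nonneg_nonneg) auto
  also have "\<dots> = c2 / (2 * l) * (U.osc h t + V.osc h \<tau>) + h * (c2 * l * (2 / d\<^sup>2)) * (U.time_energy t + V.time_energy \<tau>)"
    by (simp add: algebra_simps add_divide_distrib)
  finally show ?thesis .
qed

end

subsection \<open>The diagonal\<close>

lemma AE_lborel_shift:
  fixes c :: "'a::euclidean_space"
  assumes "AE x in lborel. R x"
  shows "AE x in lborel. R (x + c)"
proof -
  obtain N where N: "N \<in> null_sets (lborel :: 'a measure)" "{x. \<not> R x} \<subseteq> N"
    using assms by (auto simp: eventually_ae_filter)
  have m: "(\<lambda>x. x + c) \<in> borel_measurable borel" by simp
  have "{x. x + c \<in> N} = (\<lambda>x. x + c) -` N \<inter> space borel" by auto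
  then have "{x. x + c \<in> N} \<in> sets borel" using measurable_sets[OF m, of N] N(1) by auto
  then have "{x. x + c \<in> N} \<in> null_sets lborel"
    using N(1) emeasure_lborel_shift[of N c] by (auto simp: null_sets_def)
  then show ?thesis using N(2) by (elim AE_I') auto
qed

text \<open>The difference quotients fall on the smooth function, where the mean value inequality
  bounds them by \<open>L\<close>; integrability of \<open>X\<close> then gives dominated
  convergence.\<close>

lemma difference_quotient_limit:
  fixes \<theta> X D :: "'b::euclidean_space \<Rightarrow> real"
  assumes X: "integrable lborel X" and [measurable]: "\<theta> \<in> borel_measurable borel" "D \<in> borel_measurable borel"
    and deriv: "\<And>z h. ((\<lambda>h. \<theta> (z + h *\<^sub>R e)) has_real_derivative D (z + h *\<^sub>R e)) (at h)"
    and bound: "\<And>z. \<bar>D z\<bar> \<le> L"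
    and h: "h \<longlonglongrightarrow> 0" "\<And>n. h n > (0::real)"
  shows "(\<lambda>n. LINT z|lborel. X z * ((\<theta> (z + h n *\<^sub>R e) - \<theta> z) / h n)) \<longlonglongrightarrow> (LINT z|lborel. X z * D z)"
proof (rule integral_dominated_convergence)
  have [measurable]: "X \<in> borel_measurable borel" using X by auto
  show "(\<lambda>z. X z * D z) \<in> borel_measurable lborel" by measurable
  show "(\<lambda>z. X z * ((\<theta> (z + h n *\<^sub>R e) - \<theta> z) / h n)) \<in> borel_measurable lborel" for n by measurable
  show "integrable lborel (\<lambda>z. L * \<bar>X z\<bar>)" using X by auto
  have hf: "filterlim h (at 0) sequentially"
    unfolding filterlim_at using h by (auto intro: always_eventually simp: less_imp_neq[symmetric] order_less_imp_not_eq2)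
  show "AE z in lborel. (\<lambda>n. X z * ((\<theta> (z + h n *\<^sub>R e) - \<theta> z) / h n)) \<longlonglongrightarrow> X z * D z"
  proof (rule AE_I2)
    fix z
    have "((\<lambda>h. (\<theta> (z + h *\<^sub>R e) - \<theta> z) / h) \<longlongrightarrow> D z) (at 0)"
      using deriv[of z 0] by (simp add: DERIV_def)
    from filterlim_compose[OF this hf]
    show "(\<lambda>n. X z * ((\<theta> (z + h n *\<^sub>R e) - \<theta> z) / h n)) \<longlonglongrightarrow> X z * D z"
      by (rule tendsto_mult_left)
  qed
  show "AE z in lborel. norm (X z * ((\<theta> (z + h n *\<^sub>R e) - \<theta> z) / h n)) \<le> L * \<bar>X z\<bar>" for n
  proof (rule AE_I2)
    fix z
    have "norm (\<theta> (z + h n *\<^sub>R e) - \<theta> (z + 0 *\<^sub>R e)) \<le> L * norm (h n - 0)"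
      by (rule field_differentiable_bound[of UNIV _ "\<lambda>h. D (z + h *\<^sub>R e)"]) (use deriv bound in auto)
    then have "\<bar>(\<theta> (z + h n *\<^sub>R e) - \<theta> z) / h n\<bar> \<le> L"
      using h(2)[of n] by (simp add: abs_divide pos_divide_le_eq)
    from mult_left_mono[OF this, of "\<bar>X z\<bar>"]
    show "norm (X z * ((\<theta> (z + h n *\<^sub>R e) - \<theta> z) / h n)) \<le> L * \<bar>X z\<bar>"
      by (simp add: abs_mult mult.commute)
  qed
qed

lemma smooth_step_mono:
  assumes "smooth_step d \<eta> H" "x \<le> y"
  shows "H x \<le> H y"
  using assms unfolding smooth_step_def by (intro DERIV_nonneg_imp_nondecreasing[OF assms(2)]) blast

lemma smooth_step_deriv_bound:
  assumes "smooth_step d \<eta> H"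
  shows "\<exists>\<eta>' B. (\<forall>r. (\<eta> has_real_derivative \<eta>' r) (at r)) \<and> continuous_on UNIV \<eta>' \<and> (\<forall>r. \<bar>\<eta>' r\<bar> \<le> B)"
proof -
  define \<eta>' where "\<eta>' r = frechet_derivative \<eta> (at r) 1" for r
  have s: "smooth_fun \<eta>" and out: "\<And>r. r \<notin> {0..d} \<Longrightarrow> \<eta> r = 0" using assms by (auto simp: smooth_step_def)
  have d: "(\<eta> has_real_derivative \<eta>' r) (at r)" for r unfolding \<eta>'_def by (rule smooth_fun_real_deriv(1)[OF s])
  have c: "continuous_on S \<eta>'" for S
    unfolding \<eta>'_def by (rule smooth_fun_imp_continuous[OF smooth_fun_real_deriv(2)[OF s]])
  have z: "\<eta>' r = 0" if "r \<notin> {0..d}" for r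
  proof -
    have "((\<lambda>_. 0) has_real_derivative 0) (at r)" by simp
    then have "(\<eta> has_real_derivative 0) (at r)"
      by (rule has_field_derivative_transform_within_open[where S="- {0..d}"])
        (use that out in \<open>auto simp: open_Compl\<close>)
    then show ?thesis using d DERIV_unique by blast
  qed
  have "bounded (\<eta>' ` {0..d})" by (intro compact_imp_bounded compact_continuous_image c) auto
  then obtain B where B: "\<And>r. r \<in> {0..d} \<Longrightarrow> \<bar>\<eta>' r\<bar> \<le> B" unfolding bounded_iff real_norm_def by blast
  have "\<bar>\<eta>' r\<bar> \<le> \<bar>B\<bar>" for r using B[of r] z[of r] by (cases "r \<in> {0..d}") auto
  then show ?thesis using d c by blast
qed

context doubling
begin

text \<open>The excess over a positive value is at most \<open>a\<close>, so the L1 norm of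
  \<open>u\<close> is a bound. It is independent of \<open>J\<close>, hence of the ramp width, and
  dominates the later limit.\<close>

lemma avg_bounded:
  assumes "0 < T1"
  shows "\<exists>M. \<forall>J z. excess_like J \<and> fst z \<in> {T1..T2} \<and> U.good (fst z) \<longrightarrow> \<bar>avg J z\<bar> \<le> M"
proof -
  obtain M where M: "\<And>t. t \<in> {T1..T2} \<Longrightarrow> (LINT x|lebesgue. \<bar>u x t\<bar>) \<le> M" using U.L1_bound[OF assms] by blast
  have "\<bar>avg J z\<bar> \<le> M" if J: "excess_like J" and z: "fst z \<in> {T1..T2}" "U.good (fst z)" for J z
  proof -
    have "0 \<le> avg J z" unfolding avg_def
      by (intro Bochner_Integration.integral_nonneg excess_likeD(1)[OF J])
    moreover have "avg J z \<le> (LINT x|lborel. a (x, fst z))" unfolding avg_def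
      by (intro integral_mono excess_like_int[OF J z(2)] U.good_integrable[OF z(2)] order_trans[OF excess_likeD(2)[OF J] excess_le_a])
    moreover have "(LINT x|lborel. a (x, fst z)) = (LINT x|lebesgue. u x (fst z))"
      using lebesgue_AE_eq_borel(2)[OF U.section_meas U.goodD(2)[OF z(2)]] by simp
    moreover have "\<dots> \<le> (LINT x|lebesgue. \<bar>u x (fst z)\<bar>)"
      using U.w_integrable[OF U.goodD(1)[OF z(2)]] by (intro integral_mono) auto
    ultimately show ?thesis using M[OF z(1)] by linarith
  qed
  then show ?thesis by blast
qed

lemma AE_good_pairs:
  "AE z in lborel. fst z > 0 \<longrightarrow> U.good (fst z)" "AE z in lborel. snd z > 0 \<longrightarrow> V.good (snd z)"
  "AE z in lborel. fst z - h > 0 \<longrightarrow> U.good (fst z - h)" "AE z in lborel. snd z - h > 0 \<longrightarrow> V.good (snd z - h)"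
  using AE_lborel_fst[OF U.AE_good] AE_lborel_snd[OF V.AE_good]
    AE_lborel_fst[OF AE_lborel_shift[OF U.AE_good, of "- h"]] AE_lborel_snd[OF AE_lborel_shift[OF V.AE_good, of "- h"]]
  by simp_all

text \<open>Extension by zero, so that integrals and translations can be taken over the whole plane
  of time pairs. The box will be larger than the support of the test function, so that small
  backward shifts stay inside.\<close>

definition "boxed T1 T2 J z = indicator ({T1..T2} \<times> {T1..T2}) z * avg J z"

lemma boxed_meas: "excess_like J \<Longrightarrow> boxed T1 T2 J \<in> borel_measurable borel"
  unfolding boxed_def[abs_def] using avg_meas[of J]
  by (intro borel_measurable_times borel_measurable_indicator) (auto intro!: borel_closed closed_Times)

lemma indicator_box_int: "integrable lborel (\<lambda>z. indicator ({T1..T2} \<times> {T1..T2}) z :: real)" for T1 T2 :: real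
  using integrable_lborel_times(1)[OF integrable_indicator_Icc integrable_indicator_Icc, of T1 T2 T1 T2]
  by (simp add: indicator_times)

lemma boxed_AE_bound:
  assumes "0 < T1"
  shows "\<exists>M\<ge>0. \<forall>J. excess_like J \<longrightarrow> (AE z in lborel. \<bar>boxed T1 T2 J z\<bar> \<le> M * indicator ({T1..T2} \<times> {T1..T2}) z)"
proof -
  obtain M where M: "\<And>J z. excess_like J \<Longrightarrow> fst z \<in> {T1..T2} \<Longrightarrow> U.good (fst z) \<Longrightarrow> \<bar>avg J z\<bar> \<le> M"
    using avg_bounded[OF assms] by blast
  have "AE z in lborel. \<bar>boxed T1 T2 J z\<bar> \<le> \<bar>M\<bar> * indicator ({T1..T2} \<times> {T1..T2}) z" if "excess_like J" for J
    using AE_good_pairs(1)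
  proof eventually_elim
    case (elim z)
    then show ?case using M[OF that, of z] assms by (cases z) (auto simp: boxed_def indicator_def)
  qed
  then show ?thesis by (intro exI[of _ "\<bar>M\<bar>"]) auto
qed

lemma boxed_int:
  assumes "0 < T1" "excess_like J"
  shows "integrable lborel (boxed T1 T2 J)"
proof -
  obtain M where M: "M \<ge> 0" "AE z in lborel. \<bar>boxed T1 T2 J z\<bar> \<le> M * indicator ({T1..T2} \<times> {T1..T2}) z"
    using boxed_AE_bound[OF assms(1)] assms(2) by blast
  show ?thesis
  proof (rule Bochner_Integration.integrable_bound)
    show "integrable lborel (\<lambda>z. M * indicator ({T1..T2} \<times> {T1..T2}) z)" using indicator_box_int by (intro integrable_mult_right)
    show "boxed T1 T2 J \<in> borel_measurable lborel" using boxed_meas[OF assms(2)] by simp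
    show "AE z in lborel. norm (boxed T1 T2 J z) \<le> norm (M * indicator ({T1..T2} \<times> {T1..T2}) z)"
      using M(2) by eventually_elim (use M(1) in simp)
  qed
qed

lemma osc_nonneg: "0 \<le> U.osc h t" "0 \<le> V.osc h t" "0 \<le> U.time_energy t" "0 \<le> V.time_energy t"
  unfolding U.osc_def V.osc_def U.osc_density_def V.osc_density_def U.time_energy_def V.time_energy_def
  by (auto intro!: Bochner_Integration.integral_nonneg mult_nonneg_nonneg kern_nonneg)

text \<open>
  After division by \<open>h\<close> the oscillation terms vanish as \<open>h\<close> tends to zero with the weight \<open>l\<close> of the
  AM-GM inequality fixed; the remaining error is proportional to \<open>l\<close>.
\<close>

lemma doubled_inequality:
  fixes \<theta> D1 D2 :: "real \<times> real \<Rightarrow> real"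
  assumes T: "0 < T0" "T0 < T1" "T1 < T2"
    and [measurable]: "\<theta> \<in> borel_measurable borel" "D1 \<in> borel_measurable borel" "D2 \<in> borel_measurable borel"
    and \<theta>0: "\<And>z. 0 \<le> \<theta> z" "\<And>z. \<theta> z \<le> B" "\<And>z. z \<notin> {T1..T2} \<times> {T1..T2} \<Longrightarrow> \<theta> z = 0"
    and D1: "\<And>z h. ((\<lambda>h. \<theta> (z + h *\<^sub>R (1, 0))) has_real_derivative D1 (z + h *\<^sub>R (1, 0))) (at h)" "\<And>z. \<bar>D1 z\<bar> \<le> L"
    and D2: "\<And>z h. ((\<lambda>h. \<theta> (z + h *\<^sub>R (0, 1))) has_real_derivative D2 (z + h *\<^sub>R (0, 1))) (at h)" "\<And>z. \<bar>D2 z\<bar> \<le> L"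
    and d: "d > 0"
  shows "0 \<le> (LINT z|lborel. boxed T0 T2 (Jf d) z * D1 z) + (LINT z|lborel. boxed T0 T2 (Jb d) z * D2 z)"
proof -
  let ?f = "boxed T0 T2 (Jf d)" and ?b = "boxed T0 T2 (Jb d)" and ?I = "indicator {T0..T2} :: real \<Rightarrow> real"
  have T02: "T0 < T2" using T by simp
  have B0: "B \<ge> 0" using \<theta>0(1,2) order_trans by blast
  have fi: "integrable lborel ?f" and bi: "integrable lborel ?b" using boxed_int[OF T(1)] excess_like_J by blast+
  have fm[measurable]: "?f \<in> borel_measurable borel" and bm[measurable]: "?b \<in> borel_measurable borel"
    using boxed_meas excess_like_J by blast+
  define NN where "NN = (LINT t|lborel. ?I t * U.time_energy t) + (LINT t|lborel. ?I t * V.time_energy t)"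
  have iN: "integrable lborel (\<lambda>t. ?I t * U.time_energy t)" "integrable lborel (\<lambda>t. ?I t * V.time_energy t)"
    using U.time_energy_int[OF T(1) T02] V.time_energy_int[OF T(1) T02] by blast+
  have th_bound: "\<bar>\<theta> z * w\<bar> \<le> B * \<bar>w\<bar>" for z w
    using mult_right_mono[OF \<theta>0(2)[of z], of "\<bar>w\<bar>"] \<theta>0(1)[of z] by (simp add: abs_mult)
  have quotient: "- ((LINT z|lborel. ?f z * ((\<theta> (z + h *\<^sub>R (1, 0)) - \<theta> z) / h)) + (LINT z|lborel. ?b z * ((\<theta> (z + h *\<^sub>R (0, 1)) - \<theta> z) / h)))
     \<le> B * (T2 - T0) * (c2 / (2 * l) * (2 * e) + c2 * l * (2 / d\<^sup>2) * NN)"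
    if h: "0 < h" "h \<le> T1 - T0" and l: "l > 0"
      and oU: "integrable lborel (\<lambda>t. ?I t * U.osc h t)" "(LINT t|lborel. ?I t * U.osc h t) \<le> e * h"
      and oV: "integrable lborel (\<lambda>t. ?I t * V.osc h t)" "(LINT t|lborel. ?I t * V.osc h t) \<le> e * h" for h l e
  proof -
    \<comment> \<open>Right-hand side of \<open>step_inequality\<close> on the box. Every summand is
      a product of a function of one time and one of the other, so its integral factorises.\<close>
    define R where "R z = c2 / (2 * l) * ((?I (fst z) * U.osc h (fst z)) * ?I (snd z) + ?I (fst z) * (?I (snd z) * V.osc h (snd z)))
       + h * (c2 * l * (2 / d\<^sup>2)) * ((?I (fst z) * U.time_energy (fst z)) * ?I (snd z) + ?I (fst z) * (?I (snd z) * V.time_energy (snd z)))" for z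
    note iI = integrable_indicator_Icc[of T0 T2]
    have vI: "(LINT t|lborel. ?I t) = T2 - T0" using T02 by simp
    note p1 = integrable_lborel_times[OF oU(1) iI, unfolded vI] integrable_lborel_times[OF iI oV(1), unfolded vI]
      integrable_lborel_times[OF iN(1) iI, unfolded vI] integrable_lborel_times[OF iI iN(2), unfolded vI]
    have iR: "integrable lborel R" unfolding R_def
      by (intro Bochner_Integration.integrable_add integrable_mult_right p1)
    have vR: "(LINT z|lborel. R z) = c2 / (2 * l) * ((LINT t|lborel. ?I t * U.osc h t) * (T2 - T0) + (T2 - T0) * (LINT t|lborel. ?I t * V.osc h t))
       + h * (c2 * l * (2 / d\<^sup>2)) * ((LINT t|lborel. ?I t * U.time_energy t) * (T2 - T0) + (T2 - T0) * (LINT t|lborel. ?I t * V.time_energy t))"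
      unfolding R_def
      by (simp only: Bochner_Integration.integral_add Bochner_Integration.integrable_add integrable_mult_right p1 integral_mult_right_zero)
    have R0: "R z \<ge> 0" for z unfolding R_def
      using c2_nonneg h l by (intro add_nonneg_nonneg mult_nonneg_nonneg osc_nonneg) auto
    \<comment> \<open>The step inequality weighted by the test function. Both backward differences
      are taken at once, each in its own time variable.\<close>
    define Y where "Y z = \<theta> z * ((?f z - ?f (z + (- h, 0))) + (?b z - ?b (z + (0, - h))))" for z
    have le: "AE z in lborel. Y z \<le> B * R z"
      using AE_good_pairs(1) AE_good_pairs(2) AE_good_pairs(3)[of h] AE_good_pairs(4)[of h]
    proof eventually_elim
      case (elim z)
      show ?case
      proof (cases "z \<in> {T1..T2} \<times> {T1..T2}")
        case False
        then have "Y z = 0" by (simp add: Y_def \<theta>0(3))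
        then show ?thesis using B0 R0[of z] by simp
      next
        case True
        obtain t \<tau> where z: "z = (t, \<tau>)" by (cases z)
        have tt: "t \<in> {T0..T2}" "\<tau> \<in> {T0..T2}" "t - h \<in> {T0..T2}" "\<tau> - h \<in> {T0..T2}"
          using True T h by (auto simp: z)
        then have g: "U.good t" "U.good (t - h)" "V.good \<tau>" "V.good (\<tau> - h)"
          using elim T(1) by (auto simp: z)
        have "(?f z - ?f (z + (- h, 0))) + (?b z - ?b (z + (0, - h)))
           = (avg (Jf d) (t, \<tau>) - avg (Jf d) (t - h, \<tau>)) + (avg (Jb d) (t, \<tau>) - avg (Jb d) (t, \<tau> - h))"
          using tt by (simp add: boxed_def z)
        also have "\<dots> \<le> c2 / (2 * l) * (U.osc h t + V.osc h \<tau>) + h * (c2 * l * (2 / d\<^sup>2)) * (U.time_energy t + V.time_energy \<tau>)"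
          by (rule step_inequality[OF g h(1) d l])
        also have "\<dots> = R z" using tt by (simp add: R_def z)
        finally have "Y z \<le> \<theta> z * R z" unfolding Y_def by (intro mult_left_mono \<theta>0(1))
        also have "\<dots> \<le> B * R z" by (intro mult_right_mono \<theta>0(2) R0)
        finally show ?thesis .
      qed
    qed
    have sf: "integrable lborel (\<lambda>z. ?f (z + c))" "integrable lborel (\<lambda>z. ?b (z + c))" for c
      by (rule integrable_lborel_shift[OF fi], rule integrable_lborel_shift[OF bi])
    have ti: "integrable lborel (\<lambda>z. \<theta> z * f z)" if "integrable lborel f" for f :: "real \<times> real \<Rightarrow> real"
    proof (rule Bochner_Integration.integrable_bound)
      show "integrable lborel (\<lambda>z. B * \<bar>f z\<bar>)" using that by auto
      show "AE z in lborel. norm (\<theta> z * f z) \<le> norm (B * \<bar>f z\<bar>)"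
        using th_bound B0 by (intro AE_I2) (simp add: abs_mult)
    qed (use that in measurable)
    have iY: "integrable lborel Y" unfolding Y_def
      by (intro ti Bochner_Integration.integrable_add Bochner_Integration.integrable_diff fi bi sf)
    have sh: "(LINT z|lborel. \<theta> z * g (z + c)) = (LINT z|lborel. \<theta> (z - c) * g z)"
      if [measurable]: "g \<in> borel_measurable borel" for g :: "real \<times> real \<Rightarrow> real" and c
    proof -
      have "(\<lambda>z. \<theta> (z - c) * g z) \<in> borel_measurable borel" by measurable
      from integral_lborel_shift[OF this, of c] show ?thesis by simp
    qed
    have si: "integrable lborel (\<lambda>z. \<theta> (z - c) * g z)" if "integrable lborel g" for g :: "real \<times> real \<Rightarrow> real" and c
    proof (rule Bochner_Integration.integrable_bound)
      show "integrable lborel (\<lambda>z. B * \<bar>g z\<bar>)" using that by auto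
      show "AE z in lborel. norm (\<theta> (z - c) * g z) \<le> norm (B * \<bar>g z\<bar>)"
        using th_bound B0 by (intro AE_I2) (simp add: abs_mult)
    qed (use that in measurable)
    \<comment> \<open>Discrete integration by parts: a backward difference of the averages becomes a
      forward difference of the test function.\<close>
    have quot: "(LINT z|lborel. \<theta> z * g z) - (LINT z|lborel. \<theta> z * g (z + (- c))) = - (LINT z|lborel. g z * (\<theta> (z + c) - \<theta> z))"
      if g: "integrable lborel g" for g :: "real \<times> real \<Rightarrow> real" and c
    proof -
      have gm: "g \<in> borel_measurable borel" using g by auto
      have "(LINT z|lborel. g z * (\<theta> (z + c) - \<theta> z)) = (LINT z|lborel. \<theta> (z - (- c)) * g z - \<theta> z * g z)"
        by (simp add: right_diff_distrib mult.commute)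
      also have "\<dots> = (LINT z|lborel. \<theta> (z - (- c)) * g z) - (LINT z|lborel. \<theta> z * g z)"
        by (rule Bochner_Integration.integral_diff[OF si[OF g] ti[OF g]])
      finally show ?thesis unfolding sh[OF gm] by simp
    qed
    have e: "h *\<^sub>R (1, 0) = (h, 0::real)" "h *\<^sub>R (0, 1) = (0::real, h)" by auto
    have "(LINT z|lborel. Y z) = ((LINT z|lborel. \<theta> z * ?f z) - (LINT z|lborel. \<theta> z * ?f (z + (- h, 0))))
       + ((LINT z|lborel. \<theta> z * ?b z) - (LINT z|lborel. \<theta> z * ?b (z + (0, - h))))"
      unfolding Y_def distrib_left right_diff_distrib
      using ti[OF fi] ti[OF bi] ti[OF sf(1)] ti[OF sf(2)] by simp
    also have "(LINT z|lborel. \<theta> z * ?f z) - (LINT z|lborel. \<theta> z * ?f (z + (- h, 0)))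
       = - (LINT z|lborel. ?f z * (\<theta> (z + h *\<^sub>R (1, 0)) - \<theta> z))"
      using quot[OF fi, of "(h, 0)"] unfolding e by simp
    also have "(LINT z|lborel. \<theta> z * ?b z) - (LINT z|lborel. \<theta> z * ?b (z + (0, - h)))
       = - (LINT z|lborel. ?b z * (\<theta> (z + h *\<^sub>R (0, 1)) - \<theta> z))"
      using quot[OF bi, of "(0, h)"] unfolding e by simp
    finally have YI: "(LINT z|lborel. Y z) = - ((LINT z|lborel. ?f z * (\<theta> (z + h *\<^sub>R (1, 0)) - \<theta> z)) + (LINT z|lborel. ?b z * (\<theta> (z + h *\<^sub>R (0, 1)) - \<theta> z)))"
      by simp
    have "(LINT z|lborel. Y z) \<le> (LINT z|lborel. B * R z)"
      using le iY iR by (intro integral_mono_AE) auto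
    also have "\<dots> = B * (LINT z|lborel. R z)" by simp
    also have "\<dots> \<le> B * (c2 / (2 * l) * (e * h * (T2 - T0) + (T2 - T0) * (e * h)) + h * (c2 * l * (2 / d\<^sup>2)) * (NN * (T2 - T0)))"
    proof (rule mult_left_mono[OF _ B0])
      have "(LINT t|lborel. ?I t * U.osc h t) * (T2 - T0) + (T2 - T0) * (LINT t|lborel. ?I t * V.osc h t) \<le> e * h * (T2 - T0) + (T2 - T0) * (e * h)"
        using oU(2) oV(2) T02 by (intro add_mono mult_left_mono mult_right_mono) auto
      from mult_left_mono[OF this, of "c2 / (2 * l)"] c2_nonneg l
      show "(LINT z|lborel. R z) \<le> c2 / (2 * l) * (e * h * (T2 - T0) + (T2 - T0) * (e * h)) + h * (c2 * l * (2 / d\<^sup>2)) * (NN * (T2 - T0))"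
        unfolding vR NN_def by (simp add: algebra_simps)
    qed
    also have "\<dots> = h * (B * (T2 - T0) * (c2 / (2 * l) * (2 * e) + c2 * l * (2 / d\<^sup>2) * NN))"
      using l by (simp add: field_simps)
    finally have "(LINT z|lborel. Y z) / h \<le> B * (T2 - T0) * (c2 / (2 * l) * (2 * e) + c2 * l * (2 / d\<^sup>2) * NN)"
      using h by (simp add: pos_divide_le_eq mult.commute)
    moreover have "(LINT z|lborel. Y z) / h = - ((LINT z|lborel. ?f z * ((\<theta> (z + h *\<^sub>R (1, 0)) - \<theta> z) / h)) + (LINT z|lborel. ?b z * ((\<theta> (z + h *\<^sub>R (0, 1)) - \<theta> z) / h)))"
    proof -
      have "(LINT z|lborel. g z * (f z / h)) = (LINT z|lborel. g z * f z) / h" for f g :: "real \<times> real \<Rightarrow> real"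
        by simp
      moreover have "- (p + q) / h = - (p / h + q / h)" for p q :: real
        by (simp add: add_divide_distrib diff_divide_distrib)
      ultimately show ?thesis unfolding YI by presburger
    qed
    ultimately show ?thesis by simp
  qed
  define X where "X = - ((LINT z|lborel. ?f z * D1 z) + (LINT z|lborel. ?b z * D2 z))"
  define hs where "hs n = 1 / (real n + 1)" for n :: nat
  have hs: "hs \<longlonglongrightarrow> 0" "\<And>n. hs n > 0"
    unfolding hs_def using LIMSEQ_inverse_real_of_nat by (simp_all add: inverse_eq_divide add.commute)
  have lim: "(\<lambda>n. - ((LINT z|lborel. ?f z * ((\<theta> (z + hs n *\<^sub>R (1, 0)) - \<theta> z) / hs n)) + (LINT z|lborel. ?b z * ((\<theta> (z + hs n *\<^sub>R (0, 1)) - \<theta> z) / hs n)))) \<longlonglongrightarrow> X"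
    unfolding X_def
    by (intro tendsto_intros difference_quotient_limit[OF fi _ _ D1 hs] difference_quotient_limit[OF bi _ _ D2 hs]) measurable
  have Xle: "X \<le> B * (T2 - T0) * (c2 / (2 * l) * (2 * e) + c2 * l * (2 / d\<^sup>2) * NN)" if "l > 0" "e > 0" for l e
  proof (rule tendsto_upperbound[OF lim])
    obtain h1 where h1: "h1 > 0" "\<And>h. 0 < h \<Longrightarrow> h \<le> h1 \<Longrightarrow> integrable lborel (\<lambda>t. ?I t * U.osc h t) \<and> (LINT t|lborel. ?I t * U.osc h t) \<le> e * h"
      using U.osc_small[OF T(1) T02 \<open>e > 0\<close>] by blast
    obtain h2 where h2: "h2 > 0" "\<And>h. 0 < h \<Longrightarrow> h \<le> h2 \<Longrightarrow> integrable lborel (\<lambda>t. ?I t * V.osc h t) \<and> (LINT t|lborel. ?I t * V.osc h t) \<le> e * h"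
      using V.osc_small[OF T(1) T02 \<open>e > 0\<close>] by blast
    have "\<forall>\<^sub>F n in sequentially. hs n < min (T1 - T0) (min h1 h2)"
      using hs(1) h1(1) h2(1) T by (intro order_tendstoD(2)) auto
    then show "\<forall>\<^sub>F n in sequentially. - ((LINT z|lborel. ?f z * ((\<theta> (z + hs n *\<^sub>R (1, 0)) - \<theta> z) / hs n)) + (LINT z|lborel. ?b z * ((\<theta> (z + hs n *\<^sub>R (0, 1)) - \<theta> z) / hs n)))
       \<le> B * (T2 - T0) * (c2 / (2 * l) * (2 * e) + c2 * l * (2 / d\<^sup>2) * NN)"
    proof eventually_elim
      case (elim n)
      with h1(2)[of "hs n"] h2(2)[of "hs n"] hs(2)[of n]
      show ?case by (intro quotient \<open>l > 0\<close>) auto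
    qed
  qed simp
  \<comment> \<open>The oscillation level \<open>e\<close> is arbitrary for fixed \<open>l\<close>.
    Taking it as the square of \<open>l\<close> makes both error terms linear in
    \<open>l\<close>.\<close>
  have Xle2: "X \<le> B * (T2 - T0) * (c2 + c2 * (2 / d\<^sup>2) * NN) * l" if "l > 0" for l
  proof -
    have "X \<le> B * (T2 - T0) * (c2 / (2 * l) * (2 * l\<^sup>2) + c2 * l * (2 / d\<^sup>2) * NN)"
      using Xle[of l "l\<^sup>2"] that by simp
    also have "c2 / (2 * l) * (2 * l\<^sup>2) = c2 * l" using that by (simp add: power2_eq_square)
    finally show ?thesis by (simp add: algebra_simps)
  qed
  have "X \<le> 0"
  proof (rule tendsto_lowerbound[of _ _ "at_right (0::real)"])
    have "((\<lambda>l. B * (T2 - T0) * (c2 + c2 * (2 / d\<^sup>2) * NN) * l) \<longlongrightarrow> B * (T2 - T0) * (c2 + c2 * (2 / d\<^sup>2) * NN) * 0) (at_right 0)"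
      by (intro tendsto_mult_left tendsto_ident_at)
    then show "((\<lambda>l. B * (T2 - T0) * (c2 + c2 * (2 / d\<^sup>2) * NN) * l) \<longlongrightarrow> 0) (at_right 0)" by simp
    show "\<forall>\<^sub>F l in at_right 0. X \<le> B * (T2 - T0) * (c2 + c2 * (2 / d\<^sup>2) * NN) * l"
      using Xle2 by (simp add: eventually_at_filter)
  qed simp
  then show ?thesis by (simp add: X_def)
qed

lemma avg_tendsto:
  assumes d: "d \<longlonglongrightarrow> 0" "\<And>j. d j > 0" and g: "U.good (fst z)"
  shows "(\<lambda>j. avg (Jf (d j)) z) \<longlonglongrightarrow> avg (\<lambda>r k. max 0 (r - k)) z"
    "(\<lambda>j. avg (Jb (d j)) z) \<longlonglongrightarrow> avg (\<lambda>r k. max 0 (r - k)) z"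
proof -
  have gen: "(\<lambda>j. avg (J j) z) \<longlonglongrightarrow> avg (\<lambda>r k. max 0 (r - k)) z"
    if J: "\<And>j. excess_like (J j)" and lim: "\<And>r k. 0 < k \<Longrightarrow> (\<lambda>j. J j r k) \<longlonglongrightarrow> max 0 (r - k)" for J
    unfolding avg_def
  proof (rule integral_dominated_convergence)
    show "integrable lborel (\<lambda>x. a (x, fst z))" by (rule U.good_integrable[OF g])
    show "AE x in lborel. (\<lambda>j. J j (a (x, fst z)) (b (x, snd z) + \<epsilon>)) \<longlonglongrightarrow> max 0 (a (x, fst z) - (b (x, snd z) + \<epsilon>))"
      by (intro AE_I2 lim b_eps_pos)
    show "AE x in lborel. norm (J j (a (x, fst z)) (b (x, snd z) + \<epsilon>)) \<le> a (x, fst z)" for j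
      using order_trans[OF excess_likeD(2)[OF J] excess_le_a] excess_likeD(1)[OF J] by (intro AE_I2) simp
    show "(\<lambda>x. max 0 (a (x, fst z) - (b (x, snd z) + \<epsilon>))) \<in> borel_measurable lborel" by measurable
    show "(\<lambda>x. J j (a (x, fst z)) (b (x, snd z) + \<epsilon>)) \<in> borel_measurable lborel" for j
      using excess_like_section_meas[OF J] by simp
  qed
  show "(\<lambda>j. avg (Jf (d j)) z) \<longlonglongrightarrow> avg (\<lambda>r k. max 0 (r - k)) z"
    by (intro gen excess_like_J J_tendsto d)
  show "(\<lambda>j. avg (Jb (d j)) z) \<longlonglongrightarrow> avg (\<lambda>r k. max 0 (r - k)) z"
    by (intro gen excess_like_J J_tendsto d)
qed

abbreviation "boxed_excess T1 T2 \<equiv> boxed T1 T2 (\<lambda>r k. max 0 (r - k))"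

lemma boxed_tendsto:
  assumes T: "0 < T1" and d: "d \<longlonglongrightarrow> 0" "\<And>j. d j > 0"
    and [measurable]: "D \<in> borel_measurable borel" and L: "\<And>z. \<bar>D z\<bar> \<le> L"
  shows "(\<lambda>j. LINT z|lborel. boxed T1 T2 (Jf (d j)) z * D z) \<longlonglongrightarrow> (LINT z|lborel. boxed_excess T1 T2 z * D z)"
    "(\<lambda>j. LINT z|lborel. boxed T1 T2 (Jb (d j)) z * D z) \<longlonglongrightarrow> (LINT z|lborel. boxed_excess T1 T2 z * D z)"
proof -
  obtain M where M: "M \<ge> 0" "\<And>J. excess_like J \<Longrightarrow> (AE z in lborel. \<bar>boxed T1 T2 J z\<bar> \<le> M * indicator ({T1..T2} \<times> {T1..T2}) z)"
    using boxed_AE_bound[OF T] by blast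
  have gen: "(\<lambda>j. LINT z|lborel. boxed T1 T2 (J j) z * D z) \<longlonglongrightarrow> (LINT z|lborel. boxed_excess T1 T2 z * D z)"
    if J: "\<And>j. excess_like (J j)" and lim: "\<And>z. U.good (fst z) \<Longrightarrow> (\<lambda>j. avg (J j) z) \<longlonglongrightarrow> avg (\<lambda>r k. max 0 (r - k)) z" for J
  proof (rule integral_dominated_convergence)
    note [measurable] = boxed_meas[OF J] boxed_meas[OF excess_like_J(3)]
    show "(\<lambda>z. boxed_excess T1 T2 z * D z) \<in> borel_measurable lborel" by measurable
    show "(\<lambda>z. boxed T1 T2 (J j) z * D z) \<in> borel_measurable lborel" for j by measurable
    show "integrable lborel (\<lambda>z. M * L * indicator ({T1..T2} \<times> {T1..T2}) z)"
      using indicator_box_int by (intro integrable_mult_right)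
    show "AE z in lborel. (\<lambda>j. boxed T1 T2 (J j) z * D z) \<longlonglongrightarrow> boxed_excess T1 T2 z * D z"
      using AE_good_pairs(1)
    proof eventually_elim
      case (elim z)
      have "(\<lambda>j. boxed T1 T2 (J j) z) \<longlonglongrightarrow> boxed_excess T1 T2 z"
      proof (cases "z \<in> {T1..T2} \<times> {T1..T2}")
        case True
        then have "U.good (fst z)" using elim T by (cases z) auto
        from tendsto_mult_left[OF lim[OF this]] show ?thesis unfolding boxed_def .
      qed (simp add: boxed_def)
      then show ?case by (rule tendsto_mult_right)
    qed
    show "AE z in lborel. norm (boxed T1 T2 (J j) z * D z) \<le> M * L * indicator ({T1..T2} \<times> {T1..T2}) z" for j
      using M(2)[OF J, of j]
    proof eventually_elim
      case (elim z)
      have "\<bar>boxed T1 T2 (J j) z\<bar> * \<bar>D z\<bar> \<le> (M * indicator ({T1..T2} \<times> {T1..T2}) z) * L"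
        using M(1) by (intro mult_mono elim L) auto
      then show ?case by (simp add: abs_mult mult_ac)
    qed
  qed
  show "(\<lambda>j. LINT z|lborel. boxed T1 T2 (Jf (d j)) z * D z) \<longlonglongrightarrow> (LINT z|lborel. boxed_excess T1 T2 z * D z)"
    by (intro gen excess_like_J avg_tendsto(1) d)
  show "(\<lambda>j. LINT z|lborel. boxed T1 T2 (Jb (d j)) z * D z) \<longlonglongrightarrow> (LINT z|lborel. boxed_excess T1 T2 z * D z)"
    by (intro gen excess_like_J avg_tendsto(2) d)
qed

text \<open>The test function is a time cutoff in the first variable times a mollifier in the
  difference of the two times. The sum of its two partial derivatives differentiates only the
  cutoff, whose derivative is a mollifier at \<open>t1\<close> minus one at
  \<open>t2\<close>.\<close>

lemma diagonal_inequality: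
  assumes t: "0 < t1" "t1 < t2" and k: "0 < k" "k \<le> 1" and st: "smooth_step k \<eta> H"
  shows "0 \<le> (LINT z|lborel. boxed_excess (t1/2) (t2 + 2) z * ((\<eta> (fst z - t1) - \<eta> (fst z - t2)) * \<eta> (snd z - fst z)))"
proof -
  obtain \<eta>' B' where \<eta>': "\<And>r. (\<eta> has_real_derivative \<eta>' r) (at r)" "continuous_on UNIV \<eta>'" "\<And>r. \<bar>\<eta>' r\<bar> \<le> B'"
    using smooth_step_deriv_bound[OF st] by blast
  have Hd: "\<And>r. (H has_real_derivative \<eta> r) (at r)" and \<eta>0: "\<And>r. 0 \<le> \<eta> r" and \<eta>out: "\<And>r. r \<notin> {0..k} \<Longrightarrow> \<eta> r = 0"
    and H01: "\<And>r. 0 \<le> H r \<and> H r \<le> 1" and Hl: "\<And>r. r \<le> 0 \<Longrightarrow> H r = 0" and Hr: "\<And>r. r \<ge> k \<Longrightarrow> H r = 1"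
    and \<eta>s: "smooth_fun \<eta>" and Hs: "smooth_fun H"
    using st unfolding smooth_step_def by blast+
  obtain B where B: "\<And>r. \<bar>\<eta> r\<bar> \<le> B" using st unfolding smooth_step_def by blast
  have B0: "B \<ge> 0" "B' \<ge> 0" using order_trans[OF abs_ge_zero B] order_trans[OF abs_ge_zero \<eta>'(3)] by blast+
  define \<alpha> where "\<alpha> r = H (r - t1) - H (r - t2)" for r
  define \<alpha>' where "\<alpha>' r = \<eta> (r - t1) - \<eta> (r - t2)" for r
  have \<alpha>0: "0 \<le> \<alpha> r" for r using smooth_step_mono[OF st, of "r - t2" "r - t1"] t by (simp add: \<alpha>_def)
  have \<alpha>1: "\<bar>\<alpha> r\<bar> \<le> 1" for r using H01[of "r - t1"] H01[of "r - t2"] by (auto simp: \<alpha>_def)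
  have \<alpha>out: "\<alpha> r = 0" if "r \<notin> {t1..t2 + k}" for r
    using that t Hl[of "r - t1"] Hl[of "r - t2"] Hr[of "r - t1"] Hr[of "r - t2"] by (auto simp: \<alpha>_def)
  have \<alpha>d: "(\<alpha> has_real_derivative \<alpha>' r) (at r)" for r
  proof -
    have "((\<lambda>r. H (r + (- t))) has_real_derivative \<eta> (r + (- t))) (at r)" for t
      using Hd[of "r + (- t)"] unfolding DERIV_shift .
    from DERIV_diff[OF this[of t1] this[of t2]] show ?thesis unfolding \<alpha>_def \<alpha>'_def by simp
  qed
  \<comment> \<open>\<open>\<eta>\<close> forces the second time to lie between the first and
    \<open>k\<close> beyond it. With \<open>k\<close> at most 1 the support stays below
    \<open>t2 + 2\<close>, the upper end of the box.\<close>
  define \<theta> where "\<theta> z = \<alpha> (fst z) * \<eta> (snd z - fst z)" for z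
  define D1 where "D1 z = \<alpha>' (fst z) * \<eta> (snd z - fst z) - \<alpha> (fst z) * \<eta>' (snd z - fst z)" for z
  define D2 where "D2 z = \<alpha> (fst z) * \<eta>' (snd z - fst z)" for z
  define L where "L = 2 * B * B + B'"
  have cH: "continuous_on UNIV H" and ce: "continuous_on UNIV \<eta>" using smooth_fun_imp_continuous Hs \<eta>s by blast+
  have m: "\<theta> \<in> borel_measurable borel" "D1 \<in> borel_measurable borel" "D2 \<in> borel_measurable borel"
    unfolding \<theta>_def D1_def D2_def \<alpha>_def \<alpha>'_def
    by (intro borel_measurable_continuous_onI continuous_intros continuous_on_compose2[OF cH] continuous_on_compose2[OF ce]
        continuous_on_compose2[OF \<eta>'(2)]; simp)+
  have \<alpha>'b: "\<bar>\<alpha>' r\<bar> \<le> 2 * B" for r using B[of "r - t1"] B[of "r - t2"] by (simp add: \<alpha>'_def)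
  have D2b: "\<bar>D2 z\<bar> \<le> B'" for z
    using mult_mono[OF \<alpha>1[of "fst z"] \<eta>'(3)[of "snd z - fst z"]] by (simp add: D2_def abs_mult)
  have D1b: "\<bar>D1 z\<bar> \<le> L" for z
  proof -
    have "\<bar>\<alpha>' (fst z) * \<eta> (snd z - fst z)\<bar> \<le> 2 * B * B"
      unfolding abs_mult using B0 by (intro mult_mono \<alpha>'b B) auto
    then show ?thesis using D2b[of z] unfolding D1_def D2_def L_def by linarith
  qed
  have D2b': "\<bar>D2 z\<bar> \<le> L" for z using D2b[of z] B0 by (simp add: L_def add_increasing)
  define d where "d n = 1 / (real n + 1)" for n :: nat
  have d: "d \<longlonglongrightarrow> 0" "\<And>n. d n > 0"
    unfolding d_def using LIMSEQ_inverse_real_of_nat by (simp_all add: inverse_eq_divide add.commute)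
  have ineq: "0 \<le> (LINT z|lborel. boxed (t1/2) (t2 + 2) (Jf (d n)) z * D1 z) + (LINT z|lborel. boxed (t1/2) (t2 + 2) (Jb (d n)) z * D2 z)" for n
  proof (rule doubled_inequality[where ?T1.0=t1 and \<theta>=\<theta> and L=L and B=B])
    show "0 \<le> \<theta> z" for z using \<alpha>0 \<eta>0 by (simp add: \<theta>_def)
    show "\<theta> z \<le> B" for z
      using mult_mono[OF \<alpha>1[of "fst z"] B[of "snd z - fst z"]] by (simp add: \<theta>_def abs_mult[symmetric])
    show "\<theta> z = 0" if "z \<notin> {t1..t2 + 2} \<times> {t1..t2 + 2}" for z
    proof (cases "fst z \<in> {t1..t2 + k}")
      case True
      then have "snd z - fst z \<notin> {0..k}" using that k by (cases z) auto
      then show ?thesis by (simp add: \<theta>_def \<eta>out)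
    qed (simp add: \<theta>_def \<alpha>out)
    show "((\<lambda>h. \<theta> (z + h *\<^sub>R (1, 0))) has_real_derivative D1 (z + h *\<^sub>R (1, 0))) (at h)" for z h
      unfolding \<theta>_def D1_def
      by (auto intro!: derivative_eq_intros DERIV_chain2[OF \<alpha>d] DERIV_chain2[OF \<eta>'(1)])
    show "((\<lambda>h. \<theta> (z + h *\<^sub>R (0, 1))) has_real_derivative D2 (z + h *\<^sub>R (0, 1))) (at h)" for z h
      unfolding \<theta>_def D2_def
      by (auto intro!: derivative_eq_intros DERIV_chain2[OF \<alpha>d] DERIV_chain2[OF \<eta>'(1)])
  qed (use t d m D1b D2b' in auto)
  have "0 \<le> (LINT z|lborel. boxed_excess (t1/2) (t2 + 2) z * D1 z) + (LINT z|lborel. boxed_excess (t1/2) (t2 + 2) z * D2 z)"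
  proof (rule tendsto_lowerbound)
    show "(\<lambda>n. (LINT z|lborel. boxed (t1/2) (t2 + 2) (Jf (d n)) z * D1 z) + (LINT z|lborel. boxed (t1/2) (t2 + 2) (Jb (d n)) z * D2 z))
       \<longlonglongrightarrow> (LINT z|lborel. boxed_excess (t1/2) (t2 + 2) z * D1 z) + (LINT z|lborel. boxed_excess (t1/2) (t2 + 2) z * D2 z)"
      using t by (intro tendsto_add boxed_tendsto(1)[OF _ d m(2) D1b] boxed_tendsto(2)[OF _ d m(3) D2b']) auto
  qed (use ineq in auto)
  also have "\<dots> = (LINT z|lborel. boxed_excess (t1/2) (t2 + 2) z * D1 z + boxed_excess (t1/2) (t2 + 2) z * D2 z)"
  proof (rule Bochner_Integration.integral_add[symmetric])
    have i: "integrable lborel (boxed_excess (t1/2) (t2 + 2))" using t by (intro boxed_int excess_like_J) simp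
    have "integrable lborel (\<lambda>z. boxed_excess (t1/2) (t2 + 2) z * D z)"
      if "D \<in> borel_measurable borel" "\<And>z. \<bar>D z\<bar> \<le> L" for D
    proof (rule Bochner_Integration.integrable_bound)
      show "integrable lborel (\<lambda>z. L * boxed_excess (t1/2) (t2 + 2) z)" using i by (intro integrable_mult_right)
      show "AE z in lborel. norm (boxed_excess (t1/2) (t2 + 2) z * D z) \<le> norm (L * boxed_excess (t1/2) (t2 + 2) z)"
      proof (rule AE_I2)
        fix z show "norm (boxed_excess (t1/2) (t2 + 2) z * D z) \<le> norm (L * boxed_excess (t1/2) (t2 + 2) z)"
          using mult_left_mono[OF order_trans[OF that(2)[of z] abs_ge_self], of "\<bar>boxed_excess (t1/2) (t2 + 2) z\<bar>"]
          by (simp add: abs_mult mult.commute)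
      qed
      show "(\<lambda>z. boxed_excess (t1/2) (t2 + 2) z * D z) \<in> borel_measurable lborel"
        using boxed_meas[OF excess_like_J(3)] that(1) by measurable
    qed
    then show "integrable lborel (\<lambda>z. boxed_excess (t1/2) (t2 + 2) z * D1 z)" "integrable lborel (\<lambda>z. boxed_excess (t1/2) (t2 + 2) z * D2 z)"
      using m D1b D2b' by blast+
  qed
  \<comment> \<open>The terms with \<open>\<eta>'\<close> cancel between \<open>D1\<close> and
    \<open>D2\<close>; without this they would blow up as the mollifier concentrates.\<close>
  also have "(\<lambda>z. boxed_excess (t1/2) (t2 + 2) z * D1 z + boxed_excess (t1/2) (t2 + 2) z * D2 z)
     = (\<lambda>z. boxed_excess (t1/2) (t2 + 2) z * ((\<eta> (fst z - t1) - \<eta> (fst z - t2)) * \<eta> (snd z - fst z)))"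
    by (simp add: D1_def D2_def \<alpha>'_def algebra_simps)
  finally show ?thesis .
qed

text \<open>Formed with the given solutions instead of the representatives, so that it is continuous
  in both positive times and can be evaluated on the diagonal, a null set of the plane.\<close>

definition "total_excess t \<tau> = (LINT x|lebesgue. max 0 (u x t - (v x \<tau> + \<epsilon>)))"

lemma total_excess_int:
  assumes "t > 0" "\<tau> > 0"
  shows "integrable lebesgue (\<lambda>x. max 0 (u x t - (v x \<tau> + \<epsilon>)))"
proof (rule Bochner_Integration.integrable_bound)
  have i: "integrable lebesgue (\<lambda>x. u x t)" "integrable lebesgue (\<lambda>x. v x \<tau>)"
    using U.w_integrable V.w_integrable assms by blast+
  then show "integrable lebesgue (\<lambda>x. \<bar>u x t\<bar> + \<bar>v x \<tau>\<bar>)" by auto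
  have [measurable]: "(\<lambda>x. u x t) \<in> borel_measurable lebesgue" "(\<lambda>x. v x \<tau>) \<in> borel_measurable lebesgue"
    using i by auto
  show "(\<lambda>x. max 0 (u x t - (v x \<tau> + \<epsilon>))) \<in> borel_measurable lebesgue" by measurable
  show "AE x in lebesgue. norm (max 0 (u x t - (v x \<tau> + \<epsilon>))) \<le> norm (\<bar>u x t\<bar> + \<bar>v x \<tau>\<bar>)"
    using eps by (intro AE_I2) auto
qed

lemma total_excess_Lipschitz:
  assumes "t > 0" "\<tau> > 0" "t' > 0" "\<tau>' > 0"
  shows "\<bar>total_excess t \<tau> - total_excess t' \<tau>'\<bar> \<le> (LINT x|lebesgue. \<bar>u x t - u x t'\<bar>) + (LINT x|lebesgue. \<bar>v x \<tau> - v x \<tau>'\<bar>)"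
proof -
  note i = total_excess_int[OF assms(1,2)] total_excess_int[OF assms(3,4)]
  have iu: "integrable lebesgue (\<lambda>x. \<bar>u x t - u x t'\<bar>)" "integrable lebesgue (\<lambda>x. \<bar>v x \<tau> - v x \<tau>'\<bar>)"
    using U.w_integrable[of t] U.w_integrable[of t'] V.w_integrable[of \<tau>] V.w_integrable[of \<tau>'] assms by (auto intro!: integrable_abs)
  have "\<bar>total_excess t \<tau> - total_excess t' \<tau>'\<bar> = \<bar>LINT x|lebesgue. max 0 (u x t - (v x \<tau> + \<epsilon>)) - max 0 (u x t' - (v x \<tau>' + \<epsilon>))\<bar>"
    unfolding total_excess_def using i by simp
  also have "\<dots> \<le> (LINT x|lebesgue. \<bar>max 0 (u x t - (v x \<tau> + \<epsilon>)) - max 0 (u x t' - (v x \<tau>' + \<epsilon>))\<bar>)"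
    by (rule integral_abs_bound)
  also have "\<dots> \<le> (LINT x|lebesgue. \<bar>u x t - u x t'\<bar> + \<bar>v x \<tau> - v x \<tau>'\<bar>)"
    by (rule integral_mono[OF integrable_abs[OF Bochner_Integration.integrable_diff[OF i]] Bochner_Integration.integrable_add[OF iu]]) auto
  also have "\<dots> = (LINT x|lebesgue. \<bar>u x t - u x t'\<bar>) + (LINT x|lebesgue. \<bar>v x \<tau> - v x \<tau>'\<bar>)"
    using iu by simp
  finally show ?thesis .
qed

lemma total_excess_eq:
  assumes "U.good t" "V.good \<tau>"
  shows "avg (\<lambda>r k. max 0 (r - k)) (t, \<tau>) = total_excess t \<tau>"
  unfolding total_excess_def avg_def fst_conv snd_conv
proof (rule lebesgue_AE_eq_borel(2)[symmetric])
  show "AE x in lborel. max 0 (u x t - (v x \<tau> + \<epsilon>)) = max 0 (a (x, t) - (b (x, \<tau>) + \<epsilon>))"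
    using U.goodD(2)[OF assms(1)] V.goodD(2)[OF assms(2)] by eventually_elim simp
qed measurable

lemma total_excess_near_diagonal:
  assumes "t > 0" "e > 0"
  shows "\<exists>\<delta>>0. \<forall>t' \<tau>'. t' \<in> {t..t + \<delta>} \<and> \<tau>' \<in> {t..t + \<delta>} \<longrightarrow> \<bar>total_excess t' \<tau>' - total_excess t t\<bar> \<le> e"
proof -
  obtain d1 where d1: "d1 > 0" "\<And>t'. t' \<noteq> t \<Longrightarrow> dist t' t < d1 \<Longrightarrow> \<bar>LINT x|lebesgue. \<bar>u x t' - u x t\<bar>\<bar> < e/2"
    using tendstoD[OF U.L1_tendsto[OF assms(1)], of "e/2"] assms(2) by (auto simp: eventually_at)
  obtain d2 where d2: "d2 > 0" "\<And>t'. t' \<noteq> t \<Longrightarrow> dist t' t < d2 \<Longrightarrow> \<bar>LINT x|lebesgue. \<bar>v x t' - v x t\<bar>\<bar> < e/2"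
    using tendstoD[OF V.L1_tendsto[OF assms(1)], of "e/2"] assms(2) by (auto simp: eventually_at)
  define \<delta> where "\<delta> = min d1 d2 / 2"
  have \<delta>: "0 < \<delta>" "\<delta> < d1" "\<delta> < d2" using d1(1) d2(1) by (auto simp: \<delta>_def min_def)
  have a: "(LINT x|lebesgue. \<bar>u x t' - u x t\<bar>) \<le> e/2" if "t' \<in> {t..t + \<delta>}" for t'
    using d1(2)[of t'] that d1(1) d2(1) assms(2) \<delta> by (cases "t' = t") (auto simp: dist_real_def)
  have b: "(LINT x|lebesgue. \<bar>v x t' - v x t\<bar>) \<le> e/2" if "t' \<in> {t..t + \<delta>}" for t'
    using d2(2)[of t'] that d1(1) d2(1) assms(2) \<delta> by (cases "t' = t") (auto simp: dist_real_def)
  have "\<bar>total_excess t' \<tau>' - total_excess t t\<bar> \<le> e" if "t' \<in> {t..t + \<delta>}" "\<tau>' \<in> {t..t + \<delta>}" for t' \<tau>'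
    using total_excess_Lipschitz[of t' \<tau>' t t] a[OF that(1)] b[OF that(2)] that assms by auto
  then show ?thesis using \<delta>(1) by blast
qed

text \<open>Two averages in succession: over the second time, within \<open>k\<close> after the
  first one, and then over the first time, within \<open>k\<close> after \<open>t\<close>. Both
  times therefore stay within \<open>2 * k\<close> of \<open>t\<close>, which explains the window of
  the hypothesis.\<close>

lemma diagonal_average:
  assumes t: "0 < t" "0 < T0" "T0 \<le> t" "t + 2 * k \<le> T2" and k: "0 < k" and st: "smooth_step k \<eta> H"
    and near: "\<And>t' \<tau>'. t' \<in> {t..t + 2 * k} \<Longrightarrow> \<tau>' \<in> {t..t + 2 * k} \<Longrightarrow> \<bar>total_excess t' \<tau>' - total_excess t t\<bar> \<le> e"
  shows "integrable lborel (\<lambda>z. boxed_excess T0 T2 z * (\<eta> (fst z - t) * \<eta> (snd z - fst z)))"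
    "\<bar>(LINT z|lborel. boxed_excess T0 T2 z * (\<eta> (fst z - t) * \<eta> (snd z - fst z))) - total_excess t t\<bar> \<le> e"
proof -
  have \<eta>s: "smooth_fun \<eta>" and \<eta>out: "\<And>r. r \<notin> {0..k} \<Longrightarrow> \<eta> r = 0" using st unfolding smooth_step_def by blast+
  obtain B where B: "\<And>r. \<bar>\<eta> r\<bar> \<le> B" using st unfolding smooth_step_def by blast
  have ce: "continuous_on UNIV \<eta>" using smooth_fun_imp_continuous \<eta>s by blast
  have [measurable]: "\<eta> \<in> borel_measurable borel" using ce by (rule borel_measurable_continuous_onI)
  have Em[measurable]: "boxed_excess T0 T2 \<in> borel_measurable borel" by (rule boxed_meas[OF excess_like_J(3)])
  have wm: "(\<lambda>z. \<eta> (fst z - t) * \<eta> (snd z - fst z)) \<in> borel_measurable borel"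
    by (intro borel_measurable_continuous_onI continuous_intros continuous_on_compose2[OF ce]; simp)
  show int: "integrable lborel (\<lambda>z. boxed_excess T0 T2 z * (\<eta> (fst z - t) * \<eta> (snd z - fst z)))"
  proof (rule Bochner_Integration.integrable_bound)
    show "integrable lborel (\<lambda>z. (B * B) * boxed_excess T0 T2 z)"
      by (intro integrable_mult_right boxed_int t excess_like_J)
    show "AE z in lborel. norm (boxed_excess T0 T2 z * (\<eta> (fst z - t) * \<eta> (snd z - fst z))) \<le> norm ((B * B) * boxed_excess T0 T2 z)"
    proof (rule AE_I2)
      fix z
      have "\<bar>\<eta> (fst z - t)\<bar> * \<bar>\<eta> (snd z - fst z)\<bar> \<le> B * B"
        using order_trans[OF abs_ge_zero B] by (intro mult_mono B) auto
      from mult_left_mono[OF order_trans[OF this abs_ge_self], of "\<bar>boxed_excess T0 T2 z\<bar>"]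
      show "norm (boxed_excess T0 T2 z * (\<eta> (fst z - t) * \<eta> (snd z - fst z))) \<le> norm ((B * B) * boxed_excess T0 T2 z)"
        using order_trans[OF abs_ge_zero B] by (simp add: abs_mult mult_ac)
    qed
    show "(\<lambda>z. boxed_excess T0 T2 z * (\<eta> (fst z - t) * \<eta> (snd z - fst z))) \<in> borel_measurable lborel"
      using Em wm by measurable
  qed
  define m where "m r = (LINT \<tau>|lborel. \<eta> (\<tau> - r) * boxed_excess T0 T2 (r, \<tau>))" for r
  have sec: "(\<lambda>\<tau>. boxed_excess T0 T2 (r, \<tau>)) \<in> borel_measurable borel" for r
    by (rule borel_comp_continuous[OF Em]) (intro continuous_intros)
  have mm: "m \<in> borel_measurable borel"
  proof -
    have "(\<lambda>z. \<eta> (snd z - fst z)) \<in> borel_measurable borel"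
      by (intro borel_measurable_continuous_onI continuous_intros continuous_on_compose2[OF ce]; simp)
    then have "(\<lambda>(r, \<tau>). \<eta> (\<tau> - r) * boxed_excess T0 T2 (r, \<tau>)) \<in> borel_measurable (lborel \<Otimes>\<^sub>M lborel)"
      unfolding lborel_prod case_prod_unfold prod.collapse using Em by measurable
    from lborel.borel_measurable_lebesgue_integral[OF this] show ?thesis unfolding m_def by simp
  qed
  have "AE r in lborel. r \<in> {t..t + k} \<longrightarrow> \<bar>m r - total_excess t t\<bar> \<le> e"
    using U.AE_good
  proof eventually_elim
    case (elim r)
    show ?case
    proof
      assume r: "r \<in> {t..t + k}"
      then have g: "U.good r" using elim t by auto
      have "AE \<tau> in lborel. \<tau> \<in> {r..r + k} \<longrightarrow> \<bar>boxed_excess T0 T2 (r, \<tau>) - total_excess t t\<bar> \<le> e"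
        using V.AE_good
      proof eventually_elim
        case (elim \<tau>)
        show ?case
        proof
          assume \<tau>: "\<tau> \<in> {r..r + k}"
          then have "V.good \<tau>" using elim r t by auto
          then have "boxed_excess T0 T2 (r, \<tau>) = total_excess r \<tau>"
            using total_excess_eq[OF g] r \<tau> t k by (simp add: boxed_def)
          then show "\<bar>boxed_excess T0 T2 (r, \<tau>) - total_excess t t\<bar> \<le> e"
            using near[of r \<tau>] r \<tau> by auto
        qed
      qed
      from smooth_step_average(2)[OF st sec this]
      show "\<bar>m r - total_excess t t\<bar> \<le> e" unfolding m_def .
    qed
  qed
  from smooth_step_average(2)[OF st mm this]
  have res: "\<bar>(LINT r|lborel. \<eta> (r - t) * m r) - total_excess t t\<bar> \<le> e" .
  have int': "integrable (lborel \<Otimes>\<^sub>M lborel) (\<lambda>z. boxed_excess T0 T2 z * (\<eta> (fst z - t) * \<eta> (snd z - fst z)))"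
    using int unfolding lborel_prod .
  have "(LINT z|lborel. boxed_excess T0 T2 z * (\<eta> (fst z - t) * \<eta> (snd z - fst z)))
     = (LINT r|lborel. LINT \<tau>|lborel. boxed_excess T0 T2 (r, \<tau>) * (\<eta> (r - t) * \<eta> (\<tau> - r)))"
    using lborel_pair.integral_fst'[OF int'] unfolding lborel_prod by simp
  also have "\<dots> = (LINT r|lborel. \<eta> (r - t) * m r)"
    unfolding m_def integral_mult_right_zero[symmetric] by (simp add: mult_ac)
  finally show "\<bar>(LINT z|lborel. boxed_excess T0 T2 z * (\<eta> (fst z - t) * \<eta> (snd z - fst z))) - total_excess t t\<bar> \<le> e"
    using res by simp
qed

lemma total_excess_antimono:
  assumes t: "0 < t1" "t1 < t2"
  shows "total_excess t2 t2 \<le> total_excess t1 t1"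
proof (rule field_le_epsilon)
  fix e :: real assume e: "e > 0"
  have t2: "t2 > 0" using t by simp
  obtain d1 where d1: "d1 > 0" "\<And>t' \<tau>'. t' \<in> {t1..t1 + d1} \<Longrightarrow> \<tau>' \<in> {t1..t1 + d1} \<Longrightarrow> \<bar>total_excess t' \<tau>' - total_excess t1 t1\<bar> \<le> e/2"
    using total_excess_near_diagonal[OF t(1), of "e/2"] e by auto
  obtain d2 where d2: "d2 > 0" "\<And>t' \<tau>'. t' \<in> {t2..t2 + d2} \<Longrightarrow> \<tau>' \<in> {t2..t2 + d2} \<Longrightarrow> \<bar>total_excess t' \<tau>' - total_excess t2 t2\<bar> \<le> e/2"
    using total_excess_near_diagonal[OF t2, of "e/2"] e by auto
  \<comment> \<open>The bound 1 is required by \<open>diagonal_inequality\<close>; half of the radii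
    makes the windows of length \<open>2 * k\<close> fit at both end times.\<close>
  define k where "k = min 1 (min d1 d2 / 2)"
  have k: "0 < k" "k \<le> 1" "2 * k \<le> d1" "2 * k \<le> d2" using d1(1) d2(1) by (auto simp: k_def)
  obtain \<eta> H where st: "smooth_step k \<eta> H" using smooth_step_ex[OF k(1)] by blast
  note A1 = diagonal_average[of t1 "t1/2" k "t2 + 2" \<eta> H "e/2"]
  note A2 = diagonal_average[of t2 "t1/2" k "t2 + 2" \<eta> H "e/2"]
  let ?E = "boxed_excess (t1/2) (t2 + 2)"
  have a1: "integrable lborel (\<lambda>z. ?E z * (\<eta> (fst z - t1) * \<eta> (snd z - fst z)))"
    "\<bar>(LINT z|lborel. ?E z * (\<eta> (fst z - t1) * \<eta> (snd z - fst z))) - total_excess t1 t1\<bar> \<le> e/2"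
    by (rule A1; use t k st d1(2) in auto)+
  have a2: "integrable lborel (\<lambda>z. ?E z * (\<eta> (fst z - t2) * \<eta> (snd z - fst z)))"
    "\<bar>(LINT z|lborel. ?E z * (\<eta> (fst z - t2) * \<eta> (snd z - fst z))) - total_excess t2 t2\<bar> \<le> e/2"
    by (rule A2; use t k st d2(2) in auto)+
  have "0 \<le> (LINT z|lborel. ?E z * ((\<eta> (fst z - t1) - \<eta> (fst z - t2)) * \<eta> (snd z - fst z)))"
    by (rule diagonal_inequality[OF t k(1,2) st])
  also have "\<dots> = (LINT z|lborel. ?E z * (\<eta> (fst z - t1) * \<eta> (snd z - fst z))) - (LINT z|lborel. ?E z * (\<eta> (fst z - t2) * \<eta> (snd z - fst z)))"
    using a1(1) a2(1) by (simp add: left_diff_distrib right_diff_distrib)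
  finally show "total_excess t2 t2 \<le> total_excess t1 t1 + e" using a1(2) a2(2) by linarith
qed

end

section \<open>Return to the given solutions and their initial data\<close>

lemma L1_cont_subset:
  assumes "L1_cont T u" "S \<subseteq> T"
  shows "L1_cont S u"
  using assms unfolding L1_cont_def by (blast intro: tendsto_within_subset)

lemma AE_lebesgue_lborel: "(AE z in lebesgue. R z) \<longleftrightarrow> (AE z in (lborel :: 'a::euclidean_space measure). R z)"
  by (rule AE_completion_iff)

theorem theorem7p1:
  fixes u0 :: "'a::euclidean_space \<Rightarrow> real"
    and u v :: "'a \<Rightarrow> real \<Rightarrow> real"
    and s n \<epsilon> :: real
  assumes "0 < s" "s < 1" "n \<ge> 0"
    and "integrable lebesgue u0" "AE x in lebesgue. u0 x \<ge> 0"
    and "strong_solution n s u" "initial_datum u u0"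
    and "\<epsilon> > 0"
    and "approx_weak_solution n s \<epsilon> u0 v"
  shows "AE z in lebesgue. snd z > 0 \<longrightarrow> u (fst z) (snd z) \<le> v (fst z) (snd z) + \<epsilon>"
proof -
  have u: "jmeas u" "AE z in lebesgue. snd z > 0 \<longrightarrow> u (fst z) (snd z) > 0" "L1_cont {0<..} u"
    "L2loc_Hs s (\<lambda>x t. phi n (u x t))" "weak_eq s (phi n) u"
    using assms(6) unfolding strong_solution_def weak_solution_def by blast+
  have v: "jmeas v" "AE z in lebesgue. snd z \<ge> 0 \<longrightarrow> v (fst z) (snd z) \<ge> 0" "L1_cont {0..} v"
    "AE x in lebesgue. v x 0 = u0 x" "L2loc_Hs s (\<lambda>x t. phi_eps n \<epsilon> (v x t))" "weak_eq s (phi_eps n \<epsilon>) v"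
    using assms(9) unfolding approx_weak_solution_def by blast+
  obtain a0 where a0: "a0 \<in> borel_measurable lborel" "AE z in lborel. u (fst z) (snd z) = a0 z"
    using completion_ex_borel_measurable_real[OF u(1)[unfolded jmeas_def]] by blast
  obtain b0 where b0: "b0 \<in> borel_measurable lborel" "AE z in lborel. v (fst z) (snd z) = b0 z"
    using completion_ex_borel_measurable_real[OF v(1)[unfolded jmeas_def]] by blast
  \<comment> \<open>Both representatives are altered so that the sign conditions hold at every
    point. At positive times this affects a null set only; at other times the values are
    immaterial.\<close>
  define a where "a z = (if a0 z > 0 then a0 z else 1)" for z
  define b where "b z = max 0 (b0 z)" for z
  have am: "a \<in> borel_measurable borel" and bm: "b \<in> borel_measurable borel"
    unfolding a_def b_def using a0(1) b0(1) by simp_all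
  have ae_a: "AE z in lborel. snd z > 0 \<longrightarrow> u (fst z) (snd z) = a z"
    using a0(2) u(2)[unfolded AE_lebesgue_lborel] by eventually_elim (auto simp: a_def)
  have ae_b: "AE z in lborel. snd z > 0 \<longrightarrow> v (fst z) (snd z) = b z"
    using b0(2) v(2)[unfolded AE_lebesgue_lborel] by eventually_elim (auto simp: b_def)
  interpret ph: strict_mono_pos "phi n" by (rule strict_mono_pos_phi[OF assms(3)])
  interpret dbl: doubling s "phi n" "phi_eps n \<epsilon>" u v a b \<epsilon> "phi n \<epsilon>"
  proof
    show "phi_eps n \<epsilon> \<in> borel_measurable borel"
      unfolding phi_eps_def using ph.\<phi>_meas by measurable
    show "L1_cont {0<..} v" by (rule L1_cont_subset[OF v(3)]) auto
  qed (use assms(1,2,8) u v am bm ae_a ae_b ph.\<phi>_mono in \<open>auto simp: a_def b_def phi_eps_def\<close>)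
  have u0i: "integrable lebesgue u0" by fact
  have v_int: "integrable lebesgue (\<lambda>x. v x t)" if "t \<ge> 0" for t
    using v(3) that unfolding L1_cont_def by auto
  have "((\<lambda>t. (LINT x|lebesgue. \<bar>u x t - u0 x\<bar>) + (LINT x|lebesgue. \<bar>v x t - v x 0\<bar>)) \<longlongrightarrow> 0 + 0) (at_right 0)"
  proof (rule tendsto_add)
    show "((\<lambda>t. LINT x|lebesgue. \<bar>u x t - u0 x\<bar>) \<longlongrightarrow> 0) (at_right 0)"
      using assms(7) unfolding initial_datum_def .
    have "((\<lambda>t. LINT x|lebesgue. \<bar>v x t - v x 0\<bar>) \<longlongrightarrow> 0) (at 0 within {0..})"
      using conjunct2[OF v(3)[unfolded L1_cont_def]] by simp
    then show "((\<lambda>t. LINT x|lebesgue. \<bar>v x t - v x 0\<bar>) \<longlongrightarrow> 0) (at_right 0)"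
      by (rule tendsto_within_subset) auto
  qed
  \<comment> \<open>Both solutions start from \<open>u0\<close>, up to the lift by
    \<open>\<epsilon>\<close>, which only lowers the excess. So the excess at time \<open>t\<close>
    is bounded by the distances of both solutions from their initial values.\<close>
  moreover have "dbl.total_excess t t \<le> (LINT x|lebesgue. \<bar>u x t - u0 x\<bar>) + (LINT x|lebesgue. \<bar>v x t - v x 0\<bar>)" if t: "t > 0" for t
  proof -
    have i: "integrable lebesgue (\<lambda>x. \<bar>u x t - u0 x\<bar>)" "integrable lebesgue (\<lambda>x. \<bar>v x t - v x 0\<bar>)"
      using dbl.U.w_integrable[OF t] u0i v_int[of t] v_int[of 0] t by (auto intro!: integrable_abs)
    have "dbl.total_excess t t \<le> (LINT x|lebesgue. \<bar>u x t - u0 x\<bar> + \<bar>v x t - v x 0\<bar>)"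
      unfolding dbl.total_excess_def
    proof (rule integral_mono_AE[OF dbl.total_excess_int[OF t t] Bochner_Integration.integrable_add[OF i]])
      show "AE x in lebesgue. max 0 (u x t - (v x t + \<epsilon>)) \<le> \<bar>u x t - u0 x\<bar> + \<bar>v x t - v x 0\<bar>"
        using v(4) by eventually_elim (use assms(8) in auto)
    qed
    then show ?thesis using i by simp
  qed
  ultimately have lim0: "\<And>e. e > 0 \<Longrightarrow> \<exists>t0>0. \<forall>t. 0 < t \<and> t < t0 \<longrightarrow> dbl.total_excess t t < e"
    by (force simp: tendsto_iff eventually_at_right_field dist_real_def)
  \<comment> \<open>Monotonicity compares with arbitrarily early times, where the excess is
    arbitrarily small.\<close>
  have zero: "dbl.total_excess t t = 0" if t: "t > 0" for t
  proof (rule antisym)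
    show "dbl.total_excess t t \<le> 0"
    proof (rule field_le_epsilon)
      fix e :: real assume "e > 0"
      then obtain t0 where t0: "t0 > 0" "\<And>t. 0 < t \<Longrightarrow> t < t0 \<Longrightarrow> dbl.total_excess t t < e" using lim0 by blast
      define r where "r = min (t0 / 2) (t / 2)"
      have r: "0 < r" "r < t0" "r < t" using t0(1) t by (auto simp: r_def)
      show "dbl.total_excess t t \<le> 0 + e"
        using dbl.total_excess_antimono[OF r(1,3)] t0(2)[OF r(1,2)] by simp
    qed
    show "0 \<le> dbl.total_excess t t" unfolding dbl.total_excess_def
      by (intro Bochner_Integration.integral_nonneg) simp
  qed
  \<comment> \<open>Formed with the Borel representatives, so that \<open>N\<close> is a Borel set
    and vanishing of almost every time slice implies that \<open>N\<close> itself is null.\<close>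
  define N where "N = {z. snd z > 0 \<and> a z > b z + \<epsilon>}"
  have Nm: "N \<in> sets borel"
  proof -
    have "(\<lambda>z::'a\<times>real. snd z) \<in> borel_measurable borel"
      by (intro borel_measurable_continuous_onI continuous_intros)
    note [measurable] = this am bm
    have "Measurable.pred borel (\<lambda>z. snd z > 0 \<and> a z > b z + \<epsilon>)" by measurable
    then show ?thesis unfolding N_def by (simp add: pred_def)
  qed
  have "AE t in lborel. AE x in lborel. (x, t) \<notin> N"
    using dbl.U.AE_good dbl.V.AE_good
  proof eventually_elim
    case (elim t)
    show ?case
    proof (cases "t > 0")
      case True
      have "AE x in lebesgue. max 0 (u x t - (v x t + \<epsilon>)) = 0"
        using integral_nonneg_eq_0_iff_AE[OF dbl.total_excess_int[OF True True]] zero[OF True]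
        unfolding dbl.total_excess_def by simp
      then have "AE x in lborel. max 0 (u x t - (v x t + \<epsilon>)) = 0" unfolding AE_lebesgue_lborel .
      moreover have "AE x in lborel. u x t = a (x, t)" "AE x in lborel. v x t = b (x, t)"
        using dbl.U.goodD(2) dbl.V.goodD(2) elim True by blast+
      ultimately show ?thesis by eventually_elim (auto simp: N_def)
    qed (simp add: N_def)
  qed
  from AE_lborel_sectionsI[OF Nm this]
  have "AE z in lborel. snd z > 0 \<longrightarrow> u (fst z) (snd z) \<le> v (fst z) (snd z) + \<epsilon>"
    using ae_a ae_b by eventually_elim (auto simp: N_def)
  then show ?thesis unfolding AE_lebesgue_lborel .
qed

end
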